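(* There exists a universal constant $K$ such that for fixed $d\ge2$ and for all positive sequences $\varepsilon_{\ell,d}$, $$\mu_\ell\bigl\{\alpha_\ell : d_{Kol}(h_{\alpha,\ell,d}(X),Z)>\varepsilon_{\ell,d}\bigr\}\le\frac{K}{n_{\ell d}\,\varepsilon_{\ell,d}^3}=O\left(\frac1{\ell^{d-1}\varepsilon_{\ell,d}^3}\right)\qquad\text{as }\ell\to\infty.$$ Likewise, there exists a universal constant $K'$ such that for fixed $\ell\ge1$ and for all positive sequences $\varepsilon_{\ell,d}$, $$\mu_\ell\bigl\{\alpha_{\ell,d} : d_{Kol}(h_{\alpha,\ell,d}(X),Z)>\varepsilon_{\ell,d}\bigr\}\le\frac{K'}{n_{\ell d}\,\varepsilon_{\ell,d}^3}=O\left(\frac1{d^{\ell}\varepsilon_{\ell,d}^3}\right)\qquad\text{as }d\to\infty.$$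
   Context: Let $S^d\subset\mathbb R^{d+1}$ be the unit sphere with normalized (total mass one) Lebesgue measure $dx$. For $\ell\ge1$ let $\{Y_{\ell m}: 1\le m\le n_{\ell d}\}$ be a real orthonormal basis (in $L^2$ of the normalized measure) of the eigenspace $\{f:\Delta_{S^d}f=-\ell(\ell+d-1)f\}$ of the Laplace--Beltrami operator, where $n_{\ell d}=\frac{2\ell+d-1}{\ell}\binom{\ell+d-2}{\ell-1}$ is its dimension. For $\alpha_\ell=\alpha_{\ell,d}=(\alpha_{\ell1},\dots,\alpha_{\ell n_{\ell d}})$ in the unit sphere $S^{n_{\ell d}-1}\subset\mathbb R^{n_{\ell d}}$ put $h_{\alpha,\ell}=h_{\alpha,\ell,d}=\sum_{m=1}^{n_{\ell d}}\alpha_{\ell m}Y_{\ell m}$; $\mu_\ell$ (which also depends on $d$) is the normalized Lebesgue (uniform) probability measure on $S^{n_{\ell d}-1}$. $X$ is uniformly distributed on $S^d$, $Z$ is a standard Gaussian variable with distribution function $\Phi$, and for fixed $\alpha_\ell$ the Kolmogorov distance is $$d_{Kol}(h_{\alpha,\ell}(X),Z)=\sup_{u\in\mathbb R}\left|\int_{S^d}1_{(-\infty,u]}(h_{\alpha,\ell}(x))\,dx-\Phi(u)\right|.$$ *)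

theory Defs
  imports "HOL-Probability.Probability" "HOL-Library.Landau_Symbols"
begin

text \<open>
  All dimensions vary inside the statement, so a vector of \<open>\<real>\<^sup>N\<close> is an extensional
  function on an index set \<open>I\<close> with \<open>N\<close> elements: \<open>\<real>\<^sup>d\<^sup>+\<^sup>1\<close> is indexed by \<open>{..d}\<close>, and the
  coefficient vectors by \<open>{1..n}\<close>.  Functions on the sphere are functions on the whole type
  \<open>nat \<Rightarrow> real\<close> of which only the values on the sphere matter.
\<close>

definition unit_sphere :: "nat set \<Rightarrow> (nat \<Rightarrow> real) set"
  where "unit_sphere I = {x \<in> I \<rightarrow>\<^sub>E UNIV. L2_set x I = 1}"

definition normalize_vec :: "nat set \<Rightarrow> (nat \<Rightarrow> real) \<Rightarrow> (nat \<Rightarrow> real)"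
  where "normalize_vec I x = (\<lambda>i\<in>I. x i / L2_set x I)"

definition unit_ball :: "nat set \<Rightarrow> (nat \<Rightarrow> real) set"
  where "unit_ball I = {x \<in> I \<rightarrow>\<^sub>E UNIV. L2_set x I \<le> 1}"

text \<open>
  Normalized Lebesgue (surface) measure: the mass of \<open>A\<close> is the volume of the cone
  \<open>{t x | x \<in> A, 0 < t \<le> 1}\<close> divided by the volume of the unit ball.  The centre of the ball is
  sent to \<open>0\<close>, off the sphere, but it is a null set.
\<close>

definition sphere_measure :: "nat set \<Rightarrow> (nat \<Rightarrow> real) measure"
  where "sphere_measure I =
    restrict_space
      (distr (uniform_measure (\<Pi>\<^sub>M i\<in>I. lborel) (unit_ball I)) (\<Pi>\<^sub>M i\<in>I. lborel) (normalize_vec I))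
      (unit_sphere I)"

lemma sphere_measure_prob:
  assumes I: "finite I" "I \<noteq> {}"
  shows "prob_space (sphere_measure I)" "space (sphere_measure I) = unit_sphere I"
proof -
  let ?M = "\<Pi>\<^sub>M i\<in>I. (lborel::real measure)"
  interpret product_sigma_finite "\<lambda>_. lborel :: real measure" by standard
  interpret finite_product_sigma_finite "\<lambda>_. lborel :: real measure" I
    by standard (rule I)
  have L2[measurable]: "(\<lambda>x. L2_set x I) \<in> borel_measurable ?M"
    unfolding L2_set_def by measurable
  have B[measurable]: "unit_ball I \<in> sets ?M"
  proof -
    have "unit_ball I = {x \<in> space ?M. L2_set x I \<le> 1}" by (simp add: unit_ball_def space_PiM)
    then show ?thesis by simp
  qed
  have S[measurable]: "unit_sphere I \<in> sets ?M"
  proof -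
    have "unit_sphere I = {x \<in> space ?M. L2_set x I = 1}" by (simp add: unit_sphere_def space_PiM)
    then show ?thesis by simp
  qed
  have N[measurable]: "normalize_vec I \<in> measurable ?M ?M"
    unfolding normalize_vec_def by measurable
  have box: "emeasure ?M (PiE I (\<lambda>_. {-a..a})) = ennreal ((2*a) ^ card I)" if "a \<ge> 0" for a :: real
    using that by (subst emeasure_PiM) (auto simp: I prod_ennreal ennreal_power)
  have fin: "emeasure ?M (unit_ball I) \<noteq> \<infinity>"
  proof -
    have "unit_ball I \<subseteq> PiE I (\<lambda>_. {-1..1})"
    proof
      fix x assume x: "x \<in> unit_ball I"
      have "\<bar>x i\<bar> \<le> 1" if "i \<in> I" for i
      proof -
        have "(x i)^2 \<le> (\<Sum>i\<in>I. (x i)^2)" using I that by (intro member_le_sum) auto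
        also have "\<dots> \<le> 1" using x by (simp add: unit_ball_def L2_set_def)
        finally show ?thesis by (simp add: abs_square_le_1)
      qed
      then show "x \<in> PiE I (\<lambda>_. {-1..1})" using x by (force simp: unit_ball_def PiE_iff abs_le_iff)
    qed
    then have "emeasure ?M (unit_ball I) \<le> emeasure ?M (PiE I (\<lambda>_. {-1..1}))"
      by (intro emeasure_mono) (auto intro!: sets_PiM_I_finite I)
    then show ?thesis using box[of 1] by (auto simp: top_unique)
  qed
  have pos: "emeasure ?M (unit_ball I) \<noteq> 0"
  proof -
    let ?a = "1 / real (card I)"
    have c: "card I > 0" using I by (simp add: card_gt_0_iff)
    have "PiE I (\<lambda>_. {-?a..?a}) \<subseteq> unit_ball I"
    proof
      fix x assume x: "x \<in> PiE I (\<lambda>_. {-?a..?a})"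
      have "L2_set x I \<le> (\<Sum>i\<in>I. \<bar>x i\<bar>)" by (rule L2_set_le_sum_abs)
      also have "\<dots> \<le> (\<Sum>i\<in>I. ?a)" using x by (intro sum_mono) (force simp: PiE_iff abs_le_iff)
      also have "\<dots> = 1" using c by simp
      finally show "x \<in> unit_ball I" using x by (auto simp: unit_ball_def PiE_iff)
    qed
    then have "emeasure ?M (PiE I (\<lambda>_. {-?a..?a})) \<le> emeasure ?M (unit_ball I)"
      by (intro emeasure_mono) auto
    then show ?thesis using box[of ?a] c by auto
  qed
  let ?U = "uniform_measure ?M (unit_ball I)"
  interpret U: prob_space ?U by (rule prob_space_uniform_measure[OF pos fin])
  let ?D = "distr ?U ?M (normalize_vec I)"
  interpret D: prob_space ?D by (rule U.prob_space_distr) simp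
  have z: "emeasure ?M (PiE I (\<lambda>_. {0})) = 0" using box[of 0] I by (simp add: card_gt_0_iff)
  have "AE x in ?M. x \<notin> PiE I (\<lambda>_. {0})"
    by (rule AE_not_in, rule null_setsI[OF z], rule sets_PiM_I_finite) (use I in simp_all)
  then have "AE x in ?M. x \<in> unit_ball I \<longrightarrow> normalize_vec I x \<in> unit_sphere I"
  proof (rule AE_mp, intro AE_I2 impI)
    fix x assume x: "x \<in> space ?M" "x \<notin> PiE I (\<lambda>_. {0})"
    have e: "x \<in> extensional I" using x(1) by (simp add: space_PiM PiE_def)
    have "L2_set x I \<noteq> 0"
    proof
      assume "L2_set x I = 0"
      then have "\<forall>i\<in>I. x i = 0" using I by (simp add: L2_set_eq_0_iff)
      with e have "x \<in> PiE I (\<lambda>_. {0})" unfolding PiE_def Pi_def by blast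
      with x(2) show False by contradiction
    qed
    then have n: "L2_set x I > 0" using L2_set_nonneg[of x I] by linarith
    have "L2_set (normalize_vec I x) I = L2_set (\<lambda>i. (1 / L2_set x I) * x i) I"
      by (rule L2_set_cong) (auto simp: normalize_vec_def)
    also have "\<dots> = 1" using n by (subst L2_set_right_distrib[symmetric]) auto
    finally show "normalize_vec I x \<in> unit_sphere I"
      by (simp add: unit_sphere_def) (simp add: normalize_vec_def)
  qed
  then have "AE x in ?U. normalize_vec I x \<in> unit_sphere I"
    by (intro AE_uniform_measureI) auto
  then have "AE x in ?D. x \<in> unit_sphere I" by (subst AE_distr_iff) auto
  then have "emeasure ?D (unit_sphere I) = 1" using D.emeasure_eq_1_AE by simp
  then have "emeasure (sphere_measure I) (unit_sphere I) = 1"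
    unfolding sphere_measure_def by (subst emeasure_restrict_space) auto
  moreover show sp: "space (sphere_measure I) = unit_sphere I"
    by (auto simp: sphere_measure_def space_restrict_space unit_sphere_def space_PiM)
  ultimately show "prob_space (sphere_measure I)" by (intro prob_spaceI) simp
qed

definition partial_deriv :: "nat \<Rightarrow> ((nat \<Rightarrow> real) \<Rightarrow> real) \<Rightarrow> (nat \<Rightarrow> real) \<Rightarrow> real"
  where "partial_deriv i F x = deriv (\<lambda>t. F (x(i := t))) (x i)"

text \<open>
  \<open>Ck I k U F\<close>: all partial derivatives of \<open>F\<close> of order at most \<open>k\<close> exist and are continuous
  on \<open>U\<close>, a relatively open set of vectors indexed by \<open>I\<close>.
\<close>

primrec Ck :: "nat set \<Rightarrow> nat \<Rightarrow> (nat \<Rightarrow> real) set \<Rightarrow> ((nat \<Rightarrow> real) \<Rightarrow> real) \<Rightarrow> bool"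
  where
    "Ck I 0 U F \<longleftrightarrow> continuous_on U F"
  | "Ck I (Suc k) U F \<longleftrightarrow> continuous_on U F \<and>
       (\<forall>i\<in>I. (\<forall>x\<in>U. (\<lambda>t. F (x(i := t))) differentiable (at (x i))) \<and>
               Ck I k U (partial_deriv i F))"

text \<open>
  The smooth structure and the Laplace--Beltrami operator of the round sphere \<open>S\<^sup>d\<close> are those of
  the ambient space applied to the extension of \<open>f\<close> that is constant along rays.
\<close>

definition radial_ext :: "nat \<Rightarrow> ((nat \<Rightarrow> real) \<Rightarrow> real) \<Rightarrow> (nat \<Rightarrow> real) \<Rightarrow> real"
  where "radial_ext d f x = f (normalize_vec {..d} x)"

definition smooth_on_sphere :: "nat \<Rightarrow> ((nat \<Rightarrow> real) \<Rightarrow> real) \<Rightarrow> bool"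
  where "smooth_on_sphere d f \<longleftrightarrow>
    (\<forall>k. Ck {..d} k {x \<in> {..d} \<rightarrow>\<^sub>E UNIV. L2_set x {..d} \<noteq> 0} (radial_ext d f))"

definition laplace_beltrami :: "nat \<Rightarrow> ((nat \<Rightarrow> real) \<Rightarrow> real) \<Rightarrow> (nat \<Rightarrow> real) \<Rightarrow> real"
  where "laplace_beltrami d f x = (\<Sum>i\<le>d. partial_deriv i (partial_deriv i (radial_ext d f)) x)"

definition eigenspace :: "nat \<Rightarrow> nat \<Rightarrow> ((nat \<Rightarrow> real) \<Rightarrow> real) set"
  where "eigenspace l d = {f. smooth_on_sphere d f \<and>
    (\<forall>x\<in>unit_sphere {..d}. laplace_beltrami d f x = - (real l * (real l + real d - 1)) * f x)}"

text \<open>The division by \<open>l\<close> is exact for \<open>l, d \<ge> 1\<close>, see \<open>real_eigendim\<close>.\<close>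

definition eigendim :: "nat \<Rightarrow> nat \<Rightarrow> nat"
  where "eigendim l d = ((2 * l + d - 1) * ((l + d - 2) choose (l - 1))) div l"

lemma eigendim_altdef:
  assumes "l \<ge> 1" "d \<ge> 1"
  shows "eigendim l d = ((l + d - 2) choose (l - 1)) + ((l + d - 1) choose l)"
proof -
  obtain k e where ke: "l = Suc k" "d = Suc e"
    using assms by (metis Suc_le_D One_nat_def)
  have "Suc k * (Suc (k + e) choose Suc k) = Suc (k + e) * ((k + e) choose k)"
    by (rule Suc_times_binomial)
  then have "(2 * l + d - 1) * ((l + d - 2) choose (l - 1)) =
      l * (((l + d - 2) choose (l - 1)) + ((l + d - 1) choose l))"
    by (simp add: ke algebra_simps)
  then show ?thesis
    using assms by (simp add: eigendim_def)
qed

lemma real_eigendim: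
  assumes "l \<ge> 1" "d \<ge> 1"
  shows "real (eigendim l d) =
    (2 * real l + real d - 1) / real l * real ((l + d - 2) choose (l - 1))"
proof -
  obtain k e where ke: "l = Suc k" "d = Suc e"
    using assms by (metis Suc_le_D One_nat_def)
  have "real (Suc k) * real (Suc (k + e) choose Suc k) = real (Suc (k + e)) * real ((k + e) choose k)"
    using Suc_times_binomial[of k "k + e"] by (metis of_nat_mult)
  then show ?thesis
    unfolding eigendim_altdef[OF assms] by (simp add: ke field_simps)
qed

definition orthonormal_eigenbasis :: "nat \<Rightarrow> nat \<Rightarrow> (nat \<Rightarrow> (nat \<Rightarrow> real) \<Rightarrow> real) \<Rightarrow> bool"
  where "orthonormal_eigenbasis l d Y \<longleftrightarrow>
    (\<forall>m\<in>{1..eigendim l d}. Y m \<in> eigenspace l d) \<and>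
    (\<forall>m\<in>{1..eigendim l d}. \<forall>m'\<in>{1..eigendim l d}.
       (\<integral>x. Y m x * Y m' x \<partial>sphere_measure {..d}) = (if m = m' then 1 else 0)) \<and>
    (\<forall>f\<in>eigenspace l d. \<exists>c. \<forall>x\<in>unit_sphere {..d}. f x = (\<Sum>m=1..eigendim l d. c m * Y m x))"

definition random_eigenfunction ::
    "nat \<Rightarrow> nat \<Rightarrow> (nat \<Rightarrow> (nat \<Rightarrow> real) \<Rightarrow> real) \<Rightarrow> (nat \<Rightarrow> real) \<Rightarrow> (nat \<Rightarrow> real) \<Rightarrow> real"
  where "random_eigenfunction l d Y \<alpha> x = (\<Sum>m=1..eigendim l d. \<alpha> m * Y m x)"

definition d_Kol :: "nat \<Rightarrow> ((nat \<Rightarrow> real) \<Rightarrow> real) \<Rightarrow> real"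
  where "d_Kol d h = (SUP u. \<bar>(\<integral>x. indicator {..u} (h x) \<partial>sphere_measure {..d})
                               - cdf std_normal_distribution u\<bar>)"

definition coeff_measure :: "nat \<Rightarrow> nat \<Rightarrow> (nat \<Rightarrow> real) measure"
  where "coeff_measure l d = sphere_measure {1..eigendim l d}"

definition bad_coeffs ::
    "nat \<Rightarrow> nat \<Rightarrow> (nat \<Rightarrow> (nat \<Rightarrow> real) \<Rightarrow> real) \<Rightarrow> real \<Rightarrow> (nat \<Rightarrow> real) set"
  where "bad_coeffs l d Y e =
    {\<alpha> \<in> unit_sphere {1..eigendim l d}. d_Kol d (random_eigenfunction l d Y \<alpha>) > e}"

end

theory Submission
  imports Defs
begin

text \<open>
  Replace the uniform coefficient vector \<open>\<alpha>\<close> by \<open>G / sqrt n\<close>, where \<open>n\<close> is the dimension of the eigenspace and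
  \<open>G\<close> is a standard Gaussian vector; \<open>\<alpha>\<close> is the direction of such a \<open>G\<close> (\<open>distr_gauss_normalize_vec\<close>).  For a
  fixed point \<open>x\<close> of the sphere the Gaussian eigenfunction has variance \<open>(\<Sum>m. (Y m x)\<^sup>2) / n\<close>.  The eigenspace
  is invariant under rotations (\<open>eigenspace_givens\<close>), which act transitively, so this sum is constant and
  equals \<open>n\<close> (\<open>addition_theorem\<close>).  Hence the value at \<open>x\<close> is exactly standard normal, the distribution
  function \<open>gauss_cdf G u\<close> of the eigenfunction on the sphere has mean \<open>normal_cdf u\<close>, and only its fluctuations
  matter.

  The mean square of \<open>gauss_cdf G u - normal_cdf u\<close> is the average over pairs of points of the covariance of two
  indicators of Gaussian variables with correlation \<open>\<rho>\<close>.  This covariance is \<open>\<rho>\<close> times a bounded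
  factor that depends on \<open>u\<close> only, up to an error of \<open>6 \<rho>\<^sup>2\<close> (\<open>covariance_indicators_gauss\<close>).  Orthonormality makes the
  average of \<open>\<rho>\<^sup>2\<close> equal to \<open>1 / n\<close>, and Bessel's inequality bounds that of \<open>\<rho>\<close> by \<open>1 / n\<close>.  So the mean square
  is at most \<open>7 / n\<close>, uniformly in \<open>u\<close> (\<open>gauss_cdf_mean_square\<close>).

  The Kolmogorov distance of a distribution function from \<open>normal_cdf\<close> is controlled by its values at about
  \<open>1 / \<epsilon>\<close> quantiles (\<open>Kolmogorov_grid\<close>).  Chebyshev's inequality at each of them costs a multiple of
  \<open>1 / (n \<epsilon>\<^sup>2)\<close>, and the union bound multiplies this by \<open>1 / \<epsilon>\<close>; this is the origin of the third power.  The
  passage from \<open>G / sqrt n\<close> back to the direction of \<open>G\<close> changes the scale by a factor that differs from \<open>1\<close> by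
  about \<open>1 / sqrt n\<close>, which costs another multiple of \<open>1 / (n \<epsilon>\<^sup>2)\<close> (\<open>d_Kol_radial\<close>, \<open>prob_square_norm_deviation\<close>).
\<close>

section \<open>Rotations of Gaussian vectors\<close>

text \<open>
  For \<open>c \<noteq> 0\<close> a rotation is a composition of two maps, each of which applies to one coordinate an affine
  function whose shift depends on the other coordinate; the scaling factors \<open>c\<close> and \<open>1 / c\<close> cancel.
\<close>

lemma nn_integral_lborel_rotation:
  fixes f :: "real \<times> real \<Rightarrow> ennreal"
  assumes [measurable]: "f \<in> borel_measurable borel" and cs: "c\<^sup>2 + s\<^sup>2 = 1"
  shows "(\<integral>\<^sup>+x. \<integral>\<^sup>+y. f (c * x - s * y, s * x + c * y) \<partial>lborel \<partial>lborel) =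
    (\<integral>\<^sup>+x. \<integral>\<^sup>+y. f (x, y) \<partial>lborel \<partial>lborel)"
proof (cases "c = 0")
  case True
  then have s: "s \<noteq> 0" "\<bar>s\<bar> = 1"
    using cs by (auto simp: power2_eq_1_iff)
  have "(\<integral>\<^sup>+x. \<integral>\<^sup>+y. f (- s * y, s * x) \<partial>lborel \<partial>lborel) = (\<integral>\<^sup>+x. \<integral>\<^sup>+y. f (y, s * x) \<partial>lborel \<partial>lborel)"
  proof (rule nn_integral_cong)
    fix x :: real
    show "(\<integral>\<^sup>+y. f (- s * y, s * x) \<partial>lborel) = (\<integral>\<^sup>+y. f (y, s * x) \<partial>lborel)"
      using nn_integral_real_affine[of "\<lambda>y. f (y, s * x)" "- s" 0] s by simp
  qed
  also have "\<dots> = (\<integral>\<^sup>+y. \<integral>\<^sup>+x. f (y, s * x) \<partial>lborel \<partial>lborel)"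
    by (subst lborel_pair.Fubini') auto
  also have "\<dots> = (\<integral>\<^sup>+y. \<integral>\<^sup>+x. f (y, x) \<partial>lborel \<partial>lborel)"
  proof (rule nn_integral_cong)
    fix y :: real
    show "(\<integral>\<^sup>+x. f (y, s * x) \<partial>lborel) = (\<integral>\<^sup>+x. f (y, x) \<partial>lborel)"
      using nn_integral_real_affine[of "\<lambda>x. f (y, x)" s 0] s by simp
  qed
  finally show ?thesis using True by simp
next
  case False
  (* Solving c x - s y for x turns the second entry into s x / c + y / c, by c^2 + s^2 = 1. *)
  have inner: "(\<integral>\<^sup>+x. f (x, s * x / c + y / c) \<partial>lborel) =
      \<bar>c\<bar> * (\<integral>\<^sup>+x. f (c * x - s * y, s * x + c * y) \<partial>lborel)" for y
  proof -
    have cc: "1 - s * s = c * c"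
      using cs by (simp add: power2_eq_square)
    have e: "s * (- s * y + c * x) / c + y / c = s * x + c * y" for x
    proof -
      have "s * (- s * y + c * x) / c + y / c = s * x + (1 - s * s) * y / c"
        using False by (simp add: field_simps)
      then show ?thesis
        using False by (simp add: cc)
    qed
    have "(\<integral>\<^sup>+x. f (x, s * x / c + y / c) \<partial>lborel) =
        \<bar>c\<bar> * (\<integral>\<^sup>+x. f (- s * y + c * x, s * (- s * y + c * x) / c + y / c) \<partial>lborel)"
      by (rule nn_integral_real_affine) (use False in simp_all)
    then show ?thesis
      unfolding e by simp
  qed
  have "(\<integral>\<^sup>+x. \<integral>\<^sup>+y. f (x, y) \<partial>lborel \<partial>lborel) =
      (\<integral>\<^sup>+x. \<bar>1 / c\<bar> * (\<integral>\<^sup>+y. f (x, s * x / c + 1 / c * y) \<partial>lborel) \<partial>lborel)"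
    by (intro nn_integral_cong, subst nn_integral_real_affine[where c = "1 / c" and t = "s * _ / c"])
       (use False in auto)
  also have "\<dots> = \<bar>1 / c\<bar> * (\<integral>\<^sup>+x. (\<integral>\<^sup>+y. f (x, s * x / c + y / c) \<partial>lborel) \<partial>lborel)"
    by (subst nn_integral_cmult) auto
  also have "(\<integral>\<^sup>+x. (\<integral>\<^sup>+y. f (x, s * x / c + y / c) \<partial>lborel) \<partial>lborel) =
      (\<integral>\<^sup>+y. (\<integral>\<^sup>+x. f (x, s * x / c + y / c) \<partial>lborel) \<partial>lborel)"
    by (subst lborel_pair.Fubini') auto
  also have "\<dots> = \<bar>c\<bar> * (\<integral>\<^sup>+y. (\<integral>\<^sup>+x. f (c * x - s * y, s * x + c * y) \<partial>lborel) \<partial>lborel)"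
    unfolding inner by (subst nn_integral_cmult) auto
  also have "\<bar>1 / c\<bar> * (\<bar>c\<bar> * (\<integral>\<^sup>+y. (\<integral>\<^sup>+x. f (c * x - s * y, s * x + c * y) \<partial>lborel) \<partial>lborel)) =
      (\<integral>\<^sup>+y. (\<integral>\<^sup>+x. f (c * x - s * y, s * x + c * y) \<partial>lborel) \<partial>lborel)"
    using False by (simp add: ennreal_mult[symmetric] mult.assoc[symmetric])
  also have "\<dots> = (\<integral>\<^sup>+x. (\<integral>\<^sup>+y. f (c * x - s * y, s * x + c * y) \<partial>lborel) \<partial>lborel)"
    by (subst lborel_pair.Fubini') auto
  finally show ?thesis by simp
qed

interpretation N: prob_space std_normal_distribution
  by (rule prob_space_normal_density) simp

interpretation N: real_distribution std_normal_distribution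
  by (rule real_dist_normal_dist)

lemma nn_integral_normal_rotation:
  fixes f :: "real \<times> real \<Rightarrow> ennreal"
  assumes [measurable]: "f \<in> borel_measurable borel" and cs: "c\<^sup>2 + s\<^sup>2 = 1"
  shows "(\<integral>\<^sup>+x. \<integral>\<^sup>+y. f (c * x - s * y, s * x + c * y) \<partial>std_normal_distribution \<partial>std_normal_distribution) =
    (\<integral>\<^sup>+x. \<integral>\<^sup>+y. f (x, y) \<partial>std_normal_distribution \<partial>std_normal_distribution)"
proof -
  let ?p = "\<lambda>x. ennreal (std_normal_density x)"
  have dens: "(\<integral>\<^sup>+x. \<integral>\<^sup>+y. h (x, y) \<partial>std_normal_distribution \<partial>std_normal_distribution) =
      (\<integral>\<^sup>+x. \<integral>\<^sup>+y. ?p x * ?p y * h (x, y) \<partial>lborel \<partial>lborel)"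
    if [measurable]: "h \<in> borel_measurable borel" for h :: "real \<times> real \<Rightarrow> ennreal"
    by (subst nn_integral_density, simp, measurable)
       (simp add: nn_integral_density nn_integral_cmult[symmetric] mult.assoc)
  have rot: "?p x * ?p y = ?p (c * x - s * y) * ?p (s * x + c * y)" for x y
  proof -
    have "(c * x - s * y)\<^sup>2 + (s * x + c * y)\<^sup>2 = (c\<^sup>2 + s\<^sup>2) * (x\<^sup>2 + y\<^sup>2)"
      by (simp add: power2_eq_square algebra_simps)
    then have "exp (- x\<^sup>2 / 2) * exp (- y\<^sup>2 / 2) =
        exp (- (c * x - s * y)\<^sup>2 / 2) * exp (- (s * x + c * y)\<^sup>2 / 2)"
      using cs by (simp add: exp_add[symmetric] add_divide_distrib[symmetric])
    then show ?thesis
      by (simp add: std_normal_density_def ennreal_mult[symmetric])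
  qed
  have [measurable]: "(\<lambda>x. f (c * fst x - s * snd x, s * fst x + c * snd x)) \<in> borel_measurable borel"
    by (rule measurable_compose[OF _ assms(1)]) (intro borel_measurable_continuous_onI continuous_intros)
  have [measurable]: "f \<in> borel_measurable (borel \<Otimes>\<^sub>M borel)"
    using assms(1) by (simp add: borel_prod)
  have "(\<lambda>x. ?p (fst x) * ?p (snd x) * f x) \<in> borel_measurable (borel \<Otimes>\<^sub>M borel)"
    by measurable
  then have [measurable]: "(\<lambda>x. ?p (fst x) * ?p (snd x) * f x) \<in> borel_measurable borel"
    by (simp add: borel_prod)
  show ?thesis
    using nn_integral_lborel_rotation[OF _ cs, of "\<lambda>(x, y). ?p x * ?p y * f (x, y)"]
      dens[of "\<lambda>(x, y). f (c * x - s * y, s * x + c * y)"] dens[of f]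
    by (simp add: rot[symmetric] split_beta')
qed

definition gauss :: "nat set \<Rightarrow> (nat \<Rightarrow> real) measure"
  where "gauss I = (\<Pi>\<^sub>M i\<in>I. std_normal_distribution)"

interpretation NP: product_prob_space "\<lambda>_. std_normal_distribution" I for I
  by standard

lemma prob_space_gauss: "prob_space (gauss I)"
  unfolding gauss_def by (rule prob_space_PiM) (rule N.prob_space_axioms)

lemma sets_gauss [measurable_cong]: "sets (gauss I) = sets (\<Pi>\<^sub>M i\<in>I. lborel)"
  unfolding gauss_def by (rule sets_PiM_cong) auto

lemma space_gauss: "space (gauss I) = I \<rightarrow>\<^sub>E UNIV"
  by (simp add: gauss_def space_PiM)

text \<open>
  Vectors are extensional functions, so a rotation is an update of two coordinates; the rotations in
  coordinate planes already act transitively on the sphere.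
\<close>

definition givens :: "nat \<Rightarrow> nat \<Rightarrow> real \<Rightarrow> real \<Rightarrow> (nat \<Rightarrow> real) \<Rightarrow> (nat \<Rightarrow> real)"
  where "givens i j c s x = x(i := c * x i - s * x j, j := s * x i + c * x j)"

lemma measurable_givens:
  assumes "i \<in> I" "j \<in> I"
  shows "givens i j c s \<in> measurable (\<Pi>\<^sub>M i\<in>I. lborel) (\<Pi>\<^sub>M i\<in>I. lborel)"
proof (rule measurable_PiM_single')
  show "(\<lambda>x. givens i j c s x k) \<in> measurable (\<Pi>\<^sub>M i\<in>I. lborel) lborel" if "k \<in> I" for k
    using that assms by (cases "k = i"; cases "k = j") (simp_all add: givens_def)
  show "givens i j c s \<in> space (\<Pi>\<^sub>M i\<in>I. lborel) \<rightarrow> (\<Pi>\<^sub>E i\<in>I. space lborel)"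
    using assms by (auto simp: givens_def space_PiM PiE_iff extensional_def)
qed

lemma nn_integral_gauss_givens:
  assumes f: "f \<in> borel_measurable (\<Pi>\<^sub>M i\<in>I. lborel)" and I: "finite I" "i \<in> I" "j \<in> I" "i \<noteq> j"
    and cs: "c\<^sup>2 + s\<^sup>2 = 1"
  shows "(\<integral>\<^sup>+x. f (givens i j c s x) \<partial>gauss I) = (\<integral>\<^sup>+x. f x \<partial>gauss I)"
proof -
  define J where "J = I - {i, j}"
  have IJ: "I = insert j (insert i J)" "i \<notin> J" "j \<notin> insert i J" "finite J"
    using I by (auto simp: J_def)
  have cong: "sets (\<Pi>\<^sub>M i\<in>K. std_normal_distribution) = sets (\<Pi>\<^sub>M i\<in>K. lborel)" for K :: "nat set"
    by (rule sets_PiM_cong) auto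
  have split2: "(\<integral>\<^sup>+x. h x \<partial>gauss I) = (\<integral>\<^sup>+x. \<integral>\<^sup>+a. \<integral>\<^sup>+b. h (x(i := a, j := b))
      \<partial>std_normal_distribution \<partial>std_normal_distribution \<partial>gauss J)"
    if h: "h \<in> borel_measurable (\<Pi>\<^sub>M i\<in>I. lborel)" for h
  proof -
    have h'[measurable]: "h \<in> borel_measurable (\<Pi>\<^sub>M i\<in>insert j (insert i J). std_normal_distribution)"
      using h IJ by (simp add: cong cong: measurable_cong_sets)
    have "(\<integral>\<^sup>+x. h x \<partial>gauss I) =
        (\<integral>\<^sup>+x. \<integral>\<^sup>+b. h (x(j := b)) \<partial>std_normal_distribution \<partial>gauss (insert i J))"
      unfolding gauss_def IJ(1) by (rule NP.product_nn_integral_insert) (use IJ in auto)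
    also have "\<dots> = (\<integral>\<^sup>+x. \<integral>\<^sup>+a. \<integral>\<^sup>+b. h (x(i := a, j := b))
      \<partial>std_normal_distribution \<partial>std_normal_distribution \<partial>gauss J)"
      unfolding gauss_def by (rule NP.product_nn_integral_insert) (use IJ in auto)
    finally show ?thesis .
  qed
  have fm: "(\<lambda>p. f (x(i := fst p, j := snd p))) \<in> borel_measurable borel" if "x \<in> space (gauss J)" for x
  proof -
    have "(\<lambda>p. x(i := fst p, j := snd p)) \<in> measurable (borel \<Otimes>\<^sub>M borel) (\<Pi>\<^sub>M i\<in>I. lborel)"
    proof (rule measurable_PiM_single')
      show "(\<lambda>p. (x(i := fst p, j := snd p)) k) \<in> measurable (borel \<Otimes>\<^sub>M borel) lborel" if "k \<in> I" for k
        by (cases "k = i"; cases "k = j") simp_all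
      show "(\<lambda>p. x(i := fst p, j := snd p)) \<in> space (borel \<Otimes>\<^sub>M borel) \<rightarrow> (\<Pi>\<^sub>E i\<in>I. space lborel)"
        using \<open>x \<in> _\<close> IJ by (auto simp: space_gauss PiE_iff extensional_def)
    qed
    from measurable_compose[OF this f] show ?thesis
      by (simp add: borel_prod)
  qed
  have "(\<integral>\<^sup>+x. f (givens i j c s x) \<partial>gauss I) =
      (\<integral>\<^sup>+x. \<integral>\<^sup>+a. \<integral>\<^sup>+b. f (x(i := c * a - s * b, j := s * a + c * b))
        \<partial>std_normal_distribution \<partial>std_normal_distribution \<partial>gauss J)"
    using measurable_compose[OF measurable_givens f] I
    by (subst split2) (auto simp: givens_def fun_upd_twist)
  also have "\<dots> = (\<integral>\<^sup>+x. \<integral>\<^sup>+a. \<integral>\<^sup>+b. f (x(i := a, j := b))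
        \<partial>std_normal_distribution \<partial>std_normal_distribution \<partial>gauss J)"
  proof (rule nn_integral_cong)
    fix x assume "x \<in> space (gauss J)"
    from nn_integral_normal_rotation[OF fm[OF this] cs]
    show "(\<integral>\<^sup>+a. \<integral>\<^sup>+b. f (x(i := c * a - s * b, j := s * a + c * b))
        \<partial>std_normal_distribution \<partial>std_normal_distribution) =
      (\<integral>\<^sup>+a. \<integral>\<^sup>+b. f (x(i := a, j := b)) \<partial>std_normal_distribution \<partial>std_normal_distribution)"
      by simp
  qed
  also have "\<dots> = (\<integral>\<^sup>+x. f x \<partial>gauss I)"
    by (rule split2[OF f, symmetric])
  finally show ?thesis .
qed

section \<open>The direction of a Gaussian vector is uniform on the sphere\<close>

interpretation LP: product_sigma_finite "\<lambda>_. lborel :: real measure"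
  by standard

lemma measurable_L2_set_PiM [measurable]:
  "(\<lambda>x. L2_set x I) \<in> borel_measurable (\<Pi>\<^sub>M i\<in>I. lborel)"
  unfolding L2_set_def by measurable

lemma measurable_normalize_vec [measurable]:
  "normalize_vec I \<in> measurable (\<Pi>\<^sub>M i\<in>I. lborel) (\<Pi>\<^sub>M i\<in>I. lborel)"
  unfolding normalize_vec_def by measurable

lemma emeasure_PiM_lborel_scale:
  fixes r :: real
  assumes I: "finite I" and r: "r > 0" and A: "A \<in> sets (\<Pi>\<^sub>M i\<in>I. lborel)"
  shows "emeasure (\<Pi>\<^sub>M i\<in>I. lborel) A =
    ennreal (r ^ card I) * emeasure (\<Pi>\<^sub>M i\<in>I. lborel) {x \<in> I \<rightarrow>\<^sub>E UNIV. (\<lambda>i\<in>I. r * x i) \<in> A}"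
proof -
  let ?M = "\<Pi>\<^sub>M i\<in>I. (lborel :: real measure)"
  let ?S = "\<lambda>x. \<lambda>i\<in>I. r * x i"
  have S[measurable]: "?S \<in> measurable ?M ?M" by measurable
  let ?P = "density (distr ?M ?M ?S) (\<lambda>_. ennreal (r ^ card I))"
  have *: "emeasure ?P B = ennreal (r ^ card I) * emeasure ?M {x \<in> I \<rightarrow>\<^sub>E UNIV. ?S x \<in> B}"
    if "B \<in> sets ?M" for B
  proof -
    have "?S -` B \<inter> space ?M = {x \<in> I \<rightarrow>\<^sub>E UNIV. ?S x \<in> B}" by (auto simp: space_PiM)
    then show ?thesis
      using that by (simp add: emeasure_density nn_integral_cmult emeasure_distr)
  qed
  have "?P = ?M"
  proof (rule LP.PiM_eqI[OF I])
    show "sets ?P = sets ?M" by simp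
    fix B :: "_ \<Rightarrow> real set" assume B: "\<And>i. i \<in> I \<Longrightarrow> B i \<in> sets lborel"
    have one: "ennreal r * emeasure lborel {t. r * t \<in> B i} = emeasure lborel (B i)" if "i \<in> I" for i
    proof -
      have [measurable]: "B i \<in> sets borel" using B[OF that] by simp
      have "emeasure lborel (B i) = (\<integral>\<^sup>+t. indicator (B i) t \<partial>lborel)" by simp
      also have "\<dots> = r * (\<integral>\<^sup>+t. indicator (B i) (0 + r * t) \<partial>lborel)"
        using r by (subst nn_integral_real_affine[where c = r and t = 0]) auto
      also have "(\<integral>\<^sup>+t. indicator (B i) (0 + r * t) \<partial>lborel) =
          (\<integral>\<^sup>+t. indicator {t. r * t \<in> B i} t \<partial>lborel)"
        by (intro nn_integral_cong) (auto simp: indicator_def)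
      also have "\<dots> = emeasure lborel {t. r * t \<in> B i}"
        by (rule nn_integral_indicator) simp
      finally show ?thesis by simp
    qed
    have "{x \<in> I \<rightarrow>\<^sub>E UNIV. ?S x \<in> Pi\<^sub>E I B} = Pi\<^sub>E I (\<lambda>i. {t. r * t \<in> B i})"
      by (auto simp: PiE_iff extensional_def)
    moreover have "{t. r * t \<in> B i} \<in> sets lborel" if "i \<in> I" for i
    proof -
      have [measurable]: "B i \<in> sets borel" using B[OF that] by simp
      show ?thesis by simp
    qed
    ultimately have "emeasure ?P (Pi\<^sub>E I B) =
        ennreal (r ^ card I) * (\<Prod>i\<in>I. emeasure lborel {t. r * t \<in> B i})"
      using B I by (subst *) (auto intro!: sets_PiM_I_finite simp: LP.emeasure_PiM)
    also have "\<dots> = (\<Prod>i\<in>I. ennreal r * emeasure lborel {t. r * t \<in> B i})"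
      using r by (simp add: prod.distrib ennreal_power)
    also have "\<dots> = (\<Prod>i\<in>I. emeasure lborel (B i))"
      by (intro prod.cong refl one)
    finally show "emeasure ?P (Pi\<^sub>E I B) = (\<Prod>i\<in>I. emeasure lborel (B i))" .
  qed
  with *[OF A] show ?thesis by simp
qed

lemma gauss_eq_density:
  assumes I: "finite I"
  shows "gauss I = density (\<Pi>\<^sub>M i\<in>I. lborel)
    (\<lambda>x. ennreal ((1 / sqrt (2 * pi)) ^ card I) * ennreal (exp (- (L2_set x I)\<^sup>2 / 2)))"
proof -
  let ?M = "\<Pi>\<^sub>M i\<in>I. (lborel :: real measure)"
  let ?p = "\<lambda>x. \<Prod>i\<in>I. ennreal (std_normal_density (x i))"
  have p: "?p x = ennreal ((1 / sqrt (2 * pi)) ^ card I) * ennreal (exp (- (L2_set x I)\<^sup>2 / 2))" for x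
  proof -
    have "?p x = ennreal (\<Prod>i\<in>I. std_normal_density (x i))"
      by (rule prod_ennreal) simp
    also have "(\<Prod>i\<in>I. std_normal_density (x i)) =
        (1 / sqrt (2 * pi)) ^ card I * (\<Prod>i\<in>I. exp (- (x i)\<^sup>2 / 2))"
      by (simp add: std_normal_density_def prod.distrib prod_dividef power_divide)
    also have "(\<Prod>i\<in>I. exp (- (x i)\<^sup>2 / 2)) = exp (- (L2_set x I)\<^sup>2 / 2)"
      using I by (simp add: exp_sum[symmetric] L2_set_def sum_nonneg sum_negf sum_divide_distrib)
    finally show ?thesis by (simp add: ennreal_mult)
  qed
  have [measurable]: "?p \<in> borel_measurable ?M" by measurable
  have "density ?M ?p = gauss I"
    unfolding gauss_def
  proof (rule NP.PiM_eqI[OF I])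
    show "sets (density ?M ?p) = sets (\<Pi>\<^sub>M i\<in>I. std_normal_distribution)"
      by (simp add: sets_gauss[unfolded gauss_def])
    fix A :: "_ \<Rightarrow> real set" assume A: "\<And>i. i \<in> I \<Longrightarrow> A i \<in> sets std_normal_distribution"
    have "emeasure (density ?M ?p) (Pi\<^sub>E I A) = (\<integral>\<^sup>+x. ?p x * indicator (Pi\<^sub>E I A) x \<partial>?M)"
      using A I by (intro emeasure_density) (auto intro!: sets_PiM_I_finite)
    also have "\<dots> = (\<integral>\<^sup>+x. (\<Prod>i\<in>I. ennreal (std_normal_density (x i)) * indicator (A i) (x i)) \<partial>?M)"
    proof (rule nn_integral_cong)
      fix x assume x: "x \<in> space ?M"
      have "indicator (Pi\<^sub>E I A) x = (\<Prod>i\<in>I. indicator (A i) (x i) :: ennreal)"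
      proof (cases "x \<in> Pi\<^sub>E I A")
        case True
        then have "(\<Prod>i\<in>I. indicator (A i) (x i) :: ennreal) = 1"
          by (intro prod.neutral) (auto simp: PiE_iff)
        with True show ?thesis by simp
      next
        case False
        then obtain i where "i \<in> I" "x i \<notin> A i" using x by (auto simp: space_PiM PiE_iff)
        then have "(\<Prod>i\<in>I. indicator (A i) (x i) :: ennreal) = 0" using I
            by (auto simp: prod_zero_iff indicator_def)
        with False show ?thesis by simp
      qed
      then show "?p x * indicator (Pi\<^sub>E I A) x =
          (\<Prod>i\<in>I. ennreal (std_normal_density (x i)) * indicator (A i) (x i))"
        by (simp add: prod.distrib)
    qed
    also have "\<dots> = (\<Prod>i\<in>I. \<integral>\<^sup>+t. ennreal (std_normal_density t) * indicator (A i) t \<partial>lborel)"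
      using A I by (intro LP.product_nn_integral_prod) auto
    also have "\<dots> = (\<Prod>i\<in>I. emeasure std_normal_distribution (A i))"
      using A by (intro prod.cong refl) (simp add: emeasure_density)
    finally show "emeasure (density ?M ?p) (Pi\<^sub>E I A) = (\<Prod>i\<in>I. emeasure std_normal_distribution (A i))" .
  qed
  then show ?thesis by (simp add: p)
qed

text \<open>
  With \<open>t\<close> the norm of a point, the indicator says that the point lies in the ball of radius \<open>s\<close>: the
  Gaussian density is a superposition of indicators of balls.
\<close>

lemma exp_neg_square_layer_cake:
  fixes t :: real
  assumes "t \<ge> 0"
  shows "ennreal (exp (- t\<^sup>2 / 2)) = (\<integral>\<^sup>+s. ennreal (s * exp (- s\<^sup>2 / 2)) * indicator {t..} s \<partial>lborel)"
proof -
  have "((\<lambda>s::real. - exp (- s\<^sup>2 / 2)) \<longlongrightarrow> 0) at_top"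
    by real_asymp
  then have "(\<integral>\<^sup>+s. ennreal (s * exp (- s\<^sup>2 / 2)) * indicator {t..} s \<partial>lborel) =
      ennreal (0 - (- exp (- t\<^sup>2 / 2)))"
    using assms
    by (intro nn_integral_FTC_atLeast[where F = "\<lambda>s. - exp (- s\<^sup>2 / 2)"])
       (auto intro!: derivative_eq_intros)
  then show ?thesis by simp
qed

lemma normalize_vec_scale:
  assumes "r > 0"
  shows "normalize_vec I (\<lambda>i\<in>I. r * x i) = normalize_vec I x"
proof -
  have "L2_set (\<lambda>i\<in>I. r * x i) I = L2_set (\<lambda>i. r * x i) I"
    by (rule L2_set_cong) auto
  also have "\<dots> = r * L2_set x I"
    using assms by (simp add: L2_set_right_distrib)
  finally show ?thesis
    using assms by (auto simp: normalize_vec_def restrict_def fun_eq_iff)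
qed

text \<open>
  A cone \<open>C\<close> meets the ball of radius \<open>s\<close> in \<open>s\<^sup>n\<close> times its volume in the unit ball, and the
  Gaussian density is a superposition of indicators of balls, so the Gaussian mass of \<open>C\<close> is
  proportional to the volume of \<open>C\<close> in the unit ball.  The case of the full space identifies
  the factor.
\<close>

lemma distr_gauss_normalize_vec:
  assumes I: "finite I"
  shows "distr (gauss I) (\<Pi>\<^sub>M i\<in>I. lborel) (normalize_vec I) =
    distr (uniform_measure (\<Pi>\<^sub>M i\<in>I. lborel) (unit_ball I)) (\<Pi>\<^sub>M i\<in>I. lborel) (normalize_vec I)"
proof -
  let ?M = "\<Pi>\<^sub>M i\<in>I. (lborel :: real measure)"
  interpret finite_product_sigma_finite "\<lambda>_. lborel :: real measure" I
    by standard (rule I)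
  interpret M: sigma_finite_measure ?M by (rule LP.sigma_finite[OF I])
  interpret P: pair_sigma_finite ?M lborel by standard
  interpret G: prob_space "gauss I" by (rule prob_space_gauss)
  have B: "unit_ball I = {x \<in> space ?M. L2_set x I \<le> 1}"
    by (simp add: unit_ball_def space_PiM)
  have [measurable]: "unit_ball I \<in> sets ?M" unfolding B by measurable
  define Z where "Z = ennreal ((1 / sqrt (2 * pi)) ^ card I)"
  define \<kappa> where "\<kappa> = Z * (\<integral>\<^sup>+s. ennreal (s * exp (- s\<^sup>2 / 2) * s ^ card I) * indicator {0<..} s \<partial>lborel)"
  have cone: "emeasure (gauss I) C = \<kappa> * emeasure ?M (C \<inter> unit_ball I)"
    if C[measurable]: "C \<in> sets ?M" and sc: "\<And>r x. r > 0 \<Longrightarrow> x \<in> I \<rightarrow>\<^sub>E UNIV \<Longrightarrow> (\<lambda>i\<in>I. r * x i) \<in> C \<longleftrightarrow> x \<in> C" for C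
  proof -
    have meas: "{x \<in> C. L2_set x I \<le> s} \<in> sets ?M" for s
    proof -
      have "{x \<in> C. L2_set x I \<le> s} = C \<inter> {x \<in> space ?M. L2_set x I \<le> s}"
        using sets.sets_into_space[OF C] by auto
      then show ?thesis by simp
    qed
    have ball: "emeasure ?M {x \<in> C. L2_set x I \<le> s} = ennreal (s ^ card I) * emeasure ?M (C \<inter> unit_ball I)"
      if s: "s > 0" for s
    proof -
      have L: "L2_set (\<lambda>i\<in>I. s * x i) I = s * L2_set x I" for x
      proof -
        have "L2_set (\<lambda>i\<in>I. s * x i) I = L2_set (\<lambda>i. s * x i) I"
          by (rule L2_set_cong) auto
        then show ?thesis
          using s by (simp add: L2_set_right_distrib)
      qed
      have sub: "C \<subseteq> I \<rightarrow>\<^sub>E UNIV"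
        using sets.sets_into_space[OF C] by (simp add: space_PiM)
      have "{x \<in> C. L2_set x I \<le> s} \<in> sets ?M"
        by (rule meas)
      moreover have "{x \<in> I \<rightarrow>\<^sub>E UNIV. (\<lambda>i\<in>I. s * x i) \<in> {x \<in> C. L2_set x I \<le> s}} = C \<inter> unit_ball I"
        using s sub sc[OF s] by (auto simp: unit_ball_def L mult_le_cancel_left1)
      ultimately show ?thesis
        by (subst emeasure_PiM_lborel_scale[OF I s]) auto
    qed
    have "emeasure (gauss I) C = (\<integral>\<^sup>+x. Z * ennreal (exp (- (L2_set x I)\<^sup>2 / 2)) * indicator C x \<partial>?M)"
      unfolding gauss_eq_density[OF I] Z_def by (intro emeasure_density) auto
    also have "\<dots> = (\<integral>\<^sup>+x. Z * (ennreal (exp (- (L2_set x I)\<^sup>2 / 2)) * indicator C x) \<partial>?M)"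
      by (simp add: mult.assoc)
    also have "\<dots> = Z * (\<integral>\<^sup>+x. ennreal (exp (- (L2_set x I)\<^sup>2 / 2)) * indicator C x \<partial>?M)"
      by (rule nn_integral_cmult) measurable
    also have "(\<integral>\<^sup>+x. ennreal (exp (- (L2_set x I)\<^sup>2 / 2)) * indicator C x \<partial>?M) =
        (\<integral>\<^sup>+x. \<integral>\<^sup>+s. ennreal (s * exp (- s\<^sup>2 / 2)) * indicator {L2_set x I..} s * indicator C x \<partial>lborel \<partial>?M)"
      by (intro nn_integral_cong, subst exp_neg_square_layer_cake[OF L2_set_nonneg], subst nn_integral_multc) auto
    also have "\<dots> = (\<integral>\<^sup>+x. \<integral>\<^sup>+s. ennreal (s * exp (- s\<^sup>2 / 2)) * (if L2_set x I \<le> s then 1 else 0) * indicator C x \<partial>lborel \<partial>?M)"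
      by (intro nn_integral_cong) (simp add: indicator_def)
    also have "\<dots> = (\<integral>\<^sup>+s. \<integral>\<^sup>+x. ennreal (s * exp (- s\<^sup>2 / 2)) * (if L2_set x I \<le> s then 1 else 0) * indicator C x \<partial>?M \<partial>lborel)"
      by (rule P.Fubini'[symmetric]) measurable
    also have "\<dots> = (\<integral>\<^sup>+s. ennreal (s * exp (- s\<^sup>2 / 2) * s ^ card I) * indicator {0<..} s * emeasure ?M (C \<inter> unit_ball I) \<partial>lborel)"
    proof (rule nn_integral_cong)
      fix s :: real
      have [measurable]: "{x \<in> C. L2_set x I \<le> s} \<in> sets ?M"
        by (rule meas)
      have "(\<integral>\<^sup>+x. ennreal (s * exp (- s\<^sup>2 / 2)) * (if L2_set x I \<le> s then 1 else 0) * indicator C x \<partial>?M) =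
          (\<integral>\<^sup>+x. ennreal (s * exp (- s\<^sup>2 / 2)) * indicator {x \<in> C. L2_set x I \<le> s} x \<partial>?M)"
        by (intro nn_integral_cong) (auto simp: indicator_def)
      also have "\<dots> = ennreal (s * exp (- s\<^sup>2 / 2)) * emeasure ?M {x \<in> C. L2_set x I \<le> s}"
        by (subst nn_integral_cmult) auto
      also have "\<dots> = ennreal (s * exp (- s\<^sup>2 / 2) * s ^ card I) * indicator {0<..} s * emeasure ?M (C \<inter> unit_ball I)"
      proof (cases "s > 0")
        case True
        then show ?thesis by (simp add: ball ennreal_mult mult.assoc)
      next
        case False
        then show ?thesis by (simp add: ennreal_neg mult_nonpos_nonneg)
      qed
      finally show "(\<integral>\<^sup>+x. ennreal (s * exp (- s\<^sup>2 / 2)) * (if L2_set x I \<le> s then 1 else 0) * indicator C x \<partial>?M) = \<dots>" .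
    qed
    also have "\<dots> = (\<integral>\<^sup>+s. ennreal (s * exp (- s\<^sup>2 / 2) * s ^ card I) * indicator {0<..} s \<partial>lborel) *
        emeasure ?M (C \<inter> unit_ball I)"
      by (rule nn_integral_multc) measurable
    finally show ?thesis by (simp add: \<kappa>_def mult.assoc)
  qed
  have "emeasure (gauss I) (space ?M) = \<kappa> * emeasure ?M (space ?M \<inter> unit_ball I)"
    by (rule cone[OF sets.top]) (auto simp: space_PiM PiE_iff)
  moreover have "space ?M \<inter> unit_ball I = unit_ball I" by (auto simp: B)
  moreover have "emeasure (gauss I) (space ?M) = 1"
    using G.emeasure_space_1 by (simp add: space_gauss space_PiM)
  ultimately have 1: "\<kappa> * emeasure ?M (unit_ball I) = 1" by simp
  show ?thesis
  proof (rule measure_eqI)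
    fix A assume "A \<in> sets (distr (gauss I) ?M (normalize_vec I))"
    then have A[measurable]: "A \<in> sets ?M" by simp
    let ?C = "normalize_vec I -` A \<inter> space ?M"
    have C[measurable]: "?C \<in> sets ?M" by measurable
    have "emeasure (gauss I) ?C = \<kappa> * emeasure ?M (?C \<inter> unit_ball I)"
      by (rule cone[OF C]) (auto simp: space_PiM normalize_vec_scale)
    also have "\<dots> = emeasure ?M (unit_ball I \<inter> ?C) / emeasure ?M (unit_ball I)"
    proof -
      have "emeasure ?M (unit_ball I) \<noteq> 0"
        using 1 by auto
      moreover have "emeasure ?M (unit_ball I) \<noteq> \<infinity>"
        using 1 by (auto simp: ennreal_mult_eq_top_iff ennreal_mult_top split: if_splits)
      ultimately have "\<kappa> = 1 / emeasure ?M (unit_ball I)"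
        using 1 by (metis ennreal_mult_divide_eq infinity_ennreal_def)
      then show ?thesis
        by (simp add: ennreal_divide_times Int_commute)
    qed
    also have "\<dots> = emeasure (uniform_measure ?M (unit_ball I)) ?C"
      by (rule emeasure_uniform_measure[symmetric]) auto
    finally have "emeasure (gauss I) ?C = emeasure (uniform_measure ?M (unit_ball I)) ?C" .
    moreover have "space (gauss I) = space ?M"
      by (simp add: space_gauss space_PiM)
    moreover have "normalize_vec I \<in> measurable (gauss I) ?M"
      using measurable_normalize_vec by (simp add: sets_gauss cong: measurable_cong_sets)
    moreover have "normalize_vec I \<in> measurable (uniform_measure ?M (unit_ball I)) ?M"
      by simp
    ultimately show "emeasure (distr (gauss I) ?M (normalize_vec I)) A =
        emeasure (distr (uniform_measure ?M (unit_ball I)) ?M (normalize_vec I)) A"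
      using A by (simp only: emeasure_distr space_uniform_measure)
  qed simp
qed

lemma L2_set_givens:
  assumes "finite I" "i \<in> I" "j \<in> I" "i \<noteq> j" "c\<^sup>2 + s\<^sup>2 = 1"
  shows "L2_set (givens i j c s x) I = L2_set x I"
proof -
  define J where "J = I - {i, j}"
  have IJ: "I = insert j (insert i J)" "i \<notin> J" "j \<notin> insert i J" "finite J"
    using assms by (auto simp: J_def)
  have "(c * x i - s * x j)\<^sup>2 + (s * x i + c * x j)\<^sup>2 = (c\<^sup>2 + s\<^sup>2) * ((x i)\<^sup>2 + (x j)\<^sup>2)"
    by (simp add: power2_eq_square algebra_simps)
  then have "(c * x i - s * x j)\<^sup>2 + (s * x i + c * x j)\<^sup>2 = (x i)\<^sup>2 + (x j)\<^sup>2"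
    using assms by simp
  moreover have "(\<Sum>k\<in>J. (givens i j c s x k)\<^sup>2) = (\<Sum>k\<in>J. (x k)\<^sup>2)"
    using IJ by (intro sum.cong) (auto simp: givens_def)
  ultimately have "(\<Sum>k\<in>I. (givens i j c s x k)\<^sup>2) = (\<Sum>k\<in>I. (x k)\<^sup>2)"
    using IJ \<open>i \<noteq> j\<close> by (simp add: givens_def)
  then show ?thesis by (simp add: L2_set_def)
qed

lemma normalize_vec_givens:
  assumes "finite I" "i \<in> I" "j \<in> I" "i \<noteq> j" "c\<^sup>2 + s\<^sup>2 = 1"
  shows "normalize_vec I (givens i j c s x) = givens i j c s (normalize_vec I x)"
  using assms(2-4) unfolding normalize_vec_def L2_set_givens[OF assms]
  by (auto simp: givens_def fun_eq_iff diff_divide_distrib add_divide_distrib)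

lemma givens_PiE [simp]:
  "i \<in> I \<Longrightarrow> j \<in> I \<Longrightarrow> givens i j c s x \<in> I \<rightarrow>\<^sub>E UNIV \<longleftrightarrow> x \<in> I \<rightarrow>\<^sub>E UNIV"
  by (auto simp: givens_def PiE_iff extensional_def)

lemma givens_unit_sphere:
  assumes "finite I" "i \<in> I" "j \<in> I" "i \<noteq> j" "c\<^sup>2 + s\<^sup>2 = 1"
  shows "givens i j c s x \<in> unit_sphere I \<longleftrightarrow> x \<in> unit_sphere I"
  using assms by (simp add: unit_sphere_def L2_set_givens)

lemma unit_sphere_sets: "unit_sphere I \<in> sets (\<Pi>\<^sub>M i\<in>I. lborel)"
proof -
  have "unit_sphere I = {x \<in> space (\<Pi>\<^sub>M i\<in>I. lborel). L2_set x I = 1}"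
    by (simp add: unit_sphere_def space_PiM)
  then show ?thesis by simp
qed

lemma sets_sphere_measure:
  "sets (sphere_measure I) = sets (restrict_space (\<Pi>\<^sub>M i\<in>I. lborel) (unit_sphere I))"
  unfolding sphere_measure_def by (rule sets_restrict_space_cong) simp

lemma sets_sphere_measure_subset:
  assumes "A \<in> sets (sphere_measure I)"
  shows "A \<in> sets (\<Pi>\<^sub>M i\<in>I. lborel)" "A \<subseteq> unit_sphere I"
  using assms unit_sphere_sets[of I]
  by (auto simp: sets_sphere_measure sets_restrict_space_iff sets_restrict_space)

lemma emeasure_sphere_measure:
  assumes I: "finite I" and A: "A \<in> sets (sphere_measure I)"
  shows "emeasure (sphere_measure I) A = emeasure (gauss I) {x \<in> I \<rightarrow>\<^sub>E UNIV. normalize_vec I x \<in> A}"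
proof -
  note A' = sets_sphere_measure_subset[OF A]
  have "emeasure (sphere_measure I) A =
      emeasure (distr (gauss I) (\<Pi>\<^sub>M i\<in>I. lborel) (normalize_vec I)) A"
    unfolding sphere_measure_def distr_gauss_normalize_vec[OF I]
    by (rule emeasure_restrict_space) (use A' unit_sphere_sets[of I] in \<open>auto intro: sets.Int\<close>)
  also have "\<dots> = emeasure (gauss I) (normalize_vec I -` A \<inter> space (gauss I))"
    using A' by (intro emeasure_distr) auto
  also have "normalize_vec I -` A \<inter> space (gauss I) = {x \<in> I \<rightarrow>\<^sub>E UNIV. normalize_vec I x \<in> A}"
    by (auto simp: space_gauss)
  finally show ?thesis .
qed

lemma measurable_givens_sphere:
  assumes "finite I" "i \<in> I" "j \<in> I" "i \<noteq> j" "c\<^sup>2 + s\<^sup>2 = 1"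
  shows "givens i j c s \<in> measurable (sphere_measure I) (sphere_measure I)"
proof -
  have "givens i j c s \<in> measurable (restrict_space (\<Pi>\<^sub>M i\<in>I. lborel) (unit_sphere I))
      (restrict_space (\<Pi>\<^sub>M i\<in>I. lborel) (unit_sphere I))"
    using givens_unit_sphere[OF assms] assms
    by (intro measurable_restrict_space3 measurable_givens) auto
  then show ?thesis
    by (simp add: sets_sphere_measure cong: measurable_cong_sets)
qed

lemma distr_sphere_givens:
  assumes I: "finite I" "i \<in> I" "j \<in> I" "i \<noteq> j" and cs: "c\<^sup>2 + s\<^sup>2 = 1"
  shows "distr (sphere_measure I) (sphere_measure I) (givens i j c s) = sphere_measure I"
proof (rule measure_eqI)
  fix A assume "A \<in> sets (distr (sphere_measure I) (sphere_measure I) (givens i j c s))"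
  then have A: "A \<in> sets (sphere_measure I)" by simp
  note A' = sets_sphere_measure_subset[OF A]
  let ?g = "givens i j c s" and ?M = "\<Pi>\<^sub>M i\<in>I. (lborel :: real measure)"
  note R = measurable_givens_sphere[OF I cs]
  have sp: "space (sphere_measure I) = unit_sphere I"
    using sphere_measure_prob(2)[of I] I by auto
  have C: "{x \<in> I \<rightarrow>\<^sub>E UNIV. normalize_vec I x \<in> A} \<in> sets ?M"
    using measurable_sets[OF measurable_normalize_vec A'(1)]
    by (simp add: vimage_def Int_def space_PiM conj_commute)
  have gC: "{x \<in> I \<rightarrow>\<^sub>E UNIV. normalize_vec I (?g x) \<in> A} \<in> sets ?M"
    using measurable_sets[OF measurable_compose[OF measurable_givens measurable_normalize_vec] A'(1)] I
    by (simp add: vimage_def Int_def space_PiM conj_commute)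
  have "emeasure (distr (sphere_measure I) (sphere_measure I) ?g) A =
      emeasure (sphere_measure I) (?g -` A \<inter> space (sphere_measure I))"
    by (rule emeasure_distr[OF R A])
  also have "\<dots> = emeasure (gauss I) {x \<in> I \<rightarrow>\<^sub>E UNIV. normalize_vec I x \<in> ?g -` A \<inter> unit_sphere I}"
    using measurable_sets[OF R A] I(1) by (subst emeasure_sphere_measure) (auto simp: sp)
  also have "{x \<in> I \<rightarrow>\<^sub>E UNIV. normalize_vec I x \<in> ?g -` A \<inter> unit_sphere I} =
      {x \<in> I \<rightarrow>\<^sub>E UNIV. normalize_vec I (?g x) \<in> A}"
    using A' givens_unit_sphere[OF I cs] by (auto simp: normalize_vec_givens[OF I cs])
  also have "emeasure (gauss I) \<dots> =
      (\<integral>\<^sup>+x. indicator {x \<in> I \<rightarrow>\<^sub>E UNIV. normalize_vec I x \<in> A} (?g x) \<partial>gauss I)"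
  proof -
    have "emeasure (gauss I) {x \<in> I \<rightarrow>\<^sub>E UNIV. normalize_vec I (?g x) \<in> A} =
        (\<integral>\<^sup>+x. indicator {x \<in> I \<rightarrow>\<^sub>E UNIV. normalize_vec I (?g x) \<in> A} x \<partial>gauss I)"
      using gC by (intro nn_integral_indicator[symmetric]) (simp add: sets_gauss)
    also have "\<dots> = (\<integral>\<^sup>+x. indicator {x \<in> I \<rightarrow>\<^sub>E UNIV. normalize_vec I x \<in> A} (?g x) \<partial>gauss I)"
      using I by (intro nn_integral_cong) (auto simp: indicator_def)
    finally show ?thesis .
  qed
  also have "\<dots> = (\<integral>\<^sup>+x. indicator {x \<in> I \<rightarrow>\<^sub>E UNIV. normalize_vec I x \<in> A} x \<partial>gauss I)"
    by (rule nn_integral_gauss_givens[OF _ I cs]) (use C in simp)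
  also have "\<dots> = emeasure (gauss I) {x \<in> I \<rightarrow>\<^sub>E UNIV. normalize_vec I x \<in> A}"
    using C by (simp add: sets_gauss)
  also have "\<dots> = emeasure (sphere_measure I) A"
    by (rule emeasure_sphere_measure[OF I(1) A, symmetric])
  finally show "emeasure (distr (sphere_measure I) (sphere_measure I) ?g) A = emeasure (sphere_measure I) A" .
qed simp

section \<open>Rotation invariance of the eigenspaces\<close>

definition punctured :: "nat set \<Rightarrow> (nat \<Rightarrow> real) set"
  where "punctured I = {x \<in> I \<rightarrow>\<^sub>E UNIV. L2_set x I \<noteq> 0}"

lemma open_update2_punctured:
  assumes "finite I"
  shows "open {p. L2_set (x(i := fst p, j := snd p)) I \<noteq> 0}"
proof -
  have "continuous_on UNIV (\<lambda>p. (x(i := fst p, j := snd p)) k)" for k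
    by (cases "k = j"; cases "k = i") (auto intro!: continuous_intros)
  then show ?thesis
    unfolding L2_set_def
    by (intro open_Collect_neq continuous_on_real_sqrt continuous_on_sum continuous_on_power continuous_on_const)
qed

lemma eventually_update_punctured:
  assumes "finite I" "x \<in> punctured I" "i \<in> I"
  shows "eventually (\<lambda>t. x(i := t) \<in> punctured I) (nhds (x i))"
proof -
  (* Updating the same coordinate twice reduces one coordinate to the case of two. *)
  have "open {p. L2_set (x(i := fst p, i := snd p)) I \<noteq> 0}"
    by (rule open_update2_punctured[OF assms(1)])
  moreover have "(x i, x i) \<in> {p. L2_set (x(i := fst p, i := snd p)) I \<noteq> 0}"
    using assms by (simp add: punctured_def)
  ultimately have ev: "eventually (\<lambda>p. p \<in> {p. L2_set (x(i := fst p, i := snd p)) I \<noteq> 0}) (nhds (x i, x i))"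
    by (rule eventually_nhds_in_open)
  have "filterlim (\<lambda>t. (x i, t)) (nhds (x i, x i)) (nhds (x i))"
    by (intro tendsto_intros) (simp add: filterlim_ident)
  from eventually_compose_filterlim[OF ev this]
  have "eventually (\<lambda>t. L2_set (x(i := t)) I \<noteq> 0) (nhds (x i))"
    by simp
  then show ?thesis
    by eventually_elim (use assms in \<open>auto simp: punctured_def PiE_iff extensional_def\<close>)
qed

text \<open>
  A map with both partial derivatives, one of them continuous, is differentiable in the plane of the two
  coordinates, and this is composed with the curve \<open>(p, q)\<close> in that plane.
\<close>

lemma chain_rule_two_coordinates:
  assumes I: "finite I" "i \<in> I" "j \<in> I" "i \<noteq> j" and x: "x \<in> punctured I"
    and di: "\<And>y. y \<in> punctured I \<Longrightarrow> (\<lambda>t. F (y(i := t))) differentiable (at (y i))"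
    and dj: "\<And>y. y \<in> punctured I \<Longrightarrow> (\<lambda>t. F (y(j := t))) differentiable (at (y j))"
    and cj: "continuous_on (punctured I) (partial_deriv j F)"
    and p: "(p has_field_derivative p') (at t)" "p t = x i"
    and q: "(q has_field_derivative q') (at t)" "q t = x j"
  shows "((\<lambda>t. F (x(i := p t, j := q t))) has_field_derivative
    (p' * partial_deriv i F x + q' * partial_deriv j F x)) (at t)"
proof -
  have DI: "((\<lambda>t. F (y(i := t))) has_field_derivative partial_deriv i F y) (at (y i))"
    if "y \<in> punctured I" for y
    unfolding partial_deriv_def using di[OF that] by (simp add: DERIV_deriv_iff_real_differentiable)
  have DJ: "((\<lambda>t. F (y(j := t))) has_field_derivative partial_deriv j F y) (at (y j))"
    if "y \<in> punctured I" for y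
    unfolding partial_deriv_def using dj[OF that] by (simp add: DERIV_deriv_iff_real_differentiable)
  let ?W = "{p. L2_set (x(i := fst p, j := snd p)) I \<noteq> 0}"
  have "open ?W" by (rule open_update2_punctured[OF I(1)])
  moreover have "(x i, x j) \<in> ?W" using x by (simp add: punctured_def)
  ultimately obtain X Y where XY: "open X" "open Y" "(x i, x j) \<in> X \<times> Y" "X \<times> Y \<subseteq> ?W"
    by (rule open_prod_elim)
  obtain e where e: "e > 0" "ball (x j) e \<subseteq> Y"
    using XY by (auto simp: open_contains_ball)
  define B where "B = ball (x j) e"
  have U: "x(i := a, j := b) \<in> punctured I" if "a \<in> X" "b \<in> B" for a b
    using that XY e x I by (force simp: punctured_def PiE_iff extensional_def B_def)
  define G where "G = (\<lambda>a b. F (x(i := a, j := b)))"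
  define H where "H = (\<lambda>a b. blinfun_mult_right (partial_deriv j F (x(i := a, j := b))))"
  have "((\<lambda>(a, b). G a b) has_derivative
      (\<lambda>(ta, tb). partial_deriv i F x * ta + H (x i) (x j) tb)) (at (x i, x j) within X \<times> B)"
  proof (rule has_derivative_partialsI)
    have "((\<lambda>a. G a (x j)) has_derivative (*) (partial_deriv i F x)) (at (x i))"
      using DI[OF x] I by (simp add: G_def has_field_derivative_def fun_upd_idem fun_upd_twist)
    then show "((\<lambda>a. G a (x j)) has_derivative (*) (partial_deriv i F x)) (at (x i) within X)"
      by (rule has_derivative_at_withinI)
    show "((\<lambda>b. G a b) has_derivative blinfun_apply (H a b)) (at b within B)"
      if "a \<in> X" "b \<in> B" for a b
    proof (rule has_derivative_at_withinI)
      show "((\<lambda>b. G a b) has_derivative blinfun_apply (H a b)) (at b)"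
        using DJ[OF U[OF that]] by (simp add: G_def H_def has_field_derivative_def blinfun_mult_right.rep_eq)
    qed
    have "continuous_on (X \<times> B) (\<lambda>p. x(i := fst p, j := snd p))"
    proof (rule continuous_on_coordinatewise_then_product)
      show "continuous_on (X \<times> B) (\<lambda>p. (x(i := fst p, j := snd p)) k)" for k
        by (cases "k = j"; cases "k = i") (auto intro!: continuous_intros)
    qed
    then have "continuous_on (X \<times> B) (\<lambda>p. partial_deriv j F (x(i := fst p, j := snd p)))"
      by (rule continuous_on_compose2[OF cj]) (use U in auto)
    then have "continuous_on (X \<times> B) (\<lambda>p. H (fst p) (snd p))"
      unfolding H_def by (rule bounded_linear.continuous_on[OF bounded_linear_blinfun_mult_right])
    moreover have "(x i, x j) \<in> X \<times> B" using XY e by (auto simp: B_def)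
    ultimately show "continuous (at (x i, x j) within X \<times> B) (\<lambda>(a, b). H a b)"
      by (simp add: continuous_on_eq_continuous_within split_beta')
    show "x j \<in> B" "convex B" using e by (auto simp: B_def)
  qed
  moreover have "at (x i, x j) within X \<times> B = at (x i, x j)"
    by (rule at_within_open) (use XY e in \<open>auto simp: B_def intro: open_Times\<close>)
  moreover have "blinfun_apply (H (x i) (x j)) = (*) (partial_deriv j F x)"
    by (simp add: H_def blinfun_mult_right.rep_eq fun_eq_iff)
  ultimately have "((\<lambda>z. G (fst z) (snd z)) has_derivative
      (\<lambda>z. partial_deriv i F x * fst z + partial_deriv j F x * snd z)) (at (p t, q t))"
    by (simp add: split_beta' p q)
  moreover have "((\<lambda>t. (p t, q t)) has_derivative (\<lambda>h. (p' * h, q' * h))) (at t)"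
    using p(1) q(1) by (intro has_derivative_Pair) (simp_all add: has_field_derivative_def)
  ultimately have "((\<lambda>t. G (p t) (q t)) has_derivative
      (\<lambda>h. partial_deriv i F x * (p' * h) + partial_deriv j F x * (q' * h))) (at t)"
    using has_derivative_compose by fastforce
  moreover have "(\<lambda>h. partial_deriv i F x * (p' * h) + partial_deriv j F x * (q' * h)) =
      (*) (p' * partial_deriv i F x + q' * partial_deriv j F x)"
    by (auto simp: fun_eq_iff algebra_simps)
  ultimately show ?thesis
    unfolding G_def has_field_derivative_def by simp
qed

lemma partial_deriv_cong:
  assumes "finite I" "x \<in> punctured I" "i \<in> I" and eq: "\<And>y. y \<in> punctured I \<Longrightarrow> F y = G y"
  shows "partial_deriv i F x = partial_deriv i G x"
    and "(\<lambda>t. F (x(i := t))) differentiable (at (x i)) \<longleftrightarrow> (\<lambda>t. G (x(i := t))) differentiable (at (x i))"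
proof -
  have ev: "eventually (\<lambda>t. F (x(i := t)) = G (x(i := t))) (nhds (x i))"
    using eventually_update_punctured[OF assms(1-3)] by eventually_elim (rule eq)
  then show "partial_deriv i F x = partial_deriv i G x"
    unfolding partial_deriv_def by (rule deriv_cong_ev) simp
  show "(\<lambda>t. F (x(i := t))) differentiable (at (x i)) \<longleftrightarrow> (\<lambda>t. G (x(i := t))) differentiable (at (x i))"
    using DERIV_cong_ev[OF refl ev refl] by (simp add: real_differentiable_def)
qed

lemma Ck_cong:
  assumes "finite I" and "\<And>x. x \<in> punctured I \<Longrightarrow> F x = G x"
  shows "Ck I k (punctured I) F \<longleftrightarrow> Ck I k (punctured I) G"
  using assms(2)
proof (induction k arbitrary: F G)
  case 0
  then show ?case by (simp cong: continuous_on_cong)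
next
  case (Suc k)
  have "Ck I k (punctured I) (partial_deriv i F) \<longleftrightarrow> Ck I k (punctured I) (partial_deriv i G)" if "i \<in> I" for i
    by (rule Suc.IH) (rule partial_deriv_cong(1)[OF assms(1) _ that Suc.prems])
  moreover have "continuous_on (punctured I) F \<longleftrightarrow> continuous_on (punctured I) G"
    using Suc.prems by (simp cong: continuous_on_cong)
  moreover have "(\<lambda>t. F (x(i := t))) differentiable (at (x i)) \<longleftrightarrow>
      (\<lambda>t. G (x(i := t))) differentiable (at (x i))" if "i \<in> I" "x \<in> punctured I" for i x
    using assms(1) that(2,1) Suc.prems by (rule partial_deriv_cong(2))
  ultimately show ?case by auto
qed

lemma Ck_imp_continuous_on: "Ck I k U F \<Longrightarrow> continuous_on U F"
  by (cases k) auto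

lemma partial_deriv_linear:
  assumes "(\<lambda>t. F (x(i := t))) differentiable (at (x i))" "(\<lambda>t. G (x(i := t))) differentiable (at (x i))"
  shows "partial_deriv i (\<lambda>x. a * F x + b * G x) x = a * partial_deriv i F x + b * partial_deriv i G x"
  unfolding partial_deriv_def
  by (intro DERIV_imp_deriv DERIV_add DERIV_cmult)
     (use assms in \<open>simp_all add: DERIV_deriv_iff_real_differentiable\<close>)

lemma Ck_linear:
  assumes I: "finite I" and F: "Ck I k (punctured I) F" and G: "Ck I k (punctured I) G"
  shows "Ck I k (punctured I) (\<lambda>x. a * F x + b * G x)"
  using F G
proof (induction k arbitrary: F G)
  case 0
  then show ?case by (simp add: continuous_on_add continuous_on_mult_left)
next
  case (Suc k)
  have "Ck I k (punctured I) (partial_deriv i (\<lambda>x. a * F x + b * G x))" if i: "i \<in> I" for i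
  proof -
    have "Ck I k (punctured I) (\<lambda>x. a * partial_deriv i F x + b * partial_deriv i G x)"
      using Suc i by auto
    moreover have "Ck I k (punctured I) (partial_deriv i (\<lambda>x. a * F x + b * G x)) \<longleftrightarrow>
        Ck I k (punctured I) (\<lambda>x. a * partial_deriv i F x + b * partial_deriv i G x)"
      by (rule Ck_cong[OF I], rule partial_deriv_linear) (use Suc.prems i in auto)
    ultimately show ?thesis by simp
  qed
  moreover have "continuous_on (punctured I) (\<lambda>x. a * F x + b * G x)"
    using Suc.prems by (intro continuous_on_add continuous_on_mult_left) simp_all
  moreover have "(\<lambda>t. a * F (x(i := t)) + b * G (x(i := t))) differentiable (at (x i))"
    if "i \<in> I" "x \<in> punctured I" for i x
    using Suc.prems that by (intro differentiable_add differentiable_mult differentiable_const) simp_all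
  ultimately show ?case by simp
qed

lemma continuous_on_givens: "continuous_on U (givens i j c s)"
proof (rule continuous_on_coordinatewise_then_product)
  have coord: "continuous_on U (\<lambda>x. x k :: real)" for k :: nat
    by (rule continuous_on_subset[OF continuous_on_product_coordinates]) simp
  have lin: "continuous_on U (\<lambda>x. a * x i + b * x j :: real)" for a b
    by (rule continuous_on_add; rule continuous_on_mult_left; rule coord)
  show "continuous_on U (\<lambda>x. givens i j c s x k)" for k
    using lin[of c "- s"] lin[of s c] coord[of k]
    unfolding givens_def by (cases "k = j"; cases "k = i") simp_all
qed

text \<open>
  The chain rule expresses the partial derivatives of \<open>F\<close> composed with a rotation as combinations of
  those of \<open>F\<close>, evaluated at the rotated point.  They have the form of the composition again, which
  makes induction on the order of differentiability possible.
\<close>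

definition rotated_partial ::
    "nat \<Rightarrow> nat \<Rightarrow> real \<Rightarrow> real \<Rightarrow> nat \<Rightarrow> ((nat \<Rightarrow> real) \<Rightarrow> real) \<Rightarrow> (nat \<Rightarrow> real) \<Rightarrow> real"
  where "rotated_partial i j c s k F =
    (if k = i then (\<lambda>x. c * partial_deriv i F x + s * partial_deriv j F x)
     else if k = j then (\<lambda>x. - s * partial_deriv i F x + c * partial_deriv j F x)
     else partial_deriv k F)"

context
  fixes I :: "nat set" and i j :: nat and c s :: real
  assumes I: "finite I" "i \<in> I" "j \<in> I" "i \<noteq> j" and cs: "c\<^sup>2 + s\<^sup>2 = 1"
begin

lemma givens_punctured: "givens i j c s x \<in> punctured I \<longleftrightarrow> x \<in> punctured I"
  using I by (simp add: punctured_def L2_set_givens[OF I cs])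

lemma has_partial_deriv_givens:
  assumes F: "Ck I (Suc n) (punctured I) F" and k: "k \<in> I" and x: "x \<in> punctured I"
  shows "((\<lambda>t. F (givens i j c s (x(k := t)))) has_field_derivative
    rotated_partial i j c s k F (givens i j c s x)) (at (x k))"
proof -
  let ?y = "givens i j c s x"
  have y: "?y \<in> punctured I" using x by (simp add: givens_punctured)
  have d: "(\<lambda>t. F (z(m := t))) differentiable (at (z m))" if "m \<in> I" "z \<in> punctured I" for m z
    using F that by simp
  have cj: "continuous_on (punctured I) (partial_deriv j F)"
    using F I by (auto intro: Ck_imp_continuous_on)
  note chain = chain_rule_two_coordinates[OF I y d[OF I(2)] d[OF I(3)] cj]
  consider "k = i" | "k = j" | "k \<noteq> i" "k \<noteq> j" by blast
  then show ?thesis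
  proof cases
    case 1
    have "((\<lambda>t. F (?y(i := c * t - s * x j, j := s * t + c * x j))) has_field_derivative
        (c * partial_deriv i F ?y + s * partial_deriv j F ?y)) (at (x i))"
    proof (rule chain)
      show "((\<lambda>t. c * t - s * x j) has_field_derivative c) (at (x i))"
        "((\<lambda>t. s * t + c * x j) has_field_derivative s) (at (x i))"
        by (auto intro!: derivative_eq_intros)
    qed (use I in \<open>simp_all add: givens_def\<close>)
    moreover have "givens i j c s (x(i := t)) = ?y(i := c * t - s * x j, j := s * t + c * x j)" for t
      using I by (auto simp: givens_def)
    ultimately show ?thesis using 1 by (simp add: rotated_partial_def)
  next
    case 2
    have "((\<lambda>t. F (?y(i := c * x i - s * t, j := s * x i + c * t))) has_field_derivative
        (- s * partial_deriv i F ?y + c * partial_deriv j F ?y)) (at (x j))"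
    proof (rule chain)
      show "((\<lambda>t. c * x i - s * t) has_field_derivative - s) (at (x j))"
        "((\<lambda>t. s * x i + c * t) has_field_derivative c) (at (x j))"
        by (auto intro!: derivative_eq_intros)
    qed (use I in \<open>simp_all add: givens_def\<close>)
    moreover have "givens i j c s (x(j := t)) = ?y(i := c * x i - s * t, j := s * x i + c * t)" for t
      using I by (auto simp: givens_def)
    ultimately show ?thesis using 2 I by (simp add: rotated_partial_def)
  next
    case 3
    have "((\<lambda>t. F (?y(k := t))) has_field_derivative partial_deriv k F ?y) (at (?y k))"
      unfolding partial_deriv_def using d[OF k y] by (simp add: DERIV_deriv_iff_real_differentiable)
    moreover have "givens i j c s (x(k := t)) = ?y(k := t)" for t
      using 3 by (auto simp: givens_def)
    moreover have "?y k = x k" using 3 by (simp add: givens_def)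
    ultimately show ?thesis using 3 by (simp add: rotated_partial_def)
  qed
qed

lemma partial_deriv_givens:
  assumes "Ck I (Suc n) (punctured I) F" "k \<in> I" "x \<in> punctured I"
  shows "partial_deriv k (\<lambda>x. F (givens i j c s x)) x = rotated_partial i j c s k F (givens i j c s x)"
  using has_partial_deriv_givens[OF assms] unfolding partial_deriv_def by (rule DERIV_imp_deriv)

lemma Ck_rotated_partial:
  assumes "Ck I (Suc n) (punctured I) F" "k \<in> I"
  shows "Ck I n (punctured I) (rotated_partial i j c s k F)"
proof -
  have "Ck I n (punctured I) (partial_deriv m F)" if "m \<in> I" for m
    using assms that by simp
  then show ?thesis
    using I assms(2) Ck_linear[OF I(1), of n "partial_deriv i F" "partial_deriv j F" "- s" c]
    unfolding rotated_partial_def by (simp add: Ck_linear[OF I(1)])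
qed

lemma Ck_givens:
  assumes "Ck I n (punctured I) F"
  shows "Ck I n (punctured I) (\<lambda>x. F (givens i j c s x))"
proof -
  have cont: "continuous_on (punctured I) (\<lambda>x. F (givens i j c s x))"
    if "continuous_on (punctured I) F" for F :: "_ \<Rightarrow> real"
    by (rule continuous_on_compose2[OF that continuous_on_givens]) (auto simp: givens_punctured)
  from assms show ?thesis
  proof (induction n arbitrary: F)
    case 0
    then show ?case by (simp add: cont)
  next
    case (Suc n)
    have "continuous_on (punctured I) (\<lambda>x. F (givens i j c s x))"
      by (rule cont[OF Ck_imp_continuous_on[OF Suc.prems]])
    moreover have "(\<lambda>t. F (givens i j c s (x(k := t)))) differentiable (at (x k))"
      if "k \<in> I" "x \<in> punctured I" for k x
      using has_partial_deriv_givens[OF Suc.prems that] real_differentiable_def by blast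
    moreover have "Ck I n (punctured I) (partial_deriv k (\<lambda>x. F (givens i j c s x)))" if k: "k \<in> I" for k
    proof -
      have "Ck I n (punctured I) (partial_deriv k (\<lambda>x. F (givens i j c s x))) \<longleftrightarrow>
          Ck I n (punctured I) (\<lambda>x. rotated_partial i j c s k F (givens i j c s x))"
        by (rule Ck_cong[OF I(1)], rule partial_deriv_givens[OF Suc.prems k])
      then show ?thesis
        using Suc.IH[OF Ck_rotated_partial[OF Suc.prems k]] by simp
    qed
    ultimately show ?case by simp
  qed
qed

text \<open>
  Each of the two mixed derivatives in the rotated plane enters the second derivative along one
  axis with the factor \<open>c s\<close> and along the other with \<open>- c s\<close>, and \<open>c\<^sup>2 + s\<^sup>2 = 1\<close> collects the rest.
\<close>

lemma laplacian_givens: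
  assumes F: "Ck I (Suc (Suc n)) (punctured I) F" and x: "x \<in> punctured I"
  shows "(\<Sum>k\<in>I. partial_deriv k (partial_deriv k (\<lambda>x. F (givens i j c s x))) x) =
    (\<Sum>k\<in>I. partial_deriv k (partial_deriv k F) (givens i j c s x))"
proof -
  let ?y = "givens i j c s x"
  have y: "?y \<in> punctured I" using x by (simp add: givens_punctured)
  have twice: "partial_deriv k (partial_deriv k (\<lambda>x. F (givens i j c s x))) x =
      rotated_partial i j c s k (rotated_partial i j c s k F) ?y" if k: "k \<in> I" for k
  proof -
    have "partial_deriv k (partial_deriv k (\<lambda>x. F (givens i j c s x))) x =
        partial_deriv k (\<lambda>x. rotated_partial i j c s k F (givens i j c s x)) x"
      by (rule partial_deriv_cong(1)[OF I(1) x k]) (rule partial_deriv_givens[OF F k])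
    also have "\<dots> = rotated_partial i j c s k (rotated_partial i j c s k F) ?y"
      by (rule partial_deriv_givens[OF Ck_rotated_partial[OF F k] k x])
    finally show ?thesis .
  qed
  have d: "(\<lambda>t. partial_deriv m F (?y(k := t))) differentiable (at (?y k))" if "k \<in> I" "m \<in> I" for k m
    using F y that by auto
  let ?P = "\<lambda>k m. partial_deriv k (partial_deriv m F) ?y"
  have ii: "rotated_partial i j c s i (rotated_partial i j c s i F) ?y =
      c * (c * ?P i i + s * ?P i j) + s * (c * ?P j i + s * ?P j j)"
    using I by (simp add: rotated_partial_def partial_deriv_linear d)
  have jj: "rotated_partial i j c s j (rotated_partial i j c s j F) ?y =
      - s * (- s * ?P i i + c * ?P i j) + c * (- s * ?P j i + c * ?P j j)"
    using I partial_deriv_linear[OF d d, of i i j "- s" c] partial_deriv_linear[OF d d, of j i j "- s" c]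
    by (simp add: rotated_partial_def)
  define J where "J = I - {i, j}"
  have IJ: "I = insert j (insert i J)" "i \<notin> J" "j \<notin> insert i J" "finite J"
    using I by (auto simp: J_def)
  have "rotated_partial i j c s i (rotated_partial i j c s i F) ?y + rotated_partial i j c s j (rotated_partial i j c s j F) ?y =
      (c\<^sup>2 + s\<^sup>2) * (?P i i + ?P j j)"
    unfolding ii jj by (simp add: power2_eq_square algebra_simps)
  moreover have "(\<Sum>k\<in>J. rotated_partial i j c s k (rotated_partial i j c s k F) ?y) = (\<Sum>k\<in>J. ?P k k)"
    using IJ by (intro sum.cong) (auto simp: rotated_partial_def)
  ultimately have "(\<Sum>k\<in>I. rotated_partial i j c s k (rotated_partial i j c s k F) ?y) = (\<Sum>k\<in>I. ?P k k)"
    using IJ cs by simp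
  with twice show ?thesis by simp
qed

end

lemma eigenspace_givens:
  assumes f: "f \<in> eigenspace l d" and ij: "i \<le> d" "j \<le> d" "i \<noteq> j" and cs: "c\<^sup>2 + s\<^sup>2 = 1"
  shows "(\<lambda>x. f (givens i j c s x)) \<in> eigenspace l d"
proof -
  have I: "finite {..d}" "i \<in> {..d}" "j \<in> {..d}" "i \<noteq> j" using ij by auto
  let ?g = "givens i j c s"
  have ext: "radial_ext d (\<lambda>x. f (?g x)) = (\<lambda>x. radial_ext d f (?g x))"
    by (simp add: radial_ext_def fun_eq_iff normalize_vec_givens[OF I cs])
  have smooth: "Ck {..d} k (punctured {..d}) (radial_ext d f)" for k
    using f by (simp add: eigenspace_def smooth_on_sphere_def punctured_def)
  have "smooth_on_sphere d (\<lambda>x. f (?g x))"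
    unfolding smooth_on_sphere_def ext using Ck_givens[OF I cs smooth] by (simp add: punctured_def)
  moreover have "laplace_beltrami d (\<lambda>x. f (?g x)) x = - (real l * (real l + real d - 1)) * f (?g x)"
    if x: "x \<in> unit_sphere {..d}" for x
  proof -
    have "x \<in> punctured {..d}" using x by (auto simp: unit_sphere_def punctured_def)
    then have "laplace_beltrami d (\<lambda>x. f (?g x)) x = laplace_beltrami d f (?g x)"
      unfolding laplace_beltrami_def ext by (rule laplacian_givens[OF I cs smooth])
    also have "\<dots> = - (real l * (real l + real d - 1)) * f (?g x)"
      using f x givens_unit_sphere[OF I cs] by (simp add: eigenspace_def)
    finally show ?thesis .
  qed
  ultimately show ?thesis by (simp add: eigenspace_def)
qed

section \<open>The normal distribution function\<close>

abbreviation normal_cdf :: "real \<Rightarrow> real"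
  where "normal_cdf \<equiv> cdf std_normal_distribution"

lemma normal_cdf_bounds: "0 \<le> normal_cdf u" "normal_cdf u \<le> 1"
  by (auto simp: N.cdf_nonneg N.cdf_bounded_prob)

lemma DERIV_normal_cdf: "(normal_cdf has_real_derivative std_normal_density u) (at u)"
proof -
  have cont: "continuous_on A std_normal_density" for A
    unfolding std_normal_density_def[abs_def] by (intro continuous_intros) simp
  have eq: "normal_cdf x = normal_cdf (u - 1) + integral {u - 1..x} std_normal_density"
    if x: "x \<in> {u - 1..u + 1}" for x
  proof (cases "x = u - 1")
    case False
    then have "normal_cdf x - normal_cdf (u - 1) = measure std_normal_distribution {u - 1<..x}"
      using x by (intro N.cdf_diff_eq) simp
    also have "\<dots> = (LINT t|std_normal_distribution. indicator {u - 1<..x} t)"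
      by simp
    also have "\<dots> = (LINT t|lborel. std_normal_density t *\<^sub>R indicator {u - 1<..x} t)"
      by (rule integral_density) simp_all
    also have "\<dots> = (LINT t : {u - 1..x} | lborel. std_normal_density t)"
      unfolding set_lebesgue_integral_def
      by (rule integral_cong_AE) (use AE_lborel_singleton[of "u - 1"] in \<open>auto simp: indicator_def\<close>)
    also have "\<dots> = integral {u - 1..x} std_normal_density"
      by (rule set_borel_integral_eq_integral(2)[OF borel_integrable_atLeastAtMost'[OF cont]])
    finally show ?thesis by simp
  qed simp
  have "((\<lambda>x. normal_cdf (u - 1) + integral {u - 1..x} std_normal_density) has_real_derivative
      std_normal_density u) (at u within {u - 1..u + 1})"
    using DERIV_add[OF DERIV_const integral_has_real_derivative[OF cont, of u "u - 1" "u + 1"]] by simp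
  then have "(normal_cdf has_real_derivative std_normal_density u) (at u within {u - 1..u + 1})"
    by (rule has_field_derivative_transform_within[OF _ zero_less_one]) (simp, rule eq[symmetric])
  moreover have "at u within {u - 1..u + 1} = at u"
    by (rule at_within_interior) simp
  ultimately show ?thesis by simp
qed

lemma std_normal_density_le_1: "std_normal_density x \<le> 1"
proof -
  have "sqrt (2 * pi) \<ge> 1" using pi_gt3 by (simp add: real_le_rsqrt)
  then show ?thesis
    by (simp add: std_normal_density_def divide_le_eq order.trans[of _ 1])
qed

lemma abs_mult_std_normal_density_le_1: "\<bar>x * std_normal_density x\<bar> \<le> 1"
proof -
  have "\<bar>x\<bar> \<le> 1 + x\<^sup>2 / 2"
    using zero_le_power2[of "\<bar>x\<bar> - 1"] by (simp add: power2_eq_square algebra_simps)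
  also have "\<dots> \<le> exp (x\<^sup>2 / 2)" by (rule exp_ge_add_one_self)
  finally have "\<bar>x\<bar> * exp (- x\<^sup>2 / 2) \<le> 1"
    by (simp add: exp_minus field_simps)
  also have "1 \<le> sqrt (2 * pi)" using pi_gt3 by (simp add: real_le_rsqrt)
  finally show ?thesis
    by (simp add: std_normal_density_def abs_mult divide_le_eq)
qed

lemma normal_cdf_MVT:
  obtains \<xi> where "normal_cdf v - normal_cdf u = (v - u) * std_normal_density \<xi>"
    "min u v \<le> \<xi>" "\<xi> \<le> max u v"
proof (cases u v rule: linorder_cases)
  case less
  then obtain \<xi> where "u < \<xi>" "\<xi> < v" "normal_cdf v - normal_cdf u = (v - u) * std_normal_density \<xi>"
    using MVT2[of u v normal_cdf std_normal_density] DERIV_normal_cdf by blast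
  with less that show ?thesis by force
next
  case equal
  with that[of u] show ?thesis by simp
next
  case greater
  then obtain \<xi> where "v < \<xi>" "\<xi> < u" "normal_cdf u - normal_cdf v = (u - v) * std_normal_density \<xi>"
    using MVT2[of v u normal_cdf std_normal_density] DERIV_normal_cdf by blast
  with greater that[of \<xi>] show ?thesis by (force simp: algebra_simps)
qed

lemma normal_cdf_taylor: "\<bar>normal_cdf (u + h) - normal_cdf u - h * std_normal_density u\<bar> \<le> h\<^sup>2"
proof -
  obtain \<xi> where \<xi>: "normal_cdf (u + h) - normal_cdf u = h * std_normal_density \<xi>"
      "min u (u + h) \<le> \<xi>" "\<xi> \<le> max u (u + h)"
    using normal_cdf_MVT[of "u + h" u] by auto
  have deriv: "(std_normal_density has_field_derivative - (x * std_normal_density x)) (at x within UNIV)" for x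
    unfolding std_normal_density_def by (rule derivative_eq_intros | simp)+
  have "norm (std_normal_density \<xi> - std_normal_density u) \<le> 1 * norm (\<xi> - u)"
    by (rule field_differentiable_bound[OF convex_UNIV deriv])
       (use abs_mult_std_normal_density_le_1 in auto)
  then have "\<bar>std_normal_density \<xi> - std_normal_density u\<bar> \<le> \<bar>h\<bar>"
    using \<xi> by (simp add: min_def max_def split: if_splits)
  then have "\<bar>h\<bar> * \<bar>std_normal_density \<xi> - std_normal_density u\<bar> \<le> \<bar>h\<bar> * \<bar>h\<bar>"
    by (rule mult_left_mono) simp
  then show ?thesis
    unfolding \<xi> by (simp add: power2_eq_square abs_mult[symmetric] algebra_simps)
qed

text \<open>
  Stretching the argument moves \<open>normal_cdf\<close> little, uniformly in \<open>u\<close>: where \<open>u\<close> is large the density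
  is small, and \<open>x\<close> times the density at \<open>x\<close> is bounded.  The factor \<open>r\<close> is later the
  reciprocal of a conditional standard deviation, and the norm of a Gaussian vector over \<open>sqrt n\<close>.
\<close>

lemma normal_cdf_scale:
  assumes "r > 0"
  shows "\<bar>normal_cdf (u * r) - normal_cdf u\<bar> \<le> 2 * \<bar>r - 1\<bar>"
proof (cases "r \<ge> 1 / 2")
  case True
  obtain \<xi> where \<xi>: "normal_cdf (u * r) - normal_cdf u = (u * r - u) * std_normal_density \<xi>"
      "min u (u * r) \<le> \<xi>" "\<xi> \<le> max u (u * r)"
    by (rule normal_cdf_MVT)
  have "\<bar>u\<bar> \<le> 2 * \<bar>\<xi>\<bar>"
  proof (cases "u \<ge> 0")
    case u: True
    have "u * (1 / 2) \<le> u * r" using u True by (intro mult_left_mono) auto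
    then have "u * (1 / 2) \<le> min u (u * r)" using u by simp
    then have "u * (1 / 2) \<le> \<xi>" using \<xi>(2) by (rule order.trans)
    then show ?thesis using u by simp
  next
    case u: False
    have "u * r \<le> u * (1 / 2)" using u True by (intro mult_left_mono_neg) auto
    moreover have "u \<le> u * (1 / 2)" using u by simp
    ultimately have "max u (u * r) \<le> u * (1 / 2)" by (intro max.boundedI)
    with \<xi>(3) have "\<xi> \<le> u * (1 / 2)" by (rule order.trans)
    then show ?thesis using u by simp
  qed
  then have "\<bar>u\<bar> * std_normal_density \<xi> \<le> 2 * \<bar>\<xi>\<bar> * std_normal_density \<xi>"
    by (rule mult_right_mono) simp
  also have "\<dots> \<le> 2"
    using abs_mult_std_normal_density_le_1[of \<xi>] by (simp add: abs_mult)
  finally have "\<bar>r - 1\<bar> * (\<bar>u\<bar> * std_normal_density \<xi>) \<le> \<bar>r - 1\<bar> * 2"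
    by (rule mult_left_mono) simp
  moreover have "\<bar>(u * r - u) * std_normal_density \<xi>\<bar> = \<bar>r - 1\<bar> * (\<bar>u\<bar> * std_normal_density \<xi>)"
  proof -
    have "(u * r - u) * std_normal_density \<xi> = (r - 1) * (u * std_normal_density \<xi>)"
      by (simp add: algebra_simps)
    then show ?thesis by (simp only: abs_mult) (simp add: abs_mult)
  qed
  ultimately show ?thesis unfolding \<xi>(1) by linarith
next
  case False
  then have "1 \<le> 2 * \<bar>r - 1\<bar>" by (simp add: abs_if)
  moreover have "\<bar>normal_cdf (u * r) - normal_cdf u\<bar> \<le> 1"
    using normal_cdf_bounds[of u] normal_cdf_bounds[of "u * r"] by linarith
  ultimately show ?thesis by linarith
qed

section \<open>Two linear forms of a Gaussian vector\<close>

lemma polar_coordinates: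
  obtains c s p :: real where "c\<^sup>2 + s\<^sup>2 = 1" "p \<ge> 0" "u = p * c" "v = p * s" "p\<^sup>2 = u\<^sup>2 + v\<^sup>2"
proof (cases "u = 0 \<and> v = 0")
  case True
  with that[of 1 0 0] show ?thesis by simp
next
  case False
  define p where "p = sqrt (u\<^sup>2 + v\<^sup>2)"
  have pos: "u\<^sup>2 + v\<^sup>2 > 0"
    using False by (simp add: sum_power2_gt_zero_iff)
  then have p: "p > 0" "p\<^sup>2 = u\<^sup>2 + v\<^sup>2" by (auto simp: p_def)
  have "(u / p)\<^sup>2 + (v / p)\<^sup>2 = 1"
    using False by (simp add: power_divide add_divide_distrib[symmetric] p(2))
  with p that[of "u / p" "v / p" p] show ?thesis by simp
qed

text \<open>
  By induction on the number of coordinates.  A new coordinate \<open>z\<close> turns the pair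
  \<open>(p x, q x + r y)\<close> into \<open>(p x + a z, q x + r y + b z)\<close>; a rotation of \<open>(x, z)\<close> removes \<open>z\<close> from
  the first entry, and a rotation of \<open>(z, y)\<close> merges the two remaining independent terms of the second.
\<close>

lemma gauss_pair_law:
  fixes a b :: "nat \<Rightarrow> real"
  assumes "finite I"
  shows "\<exists>p q r. p \<ge> 0 \<and> r \<ge> 0 \<and> p\<^sup>2 = (\<Sum>i\<in>I. (a i)\<^sup>2) \<and> p * q = (\<Sum>i\<in>I. a i * b i) \<and>
    q\<^sup>2 + r\<^sup>2 = (\<Sum>i\<in>I. (b i)\<^sup>2) \<and>
    (\<forall>f\<in>borel_measurable borel. (\<integral>\<^sup>+G. f (\<Sum>i\<in>I. a i * G i, \<Sum>i\<in>I. b i * G i) \<partial>gauss I) =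
      (\<integral>\<^sup>+x. \<integral>\<^sup>+y. f (p * x, q * x + r * y) \<partial>std_normal_distribution \<partial>std_normal_distribution))"
  using assms
proof (induction I)
  case empty
  have "(\<integral>\<^sup>+G. c \<partial>gauss {}) = c" "(\<integral>\<^sup>+x. c \<partial>std_normal_distribution) = c" for c :: ennreal
    using prob_space.emeasure_space_1[OF prob_space_gauss[of "{}"]] N.emeasure_space_1 by simp_all
  then show ?case
    by (intro exI[of _ 0]) simp
next
  case (insert i I)
  let ?N = std_normal_distribution
  from insert.IH obtain p q r where pqr: "p \<ge> 0" "r \<ge> 0" "p\<^sup>2 = (\<Sum>i\<in>I. (a i)\<^sup>2)"
      "p * q = (\<Sum>i\<in>I. a i * b i)" "q\<^sup>2 + r\<^sup>2 = (\<Sum>i\<in>I. (b i)\<^sup>2)"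
    and IH: "\<And>f. f \<in> borel_measurable borel \<Longrightarrow> (\<integral>\<^sup>+G. f (\<Sum>i\<in>I. a i * G i, \<Sum>i\<in>I. b i * G i) \<partial>gauss I) =
      (\<integral>\<^sup>+x. \<integral>\<^sup>+y. f (p * x, q * x + r * y) \<partial>?N \<partial>?N)"
    by auto
  obtain c s p' where p': "c\<^sup>2 + s\<^sup>2 = 1" "p' \<ge> 0" "p = p' * c" "a i = p' * s" "p'\<^sup>2 = p\<^sup>2 + (a i)\<^sup>2"
    by (rule polar_coordinates)
  define q' t where "q' = q * c + b i * s" and "t = b i * c - q * s"
  obtain c' s' r' where r': "c'\<^sup>2 + s'\<^sup>2 = 1" "r' \<ge> 0" "t = r' * c'" "r = r' * s'" "r'\<^sup>2 = t\<^sup>2 + r\<^sup>2"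
    by (rule polar_coordinates)
  have qt: "q'\<^sup>2 + t\<^sup>2 = (c\<^sup>2 + s\<^sup>2) * (q\<^sup>2 + (b i)\<^sup>2)"
    by (simp add: q'_def t_def power2_eq_square algebra_simps)
  have "(\<integral>\<^sup>+G. f (\<Sum>j\<in>insert i I. a j * G j, \<Sum>j\<in>insert i I. b j * G j) \<partial>gauss (insert i I)) =
      (\<integral>\<^sup>+x. \<integral>\<^sup>+y. f (p' * x, q' * x + r' * y) \<partial>?N \<partial>?N)"
    if f: "f \<in> borel_measurable borel" for f
  proof -
    have [measurable]: "f \<in> borel_measurable (borel \<Otimes>\<^sub>M borel)"
      using f by (simp add: borel_prod)
    have shift: "(\<lambda>w. f (fst w + u, snd w + v)) \<in> borel_measurable borel" for u v
      by (rule measurable_compose[OF _ f]) (intro borel_measurable_continuous_onI continuous_intros)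
    have "(\<integral>\<^sup>+G. f (\<Sum>j\<in>insert i I. a j * G j, \<Sum>j\<in>insert i I. b j * G j) \<partial>gauss (insert i I)) =
        (\<integral>\<^sup>+z. \<integral>\<^sup>+G. f (\<Sum>j\<in>insert i I. a j * (G(i := z)) j, \<Sum>j\<in>insert i I. b j * (G(i := z)) j) \<partial>gauss I \<partial>?N)"
      unfolding gauss_def by (rule NP.product_nn_integral_insert_rev) (use insert in \<open>simp_all\<close>)
    also have "\<dots> = (\<integral>\<^sup>+z. \<integral>\<^sup>+G. f ((\<Sum>j\<in>I. a j * G j) + a i * z, (\<Sum>j\<in>I. b j * G j) + b i * z) \<partial>gauss I \<partial>?N)"
    proof -
      have "(\<Sum>j\<in>insert i I. e j * (G(i := z)) j) = (\<Sum>j\<in>I. e j * G j) + e i * z" for e G :: "nat \<Rightarrow> real" and z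
      proof -
        have "(\<Sum>j\<in>I. e j * (G(i := z)) j) = (\<Sum>j\<in>I. e j * G j)"
          using insert by (intro sum.cong) auto
        then show ?thesis using insert by simp
      qed
      then show ?thesis by simp
    qed
    also have "\<dots> = (\<integral>\<^sup>+z. \<integral>\<^sup>+x. \<integral>\<^sup>+y. f (p * x + a i * z, q * x + r * y + b i * z) \<partial>?N \<partial>?N \<partial>?N)"
      using IH[OF shift] by simp
    also have "\<dots> = (\<integral>\<^sup>+x. \<integral>\<^sup>+z. \<integral>\<^sup>+y. f (p * x + a i * z, q * x + r * y + b i * z) \<partial>?N \<partial>?N \<partial>?N)"
    proof -
      interpret NN: pair_sigma_finite ?N ?N ..
      show ?thesis by (rule NN.Fubini') measurable
    qed
    also have "\<dots> = (\<integral>\<^sup>+x. \<integral>\<^sup>+z. \<integral>\<^sup>+y. f (p * (c * x - s * z) + a i * (s * x + c * z),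
        q * (c * x - s * z) + r * y + b i * (s * x + c * z)) \<partial>?N \<partial>?N \<partial>?N)"
    proof -
      have "(\<lambda>w. \<integral>\<^sup>+y. f (p * fst w + a i * snd w, q * fst w + r * y + b i * snd w) \<partial>?N)
          \<in> borel_measurable (borel \<Otimes>\<^sub>M borel)"
        by measurable
      then have "(\<lambda>w. \<integral>\<^sup>+y. f (p * fst w + a i * snd w, q * fst w + r * y + b i * snd w) \<partial>?N)
          \<in> borel_measurable borel"
        by (simp only: borel_prod)
      from nn_integral_normal_rotation[OF this p'(1)] show ?thesis by simp
    qed
    also have "\<dots> = (\<integral>\<^sup>+x. \<integral>\<^sup>+z. \<integral>\<^sup>+y. f (p' * x, q' * x + (t * z + r * y)) \<partial>?N \<partial>?N \<partial>?N)"
    proof -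
      have "p * (c * x - s * z) + a i * (s * x + c * z) = p' * ((c\<^sup>2 + s\<^sup>2) * x)" for x z
        unfolding p'(3,4) by (simp add: power2_eq_square algebra_simps)
      then have e1: "p * (c * x - s * z) + a i * (s * x + c * z) = p' * x" for x z
        using p'(1) by simp
      have e2: "q * (c * x - s * z) + r * y + b i * (s * x + c * z) = q' * x + (t * z + r * y)" for x y z
        by (simp add: q'_def t_def algebra_simps)
      show ?thesis unfolding e1 e2 ..
    qed
    also have "\<dots> = (\<integral>\<^sup>+x. \<integral>\<^sup>+z. \<integral>\<^sup>+y. f (p' * x, q' * x + r' * z) \<partial>?N \<partial>?N \<partial>?N)"
    proof (rule nn_integral_cong)
      fix x
      have "(\<lambda>w. f (p' * x, q' * x + (t * fst w + r * snd w))) \<in> borel_measurable borel"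
        by (rule measurable_compose[OF _ f]) (intro borel_measurable_continuous_onI continuous_intros)
      from nn_integral_normal_rotation[OF this r'(1)]
      have "(\<integral>\<^sup>+z. \<integral>\<^sup>+y. f (p' * x, q' * x + (t * z + r * y)) \<partial>?N \<partial>?N) =
          (\<integral>\<^sup>+z. \<integral>\<^sup>+y. f (p' * x, q' * x + (t * (c' * z - s' * y) + r * (s' * z + c' * y))) \<partial>?N \<partial>?N)"
        by simp
      moreover have "t * (c' * z - s' * y) + r * (s' * z + c' * y) = r' * z" for y z
      proof -
        have "t * (c' * z - s' * y) + r * (s' * z + c' * y) = r' * ((c'\<^sup>2 + s'\<^sup>2) * z)"
          unfolding r'(3,4) by (simp add: power2_eq_square algebra_simps)
        then show ?thesis using r'(1) by simp
      qed
      ultimately show "(\<integral>\<^sup>+z. \<integral>\<^sup>+y. f (p' * x, q' * x + (t * z + r * y)) \<partial>?N \<partial>?N) =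
          (\<integral>\<^sup>+z. \<integral>\<^sup>+y. f (p' * x, q' * x + r' * z) \<partial>?N \<partial>?N)"
        by simp
    qed
    also have "\<dots> = (\<integral>\<^sup>+x. \<integral>\<^sup>+y. f (p' * x, q' * x + r' * y) \<partial>?N \<partial>?N)"
      using N.emeasure_space_1 by simp
    finally show ?thesis .
  qed
  moreover have "p'\<^sup>2 = (\<Sum>j\<in>insert i I. (a j)\<^sup>2)"
    using insert p' pqr by simp
  moreover have "p' * q' = (\<Sum>j\<in>insert i I. a j * b j)"
    using insert pqr p'(3,4) by (simp add: q'_def algebra_simps)
  moreover have "q'\<^sup>2 + r'\<^sup>2 = (\<Sum>j\<in>insert i I. (b j)\<^sup>2)"
    using insert pqr qt r' p' by simp
  ultimately show ?case using p'(2) r'(2) by blast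
qed

lemma distr_gauss_unit_pair:
  fixes a b :: "nat \<Rightarrow> real"
  assumes I: "finite I" and a: "(\<Sum>i\<in>I. (a i)\<^sup>2) = 1" and b: "(\<Sum>i\<in>I. (b i)\<^sup>2) = 1"
    and \<rho>: "\<rho> = (\<Sum>i\<in>I. a i * b i)"
  shows "distr (gauss I) borel (\<lambda>G. (\<Sum>i\<in>I. a i * G i, \<Sum>i\<in>I. b i * G i)) =
      distr (std_normal_distribution \<Otimes>\<^sub>M std_normal_distribution) borel
        (\<lambda>(x, y). (x, \<rho> * x + sqrt (1 - \<rho>\<^sup>2) * y))"
    and "\<rho>\<^sup>2 \<le> 1"
proof -
  let ?N = std_normal_distribution
  obtain p q r where pqr: "p \<ge> 0" "r \<ge> 0" "p\<^sup>2 = 1" "p * q = \<rho>" "q\<^sup>2 + r\<^sup>2 = 1"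
    and law: "\<And>f. f \<in> borel_measurable borel \<Longrightarrow> (\<integral>\<^sup>+G. f (\<Sum>i\<in>I. a i * G i, \<Sum>i\<in>I. b i * G i) \<partial>gauss I) =
      (\<integral>\<^sup>+x. \<integral>\<^sup>+y. f (p * x, q * x + r * y) \<partial>?N \<partial>?N)"
    using gauss_pair_law[OF I, of a b] a b \<rho> by auto
  have p: "p = 1" using pqr by (simp add: power2_eq_1_iff)
  then have q: "q = \<rho>" using pqr by simp
  have r2: "r\<^sup>2 = 1 - \<rho>\<^sup>2" using pqr q by simp
  then have r: "r = sqrt (1 - \<rho>\<^sup>2)" using pqr by (simp add: real_sqrt_unique)
  show "\<rho>\<^sup>2 \<le> 1" using r2 zero_le_power2[of r] by linarith
  interpret NN: pair_sigma_finite ?N ?N ..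
  let ?h = "\<lambda>(x, y). (x, \<rho> * x + sqrt (1 - \<rho>\<^sup>2) * y)"
  have h: "?h \<in> measurable (?N \<Otimes>\<^sub>M ?N) borel"
    unfolding borel_prod[symmetric] by measurable
  have g: "(\<lambda>G. (\<Sum>i\<in>I. a i * G i, \<Sum>i\<in>I. b i * G i)) \<in> measurable (gauss I) borel"
    unfolding borel_prod[symmetric] by measurable
  show "distr (gauss I) borel (\<lambda>G. (\<Sum>i\<in>I. a i * G i, \<Sum>i\<in>I. b i * G i)) = distr (?N \<Otimes>\<^sub>M ?N) borel ?h"
  proof (rule measure_eqI)
    fix A assume "A \<in> sets (distr (gauss I) borel (\<lambda>G. (\<Sum>i\<in>I. a i * G i, \<Sum>i\<in>I. b i * G i)))"
    then have A: "A \<in> sets borel" by simp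
    have "emeasure (distr (gauss I) borel (\<lambda>G. (\<Sum>i\<in>I. a i * G i, \<Sum>i\<in>I. b i * G i))) A =
        (\<integral>\<^sup>+w. indicator A w \<partial>distr (gauss I) borel (\<lambda>G. (\<Sum>i\<in>I. a i * G i, \<Sum>i\<in>I. b i * G i)))"
      using A by simp
    also have "\<dots> = (\<integral>\<^sup>+G. indicator A (\<Sum>i\<in>I. a i * G i, \<Sum>i\<in>I. b i * G i) \<partial>gauss I)"
      using A g by (intro nn_integral_distr) auto
    also have "\<dots> = (\<integral>\<^sup>+x. \<integral>\<^sup>+y. indicator A (?h (x, y)) \<partial>?N \<partial>?N)"
      using law[of "indicator A"] A by (simp add: p q r)
    also have "\<dots> = (\<integral>\<^sup>+w. indicator A (?h w) \<partial>(?N \<Otimes>\<^sub>M ?N))"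
      using measurable_compose[OF h, of "indicator A"] A by (intro N.nn_integral_fst) auto
    also have "\<dots> = (\<integral>\<^sup>+w. indicator A w \<partial>distr (?N \<Otimes>\<^sub>M ?N) borel ?h)"
      using A h by (intro nn_integral_distr[symmetric]) auto
    also have "\<dots> = emeasure (distr (?N \<Otimes>\<^sub>M ?N) borel ?h) A"
      using A by simp
    finally show "emeasure (distr (gauss I) borel (\<lambda>G. (\<Sum>i\<in>I. a i * G i, \<Sum>i\<in>I. b i * G i))) A =
      emeasure (distr (?N \<Otimes>\<^sub>M ?N) borel ?h) A" .
  qed simp
qed

lemma abs_integral_le:
  fixes f g :: "'a \<Rightarrow> real"
  assumes "integrable M f" "integrable M g" "\<And>x. x \<in> space M \<Longrightarrow> \<bar>f x\<bar> \<le> g x"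
  shows "\<bar>\<integral>x. f x \<partial>M\<bar> \<le> (\<integral>x. g x \<partial>M)"
  using order.trans[OF integral_abs_bound integral_mono[OF integrable_abs[OF assms(1)] assms(2,3)]] .

section \<open>Covariance of indicators\<close>

definition centered_indicator :: "real \<Rightarrow> real \<Rightarrow> real"
  where "centered_indicator u x = indicator {..u} x - normal_cdf u"

text \<open>
  The covariance of the indicators of two standard Gaussian variables with correlation \<open>\<rho>\<close> is
  \<open>\<rho> * linear_coeff u\<close> up to a multiple of \<open>\<rho>\<^sup>2\<close>.  The linear term is kept apart because after
  integration over the sphere it is controlled by the integral of \<open>\<rho>\<close>, which is at most that of \<open>\<rho>\<^sup>2\<close>.
\<close>

definition linear_coeff :: "real \<Rightarrow> real"
  where "linear_coeff u = - std_normal_density u * (\<integral>x. x * centered_indicator u x \<partial>std_normal_distribution)"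

lemma measurable_centered_indicator [measurable]: "centered_indicator u \<in> borel_measurable borel"
  unfolding centered_indicator_def[abs_def] by measurable

lemma abs_centered_indicator_le_1: "\<bar>centered_indicator u x\<bar> \<le> 1"
  using normal_cdf_bounds[of u] by (auto simp: centered_indicator_def indicator_def)

lemma std_normal_moments:
  "integrable std_normal_distribution (\<lambda>x. x)" "(\<integral>x. x \<partial>std_normal_distribution) = 0"
  "integrable std_normal_distribution (\<lambda>x. x\<^sup>2)" "(\<integral>x. x\<^sup>2 \<partial>std_normal_distribution) = 1"
  "integrable std_normal_distribution (\<lambda>x. x ^ 4)" "(\<integral>x. x ^ 4 \<partial>std_normal_distribution) = 3"
  using integrable_std_normal_distribution_moment[of 1] integral_std_normal_distribution_moment_odd[of 1]
    std_normal_distribution_even_moments[of 1] std_normal_distribution_even_moments[of 2]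
  by (simp_all add: fact_numeral)

lemma integrable_mult_centered_indicator:
  "integrable std_normal_distribution (\<lambda>x. x * centered_indicator u x)"
proof (rule Bochner_Integration.integrable_bound[OF std_normal_moments(1)])
  show "AE x in std_normal_distribution. norm (x * centered_indicator u x) \<le> norm x"
    using abs_centered_indicator_le_1 by (auto simp: abs_mult mult_left_le)
qed simp

lemma abs_linear_coeff_le_1: "\<bar>linear_coeff u\<bar> \<le> 1"
proof -
  have "\<bar>\<integral>x. x * centered_indicator u x \<partial>std_normal_distribution\<bar> \<le> (\<integral>x. (1 + x\<^sup>2) / 2 \<partial>std_normal_distribution)"
  proof (rule abs_integral_le)
    show "integrable std_normal_distribution (\<lambda>x. (1 + x\<^sup>2) / 2)"
      using std_normal_moments(3) by simp
    fix x :: real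
    have "\<bar>x * centered_indicator u x\<bar> \<le> \<bar>x\<bar>"
      using abs_centered_indicator_le_1[of u x] by (simp add: abs_mult mult_left_le)
    also have "\<dots> \<le> (1 + x\<^sup>2) / 2"
      using zero_le_power2[of "\<bar>x\<bar> - 1"] by (simp add: power2_eq_square algebra_simps)
    finally show "\<bar>x * centered_indicator u x\<bar> \<le> (1 + x\<^sup>2) / 2" .
  qed (rule integrable_mult_centered_indicator)
  also have "\<dots> = 1"
    using std_normal_moments(3,4) N.prob_space by simp
  finally have "std_normal_density u * \<bar>\<integral>x. x * centered_indicator u x \<partial>std_normal_distribution\<bar> \<le> 1 * 1"
    using std_normal_density_le_1 by (intro mult_mono) auto
  then show ?thesis by (simp add: linear_coeff_def abs_mult)
qed

interpretation NN: pair_prob_space std_normal_distribution std_normal_distribution ..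

text \<open>
  Given the first variable \<open>x\<close>, the second is normal with mean \<open>\<rho> x\<close> and standard deviation \<open>r\<close>, so its
  conditional probability is \<open>normal_cdf ((u - \<rho> x) / r)\<close>.  Replacing \<open>r\<close> by \<open>1\<close> costs a multiple of \<open>\<rho>\<^sup>2\<close>,
  and a Taylor expansion in \<open>\<rho> x\<close> leaves the linear term.
\<close>

lemma covariance_centered_indicator_small:
  assumes "\<bar>\<rho>\<bar> \<le> 1 / 2"
  shows "\<bar>(\<integral>(x, y). centered_indicator u x * centered_indicator u (\<rho> * x + sqrt (1 - \<rho>\<^sup>2) * y)
    \<partial>(std_normal_distribution \<Otimes>\<^sub>M std_normal_distribution)) - \<rho> * linear_coeff u\<bar> \<le> 5 * \<rho>\<^sup>2"
proof -
  let ?N = std_normal_distribution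
  define r where "r = sqrt (1 - \<rho>\<^sup>2)"
  let ?g = "centered_indicator u"
  have \<rho>2: "\<rho>\<^sup>2 \<le> 1 / 4"
    using power_mono[OF assms, of 2] by (simp add: power2_eq_square)
  have r2: "r\<^sup>2 = 1 - \<rho>\<^sup>2" and r: "r > 0"
    using \<rho>2 by (auto simp: r_def)
  have r1: "r \<le> 1" by (rule power2_le_imp_le) (simp_all add: r2)
  have rr: "r \<ge> r\<^sup>2" using r r1 by (simp add: power2_eq_square mult_left_le)
  have "1 / r - 1 = (1 - r) / r" using r by (simp add: field_simps)
  also have "\<dots> \<le> 2 * \<rho>\<^sup>2"
  proof -
    have "\<rho>\<^sup>2 * (1 / 2) \<le> \<rho>\<^sup>2 * r" using rr r2 \<rho>2 by (intro mult_left_mono) auto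
    then have "1 - r \<le> 2 * \<rho>\<^sup>2 * r" using rr r2 by simp
    then show ?thesis using r by (simp add: pos_divide_le_eq)
  qed
  finally have "1 / r - 1 \<le> 2 * \<rho>\<^sup>2" .
  moreover have "1 \<le> 1 / r" using r r1 by simp
  ultimately have inv: "\<bar>1 / r - 1\<bar> \<le> 2 * \<rho>\<^sup>2" by linarith
  define D where "D = (\<lambda>x. normal_cdf ((u - \<rho> * x) / r) - normal_cdf u)"
  have inner: "(\<integral>y. ?g x * ?g (\<rho> * x + r * y) \<partial>?N) = ?g x * D x" for x
  proof -
    have "(\<integral>y. ?g (\<rho> * x + r * y) \<partial>?N) = (\<integral>y. indicator {..(u - \<rho> * x) / r} y - normal_cdf u \<partial>?N)"
      using r by (intro Bochner_Integration.integral_cong)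
        (auto simp: centered_indicator_def indicator_def pos_le_divide_eq algebra_simps)
    also have "\<dots> = (\<integral>y. indicator {..(u - \<rho> * x) / r} y \<partial>?N) - (\<integral>y. normal_cdf u \<partial>?N)"
      by (intro Bochner_Integration.integral_diff N.integrable_const_bound[where B = 1])
         (auto simp: indicator_def abs_of_nonneg normal_cdf_bounds)
    also have "\<dots> = D x"
      using N.prob_space by (simp add: D_def cdf_def)
    finally show ?thesis by simp
  qed
  have D: "\<bar>D x + \<rho> * x * std_normal_density u\<bar> \<le> 4 * \<rho>\<^sup>2 + \<rho>\<^sup>2 * x\<^sup>2" for x
  proof -
    have "\<bar>normal_cdf ((u - \<rho> * x) * (1 / r)) - normal_cdf (u - \<rho> * x)\<bar> \<le> 2 * \<bar>1 / r - 1\<bar>"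
      by (rule normal_cdf_scale) (use r in simp)
    moreover have "\<bar>normal_cdf (u + (- (\<rho> * x))) - normal_cdf u - (- (\<rho> * x)) * std_normal_density u\<bar> \<le> (- (\<rho> * x))\<^sup>2"
      by (rule normal_cdf_taylor)
    moreover have "(u - \<rho> * x) * (1 / r) = (u - \<rho> * x) / r" "(- (\<rho> * x))\<^sup>2 = \<rho>\<^sup>2 * x\<^sup>2"
      "u + (- (\<rho> * x)) = u - \<rho> * x"
      by (simp_all add: power_mult_distrib)
    ultimately have "\<bar>normal_cdf ((u - \<rho> * x) / r) - normal_cdf (u - \<rho> * x)\<bar> \<le> 4 * \<rho>\<^sup>2"
      "\<bar>normal_cdf (u - \<rho> * x) - normal_cdf u + \<rho> * x * std_normal_density u\<bar> \<le> \<rho>\<^sup>2 * x\<^sup>2"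
      using inv by simp_all
    then show ?thesis unfolding D_def by linarith
  qed
  have [measurable]: "normal_cdf \<in> borel_measurable borel"
    by (rule borel_measurable_continuous_onI)
       (auto intro!: continuous_at_imp_continuous_on DERIV_isCont[OF DERIV_normal_cdf])
  have intD: "integrable ?N (\<lambda>x. ?g x * D x)"
  proof (rule N.integrable_const_bound[where B = 1])
    have "\<bar>D x\<bar> \<le> 1" for x
      using normal_cdf_bounds[of u] normal_cdf_bounds[of "(u - \<rho> * x) / r"] by (auto simp: D_def)
    then show "AE x in ?N. norm (?g x * D x) \<le> 1"
      using abs_centered_indicator_le_1[of u] by (auto simp: abs_mult intro!: mult_le_one)
  qed (simp add: D_def)
  have "(\<integral>(x, y). ?g x * ?g (\<rho> * x + r * y) \<partial>(?N \<Otimes>\<^sub>M ?N)) = (\<integral>x. \<integral>y. ?g x * ?g (\<rho> * x + r * y) \<partial>?N \<partial>?N)"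
  proof (rule NN.integral_fst[symmetric])
    show "integrable (?N \<Otimes>\<^sub>M ?N) (\<lambda>(x, y). ?g x * ?g (\<rho> * x + r * y))"
    proof (rule NN.integrable_const_bound[where B = 1])
      show "AE w in ?N \<Otimes>\<^sub>M ?N. norm (case w of (x, y) \<Rightarrow> ?g x * ?g (\<rho> * x + r * y)) \<le> 1"
        using abs_centered_indicator_le_1[of u] by (intro AE_I2) (simp add: split_beta' abs_mult mult_le_one)
    qed simp
  qed
  also have "\<dots> = (\<integral>x. ?g x * D x \<partial>?N)" by (simp only: inner)
  finally have "(\<integral>(x, y). ?g x * ?g (\<rho> * x + r * y) \<partial>(?N \<Otimes>\<^sub>M ?N)) - \<rho> * linear_coeff u =
      (\<integral>x. ?g x * D x \<partial>?N) + (\<integral>x. \<rho> * std_normal_density u * (x * ?g x) \<partial>?N)"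
    by (simp add: linear_coeff_def)
  also have "\<dots> = (\<integral>x. ?g x * D x + \<rho> * std_normal_density u * (x * ?g x) \<partial>?N)"
    by (rule Bochner_Integration.integral_add[OF intD integrable_mult_right, symmetric])
       (rule integrable_mult_centered_indicator)
  finally have eq: "(\<integral>(x, y). ?g x * ?g (\<rho> * x + r * y) \<partial>(?N \<Otimes>\<^sub>M ?N)) - \<rho> * linear_coeff u =
      (\<integral>x. ?g x * D x + \<rho> * std_normal_density u * (x * ?g x) \<partial>?N)" .
  have "\<bar>\<integral>x. ?g x * D x + \<rho> * std_normal_density u * (x * ?g x) \<partial>?N\<bar> \<le> (\<integral>x. 4 * \<rho>\<^sup>2 + \<rho>\<^sup>2 * x\<^sup>2 \<partial>?N)"
  proof (rule abs_integral_le)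
    fix x
    have "\<bar>?g x * D x + \<rho> * std_normal_density u * (x * ?g x)\<bar> = \<bar>?g x * (D x + \<rho> * x * std_normal_density u)\<bar>"
      by (simp add: algebra_simps)
    also have "\<dots> \<le> 1 * (4 * \<rho>\<^sup>2 + \<rho>\<^sup>2 * x\<^sup>2)"
      unfolding abs_mult by (intro mult_mono D abs_centered_indicator_le_1) auto
    finally show "\<bar>?g x * D x + \<rho> * std_normal_density u * (x * ?g x)\<bar> \<le> 4 * \<rho>\<^sup>2 + \<rho>\<^sup>2 * x\<^sup>2" by simp
  next
    show "integrable ?N (\<lambda>x. ?g x * D x + \<rho> * std_normal_density u * (x * ?g x))"
      by (rule Bochner_Integration.integrable_add[OF intD integrable_mult_right]) (rule integrable_mult_centered_indicator)
    show "integrable ?N (\<lambda>x. 4 * \<rho>\<^sup>2 + \<rho>\<^sup>2 * x\<^sup>2)"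
      using std_normal_moments(3) by simp
  qed
  also have "\<dots> = 5 * \<rho>\<^sup>2"
    using std_normal_moments(3,4) N.prob_space by simp
  finally show ?thesis by (simp only: eq[unfolded r_def])
qed

text \<open>
  For large correlations the bound holds because both the covariance and the linear term are bounded.
\<close>

lemma covariance_indicators_gauss:
  fixes a b :: "nat \<Rightarrow> real"
  assumes I: "finite I" and a: "(\<Sum>i\<in>I. (a i)\<^sup>2) = 1" and b: "(\<Sum>i\<in>I. (b i)\<^sup>2) = 1"
    and \<rho>: "\<rho> = (\<Sum>i\<in>I. a i * b i)"
  shows "\<bar>(\<integral>G. centered_indicator u (\<Sum>i\<in>I. a i * G i) * centered_indicator u (\<Sum>i\<in>I. b i * G i) \<partial>gauss I)
    - \<rho> * linear_coeff u\<bar> \<le> 6 * \<rho>\<^sup>2"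
proof (cases "\<bar>\<rho>\<bar> \<le> 1 / 2")
  case True
  let ?N = std_normal_distribution and ?g = "centered_indicator u"
  let ?f = "\<lambda>w. ?g (fst w) * ?g (snd w)"
  have f: "?f \<in> borel_measurable borel"
    unfolding borel_prod[symmetric] by measurable
  have m1: "(\<lambda>G. (\<Sum>i\<in>I. a i * G i, \<Sum>i\<in>I. b i * G i)) \<in> measurable (gauss I) borel"
    unfolding borel_prod[symmetric] by measurable
  have m2: "(\<lambda>(x, y). (x, \<rho> * x + sqrt (1 - \<rho>\<^sup>2) * y)) \<in> measurable (?N \<Otimes>\<^sub>M ?N) borel"
    unfolding borel_prod[symmetric] by measurable
  have "(\<integral>G. ?g (\<Sum>i\<in>I. a i * G i) * ?g (\<Sum>i\<in>I. b i * G i) \<partial>gauss I) =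
      (\<integral>w. ?f w \<partial>distr (gauss I) borel (\<lambda>G. (\<Sum>i\<in>I. a i * G i, \<Sum>i\<in>I. b i * G i)))"
    by (subst integral_distr[OF m1 f]) simp
  also have "\<dots> = (\<integral>(x, y). ?g x * ?g (\<rho> * x + sqrt (1 - \<rho>\<^sup>2) * y) \<partial>(?N \<Otimes>\<^sub>M ?N))"
    unfolding distr_gauss_unit_pair(1)[OF I a b \<rho>]
    by (subst integral_distr[OF m2 f]) (simp add: split_beta')
  finally show ?thesis
    using covariance_centered_indicator_small[OF True, of u] zero_le_power2[of \<rho>] by simp
next
  case False
  interpret G: prob_space "gauss I" by (rule prob_space_gauss)
  let ?g = "centered_indicator u"
  have "\<bar>\<integral>G. ?g (\<Sum>i\<in>I. a i * G i) * ?g (\<Sum>i\<in>I. b i * G i) \<partial>gauss I\<bar> \<le> (\<integral>G. 1 \<partial>gauss I)"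
  proof (rule abs_integral_le)
    show "\<bar>?g (\<Sum>i\<in>I. a i * G i) * ?g (\<Sum>i\<in>I. b i * G i)\<bar> \<le> 1" for G
      using abs_centered_indicator_le_1[of u] by (simp add: abs_mult mult_le_one)
    then show "integrable (gauss I) (\<lambda>G. ?g (\<Sum>i\<in>I. a i * G i) * ?g (\<Sum>i\<in>I. b i * G i))"
      by (intro G.integrable_const_bound[where B = 1]) auto
  qed simp
  moreover have "\<bar>\<rho> * linear_coeff u\<bar> \<le> \<bar>\<rho>\<bar>"
    using abs_linear_coeff_le_1[of u] by (simp add: abs_mult mult_left_le)
  moreover have "1 / 2 * \<bar>\<rho>\<bar> \<le> \<bar>\<rho>\<bar> * \<bar>\<rho>\<bar>"
    using False by (intro mult_right_mono) auto
  ultimately show ?thesis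
    using False G.prob_space by (simp add: power2_eq_square)
qed

text \<open>
  The centered squares of the coordinates are uncorrelated and have variance \<open>2\<close>.
\<close>

lemma gauss_square_norm_variance:
  assumes I: "finite I"
  shows "integrable (gauss I) (\<lambda>G. ((\<Sum>i\<in>I. (G i)\<^sup>2) - card I)\<^sup>2)"
    and "(\<integral>G. ((\<Sum>i\<in>I. (G i)\<^sup>2) - card I)\<^sup>2 \<partial>gauss I) = 2 * card I"
proof -
  let ?N = std_normal_distribution
  let ?h = "\<lambda>t::real. t\<^sup>2 - 1"
  have h0: "integrable ?N ?h" "integral\<^sup>L ?N ?h = 0"
    using std_normal_moments N.prob_space by simp_all
  have hh: "?h t * ?h t = t ^ 4 - 2 * t\<^sup>2 + 1" for t
    by (simp add: power2_eq_square power4_eq_xxxx algebra_simps)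
  have h2: "integrable ?N (\<lambda>t. ?h t * ?h t)" "(\<integral>t. ?h t * ?h t \<partial>?N) = 2"
    unfolding hh using std_normal_moments N.prob_space by simp_all
  have prod: "integrable (gauss I) (\<lambda>G. ?h (G i) * ?h (G j))"
      "(\<integral>G. ?h (G i) * ?h (G j) \<partial>gauss I) = (if i = j then 2 else 0)"
    if ij: "i \<in> I" "j \<in> I" for i j
  proof -
    (* Each coordinate gets one factor, so that the two cases of i and j are products over I. *)
    define e where "e = (\<lambda>k t. (if k = i then ?h t else 1) * (if k = j then ?h t else 1))"
    have e: "(\<Prod>k\<in>I. e k (G k)) = ?h (G i) * ?h (G j)" for G
      using ij I by (simp add: e_def prod.distrib prod.delta)
    have int: "integrable ?N (e k)" for k
      using h0 h2 by (cases "k = i"; cases "k = j") (simp_all add: e_def)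
    show "integrable (gauss I) (\<lambda>G. ?h (G i) * ?h (G j))"
      unfolding e[symmetric] gauss_def by (rule NP.product_integrable_prod[OF I int])
    have "(\<integral>G. ?h (G i) * ?h (G j) \<partial>gauss I) = (\<Prod>k\<in>I. \<integral>t. e k t \<partial>?N)"
      unfolding e[symmetric] gauss_def by (rule NP.product_integral_prod[OF I int])
    also have "\<dots> = (if i = j then 2 else 0)"
    proof (cases "i = j")
      case True
      have "(\<Prod>k\<in>I. \<integral>t. e k t \<partial>?N) = (\<Prod>k\<in>I. if k = i then 2 else 1)"
        using True h2 N.prob_space by (intro prod.cong) (auto simp: e_def)
      then show ?thesis using True ij I by simp
    next
      case False
      then have "(\<integral>t. e i t \<partial>?N) = 0" using h0 by (simp add: e_def)
      then show ?thesis using False ij I by (auto simp: prod_zero_iff)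
    qed
    finally show "(\<integral>G. ?h (G i) * ?h (G j) \<partial>gauss I) = (if i = j then 2 else 0)" .
  qed
  have sq: "((\<Sum>i\<in>I. (G i)\<^sup>2) - card I)\<^sup>2 = (\<Sum>i\<in>I. \<Sum>j\<in>I. ?h (G i) * ?h (G j))"
    for G :: "nat \<Rightarrow> real"
  proof -
    have "(\<Sum>i\<in>I. (G i)\<^sup>2) - card I = (\<Sum>i\<in>I. ?h (G i))" by (simp add: sum_subtractf)
    then show ?thesis by (simp only: power2_eq_square sum_product)
  qed
  show "integrable (gauss I) (\<lambda>G. ((\<Sum>i\<in>I. (G i)\<^sup>2) - card I)\<^sup>2)"
    unfolding sq by (intro Bochner_Integration.integrable_sum prod)
  have "(\<integral>G. ((\<Sum>i\<in>I. (G i)\<^sup>2) - card I)\<^sup>2 \<partial>gauss I) =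
      (\<Sum>i\<in>I. \<Sum>j\<in>I. \<integral>G. ?h (G i) * ?h (G j) \<partial>gauss I)"
    unfolding sq by (simp add: Bochner_Integration.integral_sum Bochner_Integration.integrable_sum prod(1))
  also have "\<dots> = (\<Sum>i\<in>I. \<Sum>j\<in>I. if i = j then 2 else 0)"
    by (intro sum.cong refl prod)
  also have "\<dots> = 2 * card I" using I by simp
  finally show "(\<integral>G. ((\<Sum>i\<in>I. (G i)\<^sup>2) - card I)\<^sup>2 \<partial>gauss I) = 2 * card I" .
qed

text \<open>
  Writing the square of an integral as a double integral and exchanging expectation and integration
  turns the mean square discrepancy into the average of the pair covariances.
\<close>

lemma mean_square_discrepancy:
  fixes a :: "nat \<Rightarrow> 's \<Rightarrow> real"
  assumes S: "prob_space S" and I: "finite I"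
    and meas [measurable]: "\<And>m. m \<in> I \<Longrightarrow> a m \<in> borel_measurable S"
    and unit: "\<And>x. x \<in> space S \<Longrightarrow> (\<Sum>m\<in>I. (a m x)\<^sup>2) = 1"
  defines "\<rho> \<equiv> \<lambda>x y. \<Sum>m\<in>I. a m x * a m y"
  shows "(\<lambda>G. \<integral>x. indicator {..u} (\<Sum>m\<in>I. a m x * G m) \<partial>S :: real) \<in> borel_measurable (gauss I)"
    and "(\<integral>G. ((\<integral>x. indicator {..u} (\<Sum>m\<in>I. a m x * G m) \<partial>S) - normal_cdf u)\<^sup>2 \<partial>gauss I) \<le>
      \<bar>\<integral>x. \<integral>y. \<rho> x y \<partial>S \<partial>S\<bar> + 6 * (\<integral>x. \<integral>y. (\<rho> x y)\<^sup>2 \<partial>S \<partial>S)"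
    (is "?lhs \<le> _")
proof -
  interpret S: prob_space S by (rule S)
  interpret G: prob_space "gauss I" by (rule prob_space_gauss)
  interpret GS: pair_prob_space "gauss I" S ..
  interpret SS: pair_prob_space S S ..
  have [measurable]: "(\<lambda>G. G m) \<in> borel_measurable (gauss I)" if "m \<in> I" for m
    using that by measurable
  have T [measurable]: "(\<lambda>(G, x). \<Sum>m\<in>I. a m x * G m) \<in> borel_measurable (gauss I \<Otimes>\<^sub>M S)"
    unfolding split_beta'
  proof (rule borel_measurable_sum)
    fix m assume [measurable]: "m \<in> I"
    show "(\<lambda>p. a m (snd p) * fst p m) \<in> borel_measurable (gauss I \<Otimes>\<^sub>M S)"
      by measurable
  qed
  define c where "c = (\<lambda>G x. centered_indicator u (\<Sum>m\<in>I. a m x * G m))"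
  have c_meas [measurable]: "(\<lambda>(G, x). c G x) \<in> borel_measurable (gauss I \<Otimes>\<^sub>M S)"
    unfolding c_def using measurable_compose[OF T measurable_centered_indicator] by (simp add: split_beta')
  have c_le: "\<bar>c G x\<bar> \<le> 1" for G x unfolding c_def by (rule abs_centered_indicator_le_1)
  have cc_le: "\<bar>c G x * c G y\<bar> \<le> 1" for G x y
    using c_le by (simp add: abs_mult mult_le_one)
  have c_S: "c G \<in> borel_measurable S" if "G \<in> space (gauss I)" for G
    using measurable_compose[OF measurable_Pair1'[OF that] c_meas] by simp
  have c_G: "(\<lambda>G. c G x) \<in> borel_measurable (gauss I)" if "x \<in> space S" for x
    using measurable_compose[OF measurable_Pair2'[OF that] c_meas] by simp
  have c_int: "integrable S (c G)" if "G \<in> space (gauss I)" for G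
    using c_le c_S[OF that] by (intro S.integrable_const_bound[where B = 1]) auto
  define H where "H = (\<lambda>G. \<integral>y. c G y \<partial>S)"
  have H_meas [measurable]: "H \<in> borel_measurable (gauss I)"
    unfolding H_def by measurable
  have ind_int: "integrable S (\<lambda>x. indicator {..u} (\<Sum>m\<in>I. a m x * G m) :: real)"
    if "G \<in> space (gauss I)" for G
  proof -
    have "integrable S (\<lambda>x. c G x + normal_cdf u)" using c_int[OF that] by simp
    then show ?thesis by (simp add: c_def centered_indicator_def)
  qed
  have H_eq: "(\<integral>x. indicator {..u} (\<Sum>m\<in>I. a m x * G m) \<partial>S) - normal_cdf u = H G"
    if "G \<in> space (gauss I)" for G
    using ind_int[OF that] S.prob_space by (simp add: H_def c_def centered_indicator_def)
  show "(\<lambda>G. \<integral>x. indicator {..u} (\<Sum>m\<in>I. a m x * G m) \<partial>S :: real) \<in> borel_measurable (gauss I)"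
  proof -
    have "(\<lambda>G. H G + normal_cdf u) \<in> borel_measurable (gauss I)" by measurable
    moreover have "(\<integral>x. indicator {..u} (\<Sum>m\<in>I. a m x * G m) \<partial>S) = H G + normal_cdf u"
      if "G \<in> space (gauss I)" for G
      using H_eq[OF that] by simp
    ultimately show ?thesis
      by (simp cong: measurable_cong)
  qed
  have H_le: "\<bar>H G\<bar> \<le> 1" if "G \<in> space (gauss I)" for G
  proof -
    have "\<bar>H G\<bar> \<le> (\<integral>x. 1 \<partial>S)"
      unfolding H_def by (rule abs_integral_le) (use c_int[OF that] c_le in auto)
    then show ?thesis using S.prob_space by simp
  qed
  have \<rho>_meas [measurable]: "(\<lambda>(x, y). \<rho> x y) \<in> borel_measurable (S \<Otimes>\<^sub>M S)"
    unfolding \<rho>_def split_beta'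
  proof (rule borel_measurable_sum)
    fix m assume [measurable]: "m \<in> I"
    show "(\<lambda>p. a m (fst p) * a m (snd p)) \<in> borel_measurable (S \<Otimes>\<^sub>M S)" by measurable
  qed
  have \<rho>2: "(\<rho> x y)\<^sup>2 \<le> 1" if "x \<in> space S" "y \<in> space S" for x y
    using distr_gauss_unit_pair(2)[OF I unit[OF that(1)] unit[OF that(2)] refl] by (simp add: \<rho>_def)
  define C where "C = (\<lambda>x y. \<integral>G. c G x * c G y \<partial>gauss I)"
  have "?lhs = (\<integral>G. \<integral>x. c G x * H G \<partial>S \<partial>gauss I)"
    by (intro Bochner_Integration.integral_cong refl) (simp add: H_eq power2_eq_square, simp add: H_def)
  also have "\<dots> = (\<integral>x. \<integral>G. c G x * H G \<partial>gauss I \<partial>S)"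
  proof (rule GS.Fubini_integral[symmetric])
    show "integrable (gauss I \<Otimes>\<^sub>M S) (\<lambda>(G, x). c G x * H G)"
    proof (rule GS.integrable_const_bound[where B = 1])
      show "AE p in gauss I \<Otimes>\<^sub>M S. norm (case p of (G, x) \<Rightarrow> c G x * H G) \<le> 1"
        using c_le H_le by (intro AE_I2) (auto simp: abs_mult space_pair_measure intro!: mult_le_one)
    qed measurable
  qed
  also have "\<dots> = (\<integral>x. \<integral>y. C x y \<partial>S \<partial>S)"
  proof (rule Bochner_Integration.integral_cong[OF refl])
    fix x assume x: "x \<in> space S"
    have [measurable]: "(\<lambda>G. c G x) \<in> borel_measurable (gauss I)" by (rule c_G[OF x])
    have "(\<integral>G. c G x * H G \<partial>gauss I) = (\<integral>G. \<integral>y. c G x * c G y \<partial>S \<partial>gauss I)"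
      by (simp add: H_def)
    also have "\<dots> = (\<integral>y. \<integral>G. c G x * c G y \<partial>gauss I \<partial>S)"
    proof (rule GS.Fubini_integral[symmetric])
      show "integrable (gauss I \<Otimes>\<^sub>M S) (\<lambda>(G, y). c G x * c G y)"
      proof (rule GS.integrable_const_bound[where B = 1])
        show "AE p in gauss I \<Otimes>\<^sub>M S. norm (case p of (G, y) \<Rightarrow> c G x * c G y) \<le> 1"
          using cc_le by (intro AE_I2) auto
      qed measurable
    qed
    finally show "(\<integral>G. c G x * H G \<partial>gauss I) = (\<integral>y. C x y \<partial>S)" by (simp add: C_def)
  qed
  also have "\<dots> \<le> (\<integral>x. \<integral>y. \<rho> x y * linear_coeff u + 6 * (\<rho> x y)\<^sup>2 \<partial>S \<partial>S)"
  proof -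
    have C_bound: "C x y \<le> \<rho> x y * linear_coeff u + 6 * (\<rho> x y)\<^sup>2" "\<bar>C x y\<bar> \<le> 1"
      if x: "x \<in> space S" and y: "y \<in> space S" for x y
    proof -
      show "C x y \<le> \<rho> x y * linear_coeff u + 6 * (\<rho> x y)\<^sup>2"
        using covariance_indicators_gauss[OF I unit[OF x] unit[OF y] refl, of u]
        by (simp add: C_def c_def \<rho>_def)
      have [measurable]: "(\<lambda>G. c G x) \<in> borel_measurable (gauss I)" "(\<lambda>G. c G y) \<in> borel_measurable (gauss I)"
        using c_G x y by auto
      have "\<bar>C x y\<bar> \<le> (\<integral>G. 1 \<partial>gauss I)"
        unfolding C_def
        by (rule abs_integral_le) (use cc_le in \<open>auto intro!: G.integrable_const_bound[where B = 1]\<close>)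
      then show "\<bar>C x y\<bar> \<le> 1" using G.prob_space by simp
    qed
    have [measurable]: "(\<lambda>(x, y). C x y) \<in> borel_measurable (S \<Otimes>\<^sub>M S)"
    proof -
      have "(\<lambda>(p, G). c G (fst p) * c G (snd p)) \<in> borel_measurable ((S \<Otimes>\<^sub>M S) \<Otimes>\<^sub>M gauss I)"
      proof -
        have "(\<lambda>q. (\<lambda>(G, x). c G x) (snd q, fst (fst q))) \<in> borel_measurable ((S \<Otimes>\<^sub>M S) \<Otimes>\<^sub>M gauss I)"
          "(\<lambda>q. (\<lambda>(G, x). c G x) (snd q, snd (fst q))) \<in> borel_measurable ((S \<Otimes>\<^sub>M S) \<Otimes>\<^sub>M gauss I)"
          by (rule measurable_compose[OF _ c_meas], measurable)+
        then show ?thesis by (simp add: split_beta')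
      qed
      from G.borel_measurable_lebesgue_integral[OF this] show ?thesis
        by (simp add: C_def split_beta')
    qed
    have \<rho>_le: "\<bar>\<rho> x y\<bar> \<le> 1" if "x \<in> space S" "y \<in> space S" for x y
      using \<rho>2[OF that] by (simp add: abs_square_le_1)
    have R_le: "\<bar>\<rho> x y * linear_coeff u + 6 * (\<rho> x y)\<^sup>2\<bar> \<le> 7" if "x \<in> space S" "y \<in> space S" for x y
    proof -
      have "\<bar>\<rho> x y * linear_coeff u\<bar> \<le> 1"
        using \<rho>_le[OF that] abs_linear_coeff_le_1[of u] by (simp add: abs_mult mult_le_one)
      then show ?thesis using \<rho>2[OF that] zero_le_power2[of "\<rho> x y"] by linarith
    qed
    have 1: "integrable (S \<Otimes>\<^sub>M S) (\<lambda>(x, y). C x y)"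
      by (rule SS.integrable_const_bound[where B = 1])
         (use C_bound(2) in \<open>auto intro!: AE_I2 simp: space_pair_measure\<close>)
    have 2: "integrable (S \<Otimes>\<^sub>M S) (\<lambda>(x, y). \<rho> x y * linear_coeff u + 6 * (\<rho> x y)\<^sup>2)"
    proof (rule SS.integrable_const_bound[where B = 7])
      show "AE p in S \<Otimes>\<^sub>M S. norm (case p of (x, y) \<Rightarrow> \<rho> x y * linear_coeff u + 6 * (\<rho> x y)\<^sup>2) \<le> 7"
        using R_le by (intro AE_I2) (auto simp: space_pair_measure)
    qed measurable
    show ?thesis
      unfolding SS.integral_fst[OF 1] SS.integral_fst[OF 2]
      by (rule integral_mono[OF 1 2]) (use C_bound(1) in \<open>auto simp: space_pair_measure\<close>)
  qed
  also have "\<dots> \<le> \<bar>\<integral>x. \<integral>y. \<rho> x y \<partial>S \<partial>S\<bar> + 6 * (\<integral>x. \<integral>y. (\<rho> x y)\<^sup>2 \<partial>S \<partial>S)"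
  proof -
    have 1: "integrable (S \<Otimes>\<^sub>M S) (\<lambda>(x, y). \<rho> x y)"
    proof (rule SS.integrable_const_bound[where B = 1])
      show "AE p in S \<Otimes>\<^sub>M S. norm (case p of (x, y) \<Rightarrow> \<rho> x y) \<le> 1"
        using \<rho>2 by (intro AE_I2) (auto simp: space_pair_measure abs_square_le_1)
    qed measurable
    have 2: "integrable (S \<Otimes>\<^sub>M S) (\<lambda>(x, y). (\<rho> x y)\<^sup>2)"
    proof (rule SS.integrable_const_bound[where B = 1])
      show "AE p in S \<Otimes>\<^sub>M S. norm (case p of (x, y) \<Rightarrow> (\<rho> x y)\<^sup>2) \<le> 1"
        using \<rho>2 by (intro AE_I2) (auto simp: space_pair_measure)
    qed measurable
    have 3: "integrable (S \<Otimes>\<^sub>M S) (\<lambda>(x, y). \<rho> x y * linear_coeff u + 6 * (\<rho> x y)\<^sup>2)"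
      using 1 2 by (simp add: split_beta')
    have "(\<integral>x. \<integral>y. \<rho> x y * linear_coeff u + 6 * (\<rho> x y)\<^sup>2 \<partial>S \<partial>S) =
        (\<integral>x. \<integral>y. \<rho> x y \<partial>S \<partial>S) * linear_coeff u + 6 * (\<integral>x. \<integral>y. (\<rho> x y)\<^sup>2 \<partial>S \<partial>S)"
      unfolding SS.integral_fst[OF 1] SS.integral_fst[OF 2] SS.integral_fst[OF 3]
      using 1 2 by (simp add: split_beta')
    moreover have "(\<integral>x. \<integral>y. \<rho> x y \<partial>S \<partial>S) * linear_coeff u \<le> \<bar>\<integral>x. \<integral>y. \<rho> x y \<partial>S \<partial>S\<bar>"
    proof -
      have "\<bar>(\<integral>x. \<integral>y. \<rho> x y \<partial>S \<partial>S) * linear_coeff u\<bar> \<le> \<bar>\<integral>x. \<integral>y. \<rho> x y \<partial>S \<partial>S\<bar>"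
        unfolding abs_mult using abs_linear_coeff_le_1[of u] by (intro mult_left_le) auto
      then show ?thesis by linarith
    qed
    ultimately show ?thesis by linarith
  qed
  finally show "?lhs \<le> \<bar>\<integral>x. \<integral>y. \<rho> x y \<partial>S \<partial>S\<bar> + 6 * (\<integral>x. \<integral>y. (\<rho> x y)\<^sup>2 \<partial>S \<partial>S)" .
qed

section \<open>The addition theorem\<close>

lemma measurable_sphere_measure_borel:
  assumes "finite I" "I \<noteq> {}"
  shows "(\<lambda>x. x) \<in> measurable (sphere_measure I) (borel :: (nat \<Rightarrow> real) measure)"
proof -
  have "(\<lambda>x. x) \<in> measurable (sphere_measure I) (\<Pi>\<^sub>M i\<in>UNIV. (borel :: real measure))"
  proof (rule measurable_PiM_single')
    fix k
    show "(\<lambda>x. x k) \<in> measurable (sphere_measure I) (borel :: real measure)"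
    proof (cases "k \<in> I")
      case True
      then have "(\<lambda>x. x k) \<in> measurable (restrict_space (\<Pi>\<^sub>M i\<in>I. lborel) (unit_sphere I)) (borel :: real measure)"
        by (intro measurable_restrict_space1) measurable
      then show ?thesis by (simp add: sets_sphere_measure cong: measurable_cong_sets)
    next
      case False
      have "x k = undefined" if "x \<in> space (sphere_measure I)" for x
        using that False by (auto simp: sphere_measure_prob(2)[OF assms] unit_sphere_def PiE_iff extensional_def)
      then have "(\<lambda>x. x k) \<in> measurable (sphere_measure I) (borel :: real measure) \<longleftrightarrow>
          (\<lambda>_. undefined) \<in> measurable (sphere_measure I) (borel :: real measure)"
        by (rule measurable_cong)
      then show ?thesis by simp
    qed
  qed simp
  then show ?thesis
    by (simp add: sets_PiM_equal_borel cong: measurable_cong_sets)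
qed

text \<open>
  Smoothness is that of the radial extension, which is continuous off the origin; it agrees with the
  eigenfunction on the sphere.
\<close>

lemma measurable_eigenspace:
  assumes "f \<in> eigenspace l d"
  shows "f \<in> borel_measurable (sphere_measure {..d})"
proof -
  have "Ck {..d} 0 (punctured {..d}) (radial_ext d f)"
    using assms unfolding eigenspace_def smooth_on_sphere_def punctured_def by blast
  then have "radial_ext d f \<in> borel_measurable (restrict_space borel (punctured {..d}))"
    by (intro borel_measurable_continuous_on_restrict) simp
  moreover have "(\<lambda>x. x) \<in> measurable (sphere_measure {..d}) (restrict_space borel (punctured {..d}))"
    by (intro measurable_restrict_space2 measurable_sphere_measure_borel)
       (auto simp: sphere_measure_prob(2) unit_sphere_def punctured_def)
  ultimately have "radial_ext d f \<in> borel_measurable (sphere_measure {..d})"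
    using measurable_compose by fastforce
  moreover have "radial_ext d f x = f x" if "x \<in> space (sphere_measure {..d})" for x
  proof -
    have "normalize_vec {..d} x = x"
      using that by (auto simp: sphere_measure_prob(2) unit_sphere_def normalize_vec_def PiE_iff
          extensional_def fun_eq_iff)
    then show ?thesis by (simp add: radial_ext_def)
  qed
  ultimately show ?thesis by (simp cong: measurable_cong)
qed

text \<open>
  The estimate holds for each degree and dimension separately, with a constant that depends on neither.
\<close>

locale eigenbasis =
  fixes l d :: nat and Y :: "nat \<Rightarrow> (nat \<Rightarrow> real) \<Rightarrow> real"
  assumes l: "l \<ge> 1" and d: "d \<ge> 1" and basis: "orthonormal_eigenbasis l d Y"
begin

abbreviation "n \<equiv> eigendim l d"
abbreviation "I \<equiv> {1..n}"
abbreviation "\<sigma> \<equiv> sphere_measure {..d}"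

lemma space_\<sigma>: "space \<sigma> = unit_sphere {..d}"
  by (rule sphere_measure_prob) auto

sublocale \<sigma>: prob_space \<sigma>
  by (rule sphere_measure_prob) auto

lemma n_pos: "n \<ge> 1"
proof -
  have "(l + d - 2) choose (l - 1) > 0" using l d by simp
  then show ?thesis using eigendim_altdef[OF l d] by linarith
qed

lemma Y_eigenspace: "m \<in> I \<Longrightarrow> Y m \<in> eigenspace l d"
  using basis by (simp add: orthonormal_eigenbasis_def)

lemma Y_measurable [measurable]: "m \<in> I \<Longrightarrow> Y m \<in> borel_measurable \<sigma>"
  by (rule measurable_eigenspace[OF Y_eigenspace])

lemma Y_orthonormal: "m \<in> I \<Longrightarrow> m' \<in> I \<Longrightarrow> (\<integral>x. Y m x * Y m' x \<partial>\<sigma>) = (if m = m' then 1 else 0)"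
  using basis unfolding orthonormal_eigenbasis_def by blast

lemma Y_spans:
  assumes "f \<in> eigenspace l d"
  obtains c where "\<And>x. x \<in> unit_sphere {..d} \<Longrightarrow> f x = (\<Sum>m\<in>I. c m * Y m x)"
  using basis assms unfolding orthonormal_eigenbasis_def by blast

lemma integrable_Y_mult_Y:
  assumes "m \<in> I" "m' \<in> I"
  shows "integrable \<sigma> (\<lambda>x. Y m x * Y m' x)"
proof -
  have sq: "integrable \<sigma> (\<lambda>x. Y k x * Y k x)" if "k \<in> I" for k
    using Y_orthonormal[OF that that] not_integrable_integral_eq[of \<sigma> "\<lambda>x. Y k x * Y k x"] by fastforce
  show ?thesis
  proof (rule Bochner_Integration.integrable_bound[OF Bochner_Integration.integrable_add[OF sq sq]])
    show "m \<in> I" "m' \<in> I" by fact+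
    show "(\<lambda>x. Y m x * Y m' x) \<in> borel_measurable \<sigma>"
      using assms by measurable
    show "AE x in \<sigma>. norm (Y m x * Y m' x) \<le> norm (Y m x * Y m x + Y m' x * Y m' x)"
    proof (intro AE_I2)
      fix x
      have "0 \<le> (\<bar>Y m x\<bar> - \<bar>Y m' x\<bar>)\<^sup>2" by simp
      then have "2 * (\<bar>Y m x\<bar> * \<bar>Y m' x\<bar>) \<le> Y m x * Y m x + Y m' x * Y m' x"
        by (simp add: power2_eq_square algebra_simps)
      moreover have "0 \<le> \<bar>Y m x\<bar> * \<bar>Y m' x\<bar>" by simp
      ultimately have "\<bar>Y m x\<bar> * \<bar>Y m' x\<bar> \<le> \<bar>Y m x * Y m x + Y m' x * Y m' x\<bar>"
        by linarith
      then show "norm (Y m x * Y m' x) \<le> norm (Y m x * Y m x + Y m' x * Y m' x)"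
        by (simp add: abs_mult)
    qed
  qed
qed

lemma sum_Y_square:
  "(\<Sum>m\<in>I. b m * Y m x)\<^sup>2 = (\<Sum>m\<in>I. \<Sum>m'\<in>I. b m * b m' * (Y m x * Y m' x))"
  by (simp add: power2_eq_square sum_product algebra_simps)

lemma integrable_sum_Y_square: "integrable \<sigma> (\<lambda>x. (\<Sum>m\<in>I. b m * Y m x)\<^sup>2)"
  unfolding sum_Y_square
  by (intro Bochner_Integration.integrable_sum integrable_mult_right integrable_Y_mult_Y)

lemma integral_sum_Y_square: "(\<integral>x. (\<Sum>m\<in>I. b m * Y m x)\<^sup>2 \<partial>\<sigma>) = (\<Sum>m\<in>I. (b m)\<^sup>2)"
proof -
  have "(\<integral>x. (\<Sum>m\<in>I. b m * Y m x)\<^sup>2 \<partial>\<sigma>) = (\<Sum>m\<in>I. \<integral>x. (\<Sum>m'\<in>I. b m * b m' * (Y m x * Y m' x)) \<partial>\<sigma>)"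
    unfolding sum_Y_square
    by (intro Bochner_Integration.integral_sum Bochner_Integration.integrable_sum integrable_mult_right integrable_Y_mult_Y)
  also have "\<dots> = (\<Sum>m\<in>I. \<Sum>m'\<in>I. \<integral>x. b m * b m' * (Y m x * Y m' x) \<partial>\<sigma>)"
    by (intro sum.cong refl Bochner_Integration.integral_sum integrable_mult_right integrable_Y_mult_Y)
  also have "\<dots> = (\<Sum>m\<in>I. \<Sum>m'\<in>I. if m = m' then (b m)\<^sup>2 else 0)"
    by (intro sum.cong refl) (simp add: Y_orthonormal power2_eq_square)
  also have "\<dots> = (\<Sum>m\<in>I. (b m)\<^sup>2)" by simp
  finally show ?thesis .
qed

definition kernel_diag :: "(nat \<Rightarrow> real) \<Rightarrow> real"
  where "kernel_diag x = (\<Sum>m\<in>I. (Y m x)\<^sup>2)"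

text \<open>
  \<open>kernel_diag x\<close> is the largest value of \<open>f(x)\<^sup>2\<close> over the \<open>f\<close> of norm one in the eigenspace.  The
  eigenfunction \<open>f\<close> with coefficients \<open>Y m (R x)\<close> in the rotated basis satisfies
  \<open>f x = kernel_diag (R x)\<close> with squared norm \<open>kernel_diag (R x)\<close>; expanding \<open>f\<close>
  in the original basis and using Cauchy--Schwarz compares it with the value at \<open>x\<close>.
\<close>

lemma kernel_diag_givens_le:
  assumes ij: "i \<le> d" "j \<le> d" "i \<noteq> j" and cs: "c\<^sup>2 + s\<^sup>2 = 1" and x: "x \<in> unit_sphere {..d}"
  shows "kernel_diag (givens i j c s x) \<le> kernel_diag x"
proof -
  have D: "finite {..d}" "i \<in> {..d}" "j \<in> {..d}" "i \<noteq> j" using ij by auto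
  let ?g = "givens i j c s"
  define b where "b = (\<lambda>m. Y m (?g x))"
  have "\<exists>e. \<forall>y\<in>unit_sphere {..d}. Y m (?g y) = (\<Sum>k\<in>I. e k * Y k y)" if "m \<in> I" for m
    using Y_spans[OF eigenspace_givens[OF Y_eigenspace[OF that] ij cs]] by metis
  then obtain e where e: "\<And>m y. m \<in> I \<Longrightarrow> y \<in> unit_sphere {..d} \<Longrightarrow> Y m (?g y) = (\<Sum>k\<in>I. e m k * Y k y)"
    by metis
  define a where "a = (\<lambda>k. \<Sum>m\<in>I. b m * e m k)"
  have f: "(\<Sum>m\<in>I. b m * Y m (?g y)) = (\<Sum>k\<in>I. a k * Y k y)" if "y \<in> unit_sphere {..d}" for y
  proof -
    have "(\<Sum>m\<in>I. b m * Y m (?g y)) = (\<Sum>m\<in>I. \<Sum>k\<in>I. b m * e m k * Y k y)"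
      by (intro sum.cong refl) (simp add: e[OF _ that] sum_distrib_left mult.assoc)
    also have "\<dots> = (\<Sum>k\<in>I. \<Sum>m\<in>I. b m * e m k * Y k y)" by (rule sum.swap)
    also have "\<dots> = (\<Sum>k\<in>I. a k * Y k y)" by (simp add: a_def sum_distrib_right)
    finally show ?thesis .
  qed
  have "(\<Sum>k\<in>I. (a k)\<^sup>2) = (\<integral>y. (\<Sum>k\<in>I. a k * Y k y)\<^sup>2 \<partial>\<sigma>)"
    by (rule integral_sum_Y_square[symmetric])
  also have "\<dots> = (\<integral>y. (\<Sum>m\<in>I. b m * Y m (?g y))\<^sup>2 \<partial>\<sigma>)"
    by (intro Bochner_Integration.integral_cong refl) (simp only: f space_\<sigma>)
  also have "\<dots> = (\<integral>y. (\<Sum>m\<in>I. b m * Y m y)\<^sup>2 \<partial>distr \<sigma> \<sigma> ?g)"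
    by (rule integral_distr[OF measurable_givens_sphere[OF D cs], symmetric]) measurable
  also have "\<dots> = (\<Sum>m\<in>I. (b m)\<^sup>2)"
    unfolding distr_sphere_givens[OF D cs] by (rule integral_sum_Y_square)
  also have "\<dots> = kernel_diag (?g x)" by (simp add: kernel_diag_def b_def)
  finally have norm: "(\<Sum>k\<in>I. (a k)\<^sup>2) = kernel_diag (?g x)" .
  have "kernel_diag (?g x) = (\<Sum>k\<in>I. a k * Y k x)"
    using f[OF x] by (simp add: kernel_diag_def b_def power2_eq_square)
  moreover have "(\<Sum>k\<in>I. a k * Y k x)\<^sup>2 \<le> (\<Sum>k\<in>I. (a k)\<^sup>2) * kernel_diag x"
    unfolding kernel_diag_def by (rule Cauchy_Schwarz_ineq_sum)
  ultimately have "(kernel_diag (?g x))\<^sup>2 \<le> kernel_diag (?g x) * kernel_diag x"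
    by (simp only: norm)
  moreover have "kernel_diag (?g x) \<ge> 0" "kernel_diag x \<ge> 0"
    by (simp_all add: kernel_diag_def sum_nonneg)
  ultimately show ?thesis
    by (cases "kernel_diag (?g x) = 0") (simp_all add: power2_eq_square mult_le_cancel_left)
qed

lemma kernel_diag_givens:
  assumes ij: "i \<le> d" "j \<le> d" "i \<noteq> j" and cs: "c\<^sup>2 + s\<^sup>2 = 1" and x: "x \<in> unit_sphere {..d}"
  shows "kernel_diag (givens i j c s x) = kernel_diag x"
proof (rule antisym)
  have "givens i j c (- s) (givens i j c s x) = x"
  proof
    fix k
    have "c * (c * a - s * b) + s * (s * a + c * b) = (c\<^sup>2 + s\<^sup>2) * a"
      "- s * (c * a - s * b) + c * (s * a + c * b) = (c\<^sup>2 + s\<^sup>2) * b" for a b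
      by (simp_all add: power2_eq_square algebra_simps)
    then show "givens i j c (- s) (givens i j c s x) k = x k"
      using ij cs by (simp add: givens_def)
  qed
  then show "kernel_diag x \<le> kernel_diag (givens i j c s x)"
    using kernel_diag_givens_le[OF ij, of c "- s" "givens i j c s x"] cs x ij
    by (simp add: givens_unit_sphere)
qed (rule kernel_diag_givens_le[OF assms])

definition pole :: "nat \<Rightarrow> real"
  where "pole = (\<lambda>i\<in>{..d}. if i = 0 then 1 else 0)"

text \<open>
  Rotations in the planes of the coordinates \<open>0\<close> and \<open>k + 1\<close> annihilate the coordinates one after the other
  and make the coordinate \<open>0\<close> nonnegative, which moves any point of the sphere to the pole.
\<close>

lemma kernel_diag_pole:
  assumes x: "x \<in> unit_sphere {..d}"
  shows "kernel_diag x = kernel_diag pole"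
proof -
  have "\<exists>z\<in>unit_sphere {..d}. kernel_diag z = kernel_diag x \<and> (\<forall>i\<in>{1..k}. z i = 0) \<and> (k \<ge> 1 \<longrightarrow> z 0 \<ge> 0)"
    if "k \<le> d" for k
    using that
  proof (induction k)
    case 0
    then show ?case using x by auto
  next
    case (Suc k)
    then obtain z where z: "z \<in> unit_sphere {..d}" "kernel_diag z = kernel_diag x" "\<forall>i\<in>{1..k}. z i = 0"
      by auto
    obtain c s p where p: "c\<^sup>2 + s\<^sup>2 = 1" "p \<ge> 0" "z 0 = p * c" "z (Suc k) = p * s"
      by (rule polar_coordinates)
    let ?z = "givens 0 (Suc k) c (- s) z"
    have "?z \<in> unit_sphere {..d}"
      using Suc.prems p z by (subst givens_unit_sphere) auto
    moreover have "kernel_diag ?z = kernel_diag z"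
      using Suc.prems p z by (intro kernel_diag_givens) auto
    moreover have "?z 0 = p * (c\<^sup>2 + s\<^sup>2)" "?z (Suc k) = 0"
      by (simp_all add: givens_def p power2_eq_square algebra_simps)
    moreover have "?z i = 0" if "i \<in> {1..Suc k}" for i
    proof (cases "i = Suc k")
      case False
      with that z show ?thesis by (auto simp: givens_def)
    qed (simp add: \<open>?z (Suc k) = 0\<close>)
    ultimately show ?case using z p by (intro bexI[of _ ?z]) auto
  qed
  from this[of d] obtain z where z: "z \<in> unit_sphere {..d}" "kernel_diag z = kernel_diag x"
      "\<forall>i\<in>{1..d}. z i = 0" "z 0 \<ge> 0"
    using d by auto
  have "(\<Sum>i\<in>{..d}. (z i)\<^sup>2) = (z 0)\<^sup>2"
  proof -
    have "(\<Sum>i\<in>{..d}. (z i)\<^sup>2) = (\<Sum>i\<in>{0}. (z i)\<^sup>2)"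
      using z(3) by (intro sum.mono_neutral_right) auto
    then show ?thesis by simp
  qed
  then have "(z 0)\<^sup>2 = 1" using z(1) by (simp add: unit_sphere_def L2_set_def)
  then have "z 0 = 1" using z(4) by (auto simp: power2_eq_1_iff)
  then have "z = pole"
    using z by (auto simp: pole_def unit_sphere_def PiE_iff extensional_def fun_eq_iff Suc_le_eq)
  with z(2) show ?thesis by simp
qed

text \<open>
  The sum is constant on the sphere, and its integral is the number of basis functions.
\<close>

lemma addition_theorem:
  assumes "x \<in> unit_sphere {..d}"
  shows "(\<Sum>m\<in>I. (Y m x)\<^sup>2) = n"
proof -
  have "(\<integral>x. kernel_diag x \<partial>\<sigma>) = (\<Sum>m\<in>I. \<integral>x. Y m x * Y m x \<partial>\<sigma>)"
    unfolding kernel_diag_def power2_eq_square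
    by (intro Bochner_Integration.integral_sum integrable_Y_mult_Y)
  also have "\<dots> = n" by (simp add: Y_orthonormal)
  finally have "n = (\<integral>x. kernel_diag x \<partial>\<sigma>)" by simp
  also have "\<dots> = (\<integral>x. kernel_diag pole \<partial>\<sigma>)"
    by (intro Bochner_Integration.integral_cong refl) (simp add: space_\<sigma> kernel_diag_pole)
  also have "\<dots> = kernel_diag pole"
    using \<sigma>.prob_space by simp
  also have "\<dots> = kernel_diag x" by (rule kernel_diag_pole[OF assms, symmetric])
  finally show ?thesis by (simp add: kernel_diag_def)
qed

section \<open>Average correlations\<close>

text \<open>
  By the addition theorem these are the coordinates of a unit vector, so that for each \<open>x\<close> the
  combination with Gaussian coefficients is standard normal, and the scalar product at two points is
  the correlation.
\<close>

definition unit_vec :: "nat \<Rightarrow> (nat \<Rightarrow> real) \<Rightarrow> real"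
  where "unit_vec m x = Y m x / sqrt n"

lemma unit_vec_measurable [measurable]: "m \<in> I \<Longrightarrow> unit_vec m \<in> borel_measurable \<sigma>"
  unfolding unit_vec_def[abs_def] by measurable

lemma sum_unit_vec_square: "x \<in> space \<sigma> \<Longrightarrow> (\<Sum>m\<in>I. (unit_vec m x)\<^sup>2) = 1"
  using addition_theorem[of x] n_pos
  by (simp add: unit_vec_def power_divide sum_divide_distrib[symmetric] space_\<sigma>)

lemma integrable_Y: "m \<in> I \<Longrightarrow> integrable \<sigma> (Y m)"
  using \<sigma>.square_integrable_imp_integrable[OF Y_measurable, of m] integrable_Y_mult_Y[of m m]
  by (simp add: power2_eq_square)

text \<open>Bessel's inequality for the constant function \<open>1\<close>.\<close>

lemma sum_integral_Y_square_le: "(\<Sum>m\<in>I. (\<integral>x. Y m x \<partial>\<sigma>)\<^sup>2) \<le> 1"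
proof -
  define b where "b = (\<lambda>m. \<integral>x. Y m x \<partial>\<sigma>)"
  let ?f = "\<lambda>x. \<Sum>m\<in>I. b m * Y m x"
  have f: "integrable \<sigma> ?f"
    by (intro Bochner_Integration.integrable_sum integrable_mult_right integrable_Y)
  have "(\<integral>x. ?f x \<partial>\<sigma>) = (\<Sum>m\<in>I. \<integral>x. b m * Y m x \<partial>\<sigma>)"
    by (intro Bochner_Integration.integral_sum integrable_mult_right integrable_Y)
  also have "\<dots> = (\<Sum>m\<in>I. (b m)\<^sup>2)"
    by (simp add: b_def power2_eq_square)
  finally have f1: "(\<integral>x. ?f x \<partial>\<sigma>) = (\<Sum>m\<in>I. (b m)\<^sup>2)" .
  have "0 \<le> (\<integral>x. (1 - ?f x)\<^sup>2 \<partial>\<sigma>)" by simp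
  also have "\<dots> = (\<integral>x. 1 - 2 * ?f x + (?f x)\<^sup>2 \<partial>\<sigma>)"
    by (simp add: power2_diff algebra_simps)
  also have "\<dots> = (\<integral>x. 1 - 2 * ?f x \<partial>\<sigma>) + (\<integral>x. (?f x)\<^sup>2 \<partial>\<sigma>)"
    using f by (intro Bochner_Integration.integral_add integrable_sum_Y_square) simp
  also have "(\<integral>x. 1 - 2 * ?f x \<partial>\<sigma>) = 1 - 2 * (\<integral>x. ?f x \<partial>\<sigma>)"
    using f \<sigma>.prob_space by simp
  finally show ?thesis
    unfolding f1 integral_sum_Y_square by (simp add: b_def)
qed

lemma average_correlation:
  "(\<integral>x. \<integral>y. (\<Sum>m\<in>I. unit_vec m x * unit_vec m y) \<partial>\<sigma> \<partial>\<sigma>) =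
    (\<Sum>m\<in>I. (\<integral>x. Y m x \<partial>\<sigma>)\<^sup>2) / n"
proof -
  have "(\<integral>y. (\<Sum>m\<in>I. unit_vec m x * unit_vec m y) \<partial>\<sigma>) = (\<Sum>m\<in>I. Y m x * (\<integral>y. Y m y \<partial>\<sigma>) / n)" for x
  proof -
    have "(\<Sum>m\<in>I. unit_vec m x * unit_vec m y) = (\<Sum>m\<in>I. (Y m x / n) * Y m y)" for y
      by (simp add: unit_vec_def)
    then have "(\<integral>y. (\<Sum>m\<in>I. unit_vec m x * unit_vec m y) \<partial>\<sigma>) = (\<integral>y. (\<Sum>m\<in>I. (Y m x / n) * Y m y) \<partial>\<sigma>)"
      by simp
    also have "\<dots> = (\<Sum>m\<in>I. \<integral>y. (Y m x / n) * Y m y \<partial>\<sigma>)"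
      by (intro Bochner_Integration.integral_sum integrable_mult_right integrable_Y)
    finally show ?thesis by simp
  qed
  then have "(\<integral>x. \<integral>y. (\<Sum>m\<in>I. unit_vec m x * unit_vec m y) \<partial>\<sigma> \<partial>\<sigma>) =
      (\<integral>x. (\<Sum>m\<in>I. ((\<integral>y. Y m y \<partial>\<sigma>) / n) * Y m x) \<partial>\<sigma>)"
    by (simp add: mult.commute)
  also have "\<dots> = (\<Sum>m\<in>I. \<integral>x. ((\<integral>y. Y m y \<partial>\<sigma>) / n) * Y m x \<partial>\<sigma>)"
    by (intro Bochner_Integration.integral_sum integrable_mult_right integrable_Y)
  also have "\<dots> = (\<Sum>m\<in>I. (\<integral>x. Y m x \<partial>\<sigma>)\<^sup>2) / n"
    by (simp add: power2_eq_square sum_divide_distrib)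
  finally show ?thesis .
qed

text \<open>
  For fixed \<open>x\<close> the correlation is an eigenfunction of \<open>y\<close> whose coefficient vector has length \<open>1 / sqrt n\<close>.
\<close>

lemma average_squared_correlation:
  "(\<integral>x. \<integral>y. (\<Sum>m\<in>I. unit_vec m x * unit_vec m y)\<^sup>2 \<partial>\<sigma> \<partial>\<sigma>) = 1 / n"
proof -
  have "(\<integral>y. (\<Sum>m\<in>I. unit_vec m x * unit_vec m y)\<^sup>2 \<partial>\<sigma>) = 1 / n" if "x \<in> space \<sigma>" for x
  proof -
    have "(\<integral>y. (\<Sum>m\<in>I. unit_vec m x * unit_vec m y)\<^sup>2 \<partial>\<sigma>) = (\<integral>y. (\<Sum>m\<in>I. (unit_vec m x / sqrt n) * Y m y)\<^sup>2 \<partial>\<sigma>)"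
      by (simp add: unit_vec_def)
    also have "\<dots> = (\<Sum>m\<in>I. (unit_vec m x / sqrt n)\<^sup>2)"
      by (rule integral_sum_Y_square)
    also have "\<dots> = 1 / n"
      using sum_unit_vec_square[OF that] by (simp add: power_divide sum_divide_distrib[symmetric])
    finally show ?thesis .
  qed
  then show ?thesis
    using \<sigma>.prob_space by (simp cong: Bochner_Integration.integral_cong)
qed

text \<open>
  The distribution function, under the uniform measure on the sphere, of the eigenfunction with
  coefficient vector \<open>G / sqrt n\<close>.
\<close>

definition gauss_cdf :: "(nat \<Rightarrow> real) \<Rightarrow> real \<Rightarrow> real"
  where "gauss_cdf G u = (\<integral>x. indicator {..u} (\<Sum>m\<in>I. unit_vec m x * G m) \<partial>\<sigma>)"

lemma gauss_cdf_measurable [measurable]: "(\<lambda>G. gauss_cdf G u) \<in> borel_measurable (gauss I)"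
  unfolding gauss_cdf_def
  by (rule mean_square_discrepancy(1)[OF \<sigma>.prob_space_axioms finite_atLeastAtMost
      unit_vec_measurable sum_unit_vec_square])

lemma gauss_cdf_mean_square: "(\<integral>G. (gauss_cdf G u - normal_cdf u)\<^sup>2 \<partial>gauss I) \<le> 7 / n"
proof -
  have "(\<integral>G. (gauss_cdf G u - normal_cdf u)\<^sup>2 \<partial>gauss I) \<le>
      \<bar>(\<Sum>m\<in>I. (\<integral>x. Y m x \<partial>\<sigma>)\<^sup>2) / n\<bar> + 6 * (1 / n)"
    unfolding gauss_cdf_def average_correlation[symmetric] average_squared_correlation[symmetric]
    by (rule mean_square_discrepancy(2)[OF \<sigma>.prob_space_axioms finite_atLeastAtMost
      unit_vec_measurable sum_unit_vec_square])
  also have "\<bar>(\<Sum>m\<in>I. (\<integral>x. Y m x \<partial>\<sigma>)\<^sup>2) / n\<bar> \<le> 1 / n"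
    using sum_integral_Y_square_le by (simp add: sum_nonneg divide_right_mono)
  finally show ?thesis by simp
qed

end

section \<open>Kolmogorov distance on finitely many quantiles and at rational points\<close>

lemma normal_quantile:
  assumes "0 < t" "t < 1"
  obtains u where "normal_cdf u = t"
proof -
  have cont: "continuous_on A normal_cdf" for A
    by (intro continuous_at_imp_continuous_on ballI DERIV_isCont[OF DERIV_normal_cdf])
  have "eventually (\<lambda>x. normal_cdf x < t) at_bot" "eventually (\<lambda>x. t < normal_cdf x) at_top"
    using order_tendstoD(2)[OF N.cdf_lim_at_bot assms(1)] order_tendstoD(1)[OF N.cdf_lim_at_top_prob assms(2)]
    by auto
  then obtain a b where a: "normal_cdf a < t" and b: "t < normal_cdf b"
    by (auto simp: eventually_at_bot_linorder eventually_at_top_linorder)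
  have "a \<le> b"
    using a b N.cdf_nondecreasing[of b a] by linarith
  with IVT'[of normal_cdf a t b, OF _ _ _ cont] a b that show ?thesis by auto
qed

text \<open>
  Between two consecutive quantiles both distribution functions are monotone and \<open>normal_cdf\<close> grows by
  \<open>1 / k\<close> only, so closeness at the quantiles extends to the line.
\<close>

lemma Kolmogorov_grid:
  fixes D :: "real measure"
  assumes D: "real_distribution D" and k: "k \<ge> 1"
    and q: "\<And>i. i \<in> {1..<k} \<Longrightarrow> normal_cdf (q i) = real i / real k"
    and \<delta>: "\<delta> \<ge> 0" and close: "\<And>i. i \<in> {1..<k} \<Longrightarrow> \<bar>cdf D (q i) - normal_cdf (q i)\<bar> \<le> \<delta>"
  shows "\<bar>cdf D u - normal_cdf u\<bar> \<le> \<delta> + 1 / k"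
proof -
  interpret D: real_distribution D by (rule D)
  let ?t = "real k * normal_cdf u"
  have kpos: "real k > 0" using k by simp
  have upper: "cdf D u \<le> normal_cdf u + 1 / k + \<delta>"
  proof -
    define i where "i = nat \<lfloor>?t\<rfloor> + 1"
    have "?t \<ge> 0" using normal_cdf_bounds[of u] by simp
    then have i: "real i - 1 \<le> ?t" "?t < real i" "i \<ge> 1"
      by (simp_all add: i_def) linarith
    show ?thesis
    proof (cases "i < k")
      case True
      then have ik: "i \<in> {1..<k}" using i by simp
      have "normal_cdf u < normal_cdf (q i)"
        using i(2) kpos by (simp add: q[OF ik] pos_less_divide_eq mult.commute)
      then have "u \<le> q i" using N.cdf_nondecreasing[of "q i" u] by linarith
      then have "cdf D u \<le> cdf D (q i)" by (rule D.cdf_nondecreasing)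
      also have "\<dots> \<le> real i / k + \<delta>" using close[OF ik] q[OF ik] by linarith
      also have "real i / k \<le> normal_cdf u + 1 / k"
        using i(1) kpos by (simp add: field_simps)
      finally show ?thesis by simp
    next
      case False
      then have "real k \<le> ?t + 1" using i(1) by linarith
      then have "1 \<le> normal_cdf u + 1 / k" using kpos by (simp add: field_simps)
      then show ?thesis using D.cdf_bounded_prob[of u] \<delta> by linarith
    qed
  qed
  have lower: "normal_cdf u \<le> cdf D u + 1 / k + \<delta>"
  proof (cases "?t \<le> 1")
    case True
    then have "normal_cdf u \<le> 1 / k" using kpos by (simp add: field_simps)
    then show ?thesis using D.cdf_nonneg[of u] \<delta> by linarith
  next
    case False
    define i where "i = nat (\<lceil>?t\<rceil> - 1)"
    have "2 \<le> \<lceil>?t\<rceil>" using False by linarith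
    then have i: "real i < ?t" "?t \<le> real i + 1" "i \<ge> 1"
      by (simp_all add: i_def) linarith+
    have "?t \<le> real k" using normal_cdf_bounds[of u] kpos by (simp add: mult_left_le)
    then have ik: "i \<in> {1..<k}" using i by auto
    have "normal_cdf (q i) < normal_cdf u"
      using i(1) kpos by (simp add: q[OF ik] pos_divide_less_eq mult.commute)
    then have "q i \<le> u" using N.cdf_nondecreasing[of u "q i"] by linarith
    then have "cdf D (q i) \<le> cdf D u" by (rule D.cdf_nondecreasing)
    moreover have "real i / k \<le> cdf D (q i) + \<delta>" using close[OF ik] q[OF ik] by linarith
    moreover have "normal_cdf u \<le> real i / k + 1 / k"
      using i(2) kpos by (simp add: field_simps)
    ultimately show ?thesis by linarith
  qed
  from upper lower show ?thesis by (simp add: abs_le_iff)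
qed

text \<open>
  By right continuity a deviation persists on an interval; this makes the supremum over \<open>u\<close> measurable in
  the coefficients.
\<close>

lemma Kolmogorov_rational:
  assumes D: "real_distribution D" and u: "\<bar>cdf D u - normal_cdf u\<bar> > e"
  shows "\<exists>q\<in>\<rat>. \<bar>cdf D q - normal_cdf q\<bar> > e"
proof -
  interpret D: real_distribution D by (rule D)
  have "((\<lambda>v. \<bar>cdf D v - normal_cdf v\<bar>) \<longlongrightarrow> \<bar>cdf D u - normal_cdf u\<bar>) (at_right u)"
    using D.cdf_is_right_cont[of u] N.cdf_is_right_cont[of u]
    by (intro tendsto_intros) (simp_all add: continuous_within)
  then have "eventually (\<lambda>v. e < \<bar>cdf D v - normal_cdf v\<bar>) (at_right u)"
    using u by (rule order_tendstoD(1))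
  then obtain b where "b > u" "\<And>v. u < v \<Longrightarrow> v < b \<Longrightarrow> e < \<bar>cdf D v - normal_cdf v\<bar>"
    by (auto simp: eventually_at_right_field)
  moreover obtain q where "q \<in> \<rat>" "u < q" "q < b"
    using Rats_dense_in_real[OF \<open>b > u\<close>] by blast
  ultimately show ?thesis by blast
qed

section \<open>The bad coefficient vectors\<close>

context eigenbasis
begin

lemma real_distribution_gauss_cdf:
  "\<exists>D. real_distribution D \<and> cdf D = gauss_cdf G"
proof -
  let ?T = "\<lambda>x. \<Sum>m\<in>I. unit_vec m x * G m"
  have T [measurable]: "?T \<in> borel_measurable \<sigma>"
    by (intro borel_measurable_sum borel_measurable_times unit_vec_measurable) auto
  have "cdf (distr \<sigma> borel ?T) u = gauss_cdf G u" for u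
  proof -
    have "cdf (distr \<sigma> borel ?T) u = measure \<sigma> (?T -` {..u} \<inter> space \<sigma>)"
      unfolding cdf_def by (rule measure_distr) auto
    also have "\<dots> = (\<integral>x. indicator (?T -` {..u} \<inter> space \<sigma>) x \<partial>\<sigma>)"
      by simp
    also have "\<dots> = gauss_cdf G u"
      unfolding gauss_cdf_def by (intro Bochner_Integration.integral_cong) (auto simp: indicator_def)
    finally show ?thesis .
  qed
  then show ?thesis using \<sigma>.real_distribution_distr[OF T] by blast
qed

lemma gauss_cdf_bounds: "0 \<le> gauss_cdf G u" "gauss_cdf G u \<le> 1"
  using real_distribution_gauss_cdf[of G] real_distribution.cdf_bounded_prob
    finite_borel_measure.cdf_nonneg real_distribution.finite_borel_measure_M by metis+

lemma eigenfunction_cdf: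
  "(\<integral>x. indicator {..u} (random_eigenfunction l d Y \<alpha> x) \<partial>\<sigma>) = gauss_cdf \<alpha> (u / sqrt n)"
proof -
  have "(\<Sum>m\<in>I. unit_vec m x * \<alpha> m) = random_eigenfunction l d Y \<alpha> x / sqrt n" for x
    by (simp add: random_eigenfunction_def unit_vec_def sum_divide_distrib mult.commute)
  then show ?thesis
    unfolding gauss_cdf_def using n_pos by (simp add: indicator_def divide_le_cancel)
qed

lemma d_Kol_less_iff:
  "e < d_Kol d (random_eigenfunction l d Y \<alpha>) \<longleftrightarrow>
    (\<exists>u. e < \<bar>gauss_cdf \<alpha> (u / sqrt n) - normal_cdf u\<bar>)"
proof -
  have "\<bar>gauss_cdf \<alpha> (u / sqrt n) - normal_cdf u\<bar> \<le> 1" for u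
    using gauss_cdf_bounds[of \<alpha> "u / sqrt n"] normal_cdf_bounds[of u] by linarith
  then have "bdd_above (range (\<lambda>u. \<bar>gauss_cdf \<alpha> (u / sqrt n) - normal_cdf u\<bar>))"
    by (intro bdd_aboveI[of _ 1]) auto
  then show ?thesis
    unfolding d_Kol_def eigenfunction_cdf by (subst less_cSUP_iff) auto
qed

lemma real_distribution_eigenfunction:
  "\<exists>D. real_distribution D \<and> cdf D = (\<lambda>u. gauss_cdf \<alpha> (u / sqrt n))"
proof -
  obtain D where D: "real_distribution D" "cdf D = gauss_cdf \<alpha>"
    using real_distribution_gauss_cdf by blast
  interpret D: real_distribution D by (rule D(1))
  have m: "(\<lambda>x. x * sqrt n) \<in> borel_measurable D" by simp
  have "cdf (distr D borel (\<lambda>x. x * sqrt n)) u = gauss_cdf \<alpha> (u / sqrt n)" for u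
  proof -
    have "cdf (distr D borel (\<lambda>x. x * sqrt n)) u = measure D ((\<lambda>x. x * sqrt n) -` {..u} \<inter> space D)"
      unfolding cdf_def by (rule measure_distr[OF m]) simp
    also have "(\<lambda>x. x * sqrt n) -` {..u} \<inter> space D = {..u / sqrt n}"
      using n_pos by (auto simp: pos_le_divide_eq)
    finally show ?thesis by (simp add: D(2)[symmetric] cdf_def)
  qed
  then show ?thesis using D.real_distribution_distr[OF m] by blast
qed

lemma bad_coeffs_sets: "bad_coeffs l d Y e \<in> sets (sphere_measure I)"
proof -
  let ?A = "\<lambda>q. {G \<in> space (gauss I). e < \<bar>gauss_cdf G (q / sqrt n) - normal_cdf q\<bar>}"
  have "bad_coeffs l d Y e = unit_sphere I \<inter> (\<Union>q\<in>\<rat>. ?A q)"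
  proof -
    have "(\<exists>u. e < \<bar>gauss_cdf \<alpha> (u / sqrt n) - normal_cdf u\<bar>) \<longleftrightarrow>
        (\<exists>q\<in>\<rat>. e < \<bar>gauss_cdf \<alpha> (q / sqrt n) - normal_cdf q\<bar>)" for \<alpha>
      using real_distribution_eigenfunction[of \<alpha>] Kolmogorov_rational by metis
    then show ?thesis
      unfolding bad_coeffs_def d_Kol_less_iff
      by (auto simp: space_gauss unit_sphere_def)
  qed
  moreover have "(\<Union>q\<in>\<rat>. ?A q) \<in> sets (gauss I)"
    by (rule sets.countable_UN''[OF countable_rat]) measurable
  ultimately show ?thesis
    using unit_sphere_sets[of I] by (auto simp: sets_sphere_measure sets_restrict_space sets_gauss)
qed

text \<open>
  With \<open>R\<close> the norm of \<open>G\<close>, the coefficient vectors \<open>G / R\<close> and \<open>G / sqrt n\<close> differ by the factor \<open>sqrt n / R\<close>.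
  Since the deviation of \<open>gauss_cdf G\<close> is bounded at all arguments, only the change of scale in the normal
  distribution function has to be paid for.
\<close>

lemma d_Kol_radial:
  assumes G: "G \<in> I \<rightarrow>\<^sub>E UNIV" "L2_set G I \<noteq> 0"
    and sup: "\<And>v. \<bar>gauss_cdf G v - normal_cdf v\<bar> \<le> c"
  shows "\<bar>gauss_cdf (normalize_vec I G) (u / sqrt n) - normal_cdf u\<bar> \<le>
    c + 2 * \<bar>(\<Sum>i\<in>I. (G i)\<^sup>2) / n - 1\<bar>"
proof -
  define R where "R = L2_set G I"
  define r where "r = R / sqrt n"
  have R: "R > 0" using G(2) L2_set_nonneg[of G I] unfolding R_def by linarith
  have n: "sqrt n > 0" using n_pos by simp
  have r: "r > 0" using R n by (simp add: r_def)
  have r2: "r\<^sup>2 = (\<Sum>i\<in>I. (G i)\<^sup>2) / n"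
    by (simp add: r_def R_def L2_set_def power_divide sum_nonneg)
  have "(\<Sum>m\<in>I. unit_vec m x * normalize_vec I G m) = (\<Sum>m\<in>I. unit_vec m x * G m) / R" for x
    by (simp add: normalize_vec_def R_def sum_divide_distrib)
  moreover have "t / R \<le> u / sqrt n \<longleftrightarrow> t \<le> u * r" for t
    using R by (simp add: r_def pos_divide_le_eq)
  ultimately have eq: "gauss_cdf (normalize_vec I G) (u / sqrt n) = gauss_cdf G (u * r)"
    unfolding gauss_cdf_def by (simp add: indicator_def)
  have le: "\<bar>r - 1\<bar> \<le> \<bar>r\<^sup>2 - 1\<bar>"
  proof -
    have "\<bar>r\<^sup>2 - 1\<bar> = \<bar>r - 1\<bar> * (r + 1)"
    proof -
      have "r\<^sup>2 - 1 = (r - 1) * (r + 1)"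
        by (simp add: power2_eq_square algebra_simps)
      then show ?thesis using r by (simp only: abs_mult)
    qed
    moreover have "\<bar>r - 1\<bar> * 1 \<le> \<bar>r - 1\<bar> * (r + 1)" using r by (intro mult_left_mono) auto
    ultimately show ?thesis by simp
  qed
  have "\<bar>a - b\<bar> \<le> c + 2 * t" if "\<bar>a - b'\<bar> \<le> c" "\<bar>b' - b\<bar> \<le> 2 * s" "s \<le> t" for a b b' s t
    using that by linarith
  from this[OF sup normal_cdf_scale[OF r] le] show ?thesis
    unfolding eq r2 .
qed

lemma prob_gauss_cdf_deviation:
  fixes \<delta> :: real
  assumes "\<delta> > 0"
  shows "measure (gauss I) {G \<in> space (gauss I). \<bar>gauss_cdf G u - normal_cdf u\<bar> > \<delta>} \<le> 7 / (n * \<delta>\<^sup>2)"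
proof -
  interpret G: prob_space "gauss I" by (rule prob_space_gauss)
  let ?f = "\<lambda>G. (gauss_cdf G u - normal_cdf u)\<^sup>2"
  have f: "integrable (gauss I) ?f"
  proof (rule G.integrable_const_bound[where B = 1])
    have "\<bar>gauss_cdf G u - normal_cdf u\<bar> \<le> 1" for G
      using gauss_cdf_bounds[of G u] normal_cdf_bounds[of u] by linarith
    then show "AE G in gauss I. norm (?f G) \<le> 1"
      by (intro AE_I2) (simp add: abs_square_le_1)
  qed measurable
  have "measure (gauss I) {G \<in> space (gauss I). \<bar>gauss_cdf G u - normal_cdf u\<bar> > \<delta>} \<le>
      measure (gauss I) {G \<in> space (gauss I). ?f G \<ge> \<delta>\<^sup>2}"
  proof (rule G.finite_measure_mono)
    show "{G \<in> space (gauss I). \<bar>gauss_cdf G u - normal_cdf u\<bar> > \<delta>} \<subseteq> {G \<in> space (gauss I). ?f G \<ge> \<delta>\<^sup>2}"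
      using assms by (auto simp: abs_le_square_iff[symmetric])
  qed measurable
  also have "\<dots> \<le> (\<integral>G. ?f G \<partial>gauss I) / \<delta>\<^sup>2"
    using assms by (intro integral_Markov_inequality_measure[OF f sets.empty_sets]) auto
  also have "\<dots> \<le> (7 / n) / \<delta>\<^sup>2"
    using gauss_cdf_mean_square[of u] by (intro divide_right_mono) auto
  finally show ?thesis by simp
qed

lemma prob_square_norm_deviation:
  fixes \<delta> :: real
  assumes "\<delta> > 0"
  shows "measure (gauss I) {G \<in> space (gauss I). \<bar>(\<Sum>i\<in>I. (G i)\<^sup>2) / n - 1\<bar> > \<delta>} \<le> 2 / (n * \<delta>\<^sup>2)"
proof -
  interpret G: prob_space "gauss I" by (rule prob_space_gauss)
  have n: "real n > 0" using n_pos by simp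
  let ?S = "\<lambda>G :: nat \<Rightarrow> real. \<Sum>i\<in>I. (G i)\<^sup>2"
  have var: "integrable (gauss I) (\<lambda>G. (?S G - n)\<^sup>2)" "(\<integral>G. (?S G - n)\<^sup>2 \<partial>gauss I) = 2 * n"
    using gauss_square_norm_variance[of I] by simp_all
  have key: "(n * \<delta>)\<^sup>2 \<le> (?S G - n)\<^sup>2" if "\<delta> < \<bar>?S G / n - 1\<bar>" for G :: "nat \<Rightarrow> real"
  proof -
    have "n * \<delta> < n * \<bar>?S G / n - 1\<bar>" using n that by simp
    also have "\<dots> = \<bar>n * (?S G / n - 1)\<bar>" using n by (simp add: abs_mult)
    also have "n * (?S G / n - 1) = ?S G - n" using n by (simp add: field_simps)
    finally show ?thesis
      using n assms by (simp add: abs_le_square_iff[symmetric])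
  qed
  have "measure (gauss I) {G \<in> space (gauss I). \<bar>?S G / n - 1\<bar> > \<delta>} \<le>
      measure (gauss I) {G \<in> space (gauss I). (?S G - n)\<^sup>2 \<ge> (n * \<delta>)\<^sup>2}"
  proof (rule G.finite_measure_mono)
    show "{G \<in> space (gauss I). \<bar>?S G / n - 1\<bar> > \<delta>} \<subseteq> {G \<in> space (gauss I). (?S G - n)\<^sup>2 \<ge> (n * \<delta>)\<^sup>2}"
      using key by blast
  qed measurable
  also have "\<dots> \<le> (\<integral>G. (?S G - n)\<^sup>2 \<partial>gauss I) / (n * \<delta>)\<^sup>2"
    using assms n by (intro integral_Markov_inequality_measure[OF var(1) sets.empty_sets]) auto
  also have "\<dots> = 2 / (n * \<delta>\<^sup>2)"
    unfolding var(2) using n assms by (simp add: power2_eq_square field_simps)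
  finally show ?thesis .
qed

text \<open>
  Chebyshev's inequality at the \<open>k - 1 \<le> 4 / e\<close> interior quantiles and for the norm.  The deviation \<open>e\<close> exceeds
  the sum of \<open>e / 4\<close> at the quantiles, \<open>1 / k \<le> e / 4\<close> between them and twice \<open>e / 8\<close> for the norm; the
  constant is \<open>576 = 4 * 7 * 16 + 2 * 64\<close>.
\<close>

lemma prob_bad_coeffs:
  fixes e :: real
  assumes e: "e > 0"
  shows "measure (sphere_measure I) (bad_coeffs l d Y e) \<le> 576 / (n * e ^ 3)"
proof (cases "e < 1")
  case False
  have "\<not> e < \<bar>gauss_cdf \<alpha> (u / sqrt n) - normal_cdf u\<bar>" for \<alpha> u
    using False gauss_cdf_bounds[of \<alpha> "u / sqrt n"] normal_cdf_bounds[of u] by linarith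
  then have "bad_coeffs l d Y e = {}"
    by (simp add: bad_coeffs_def d_Kol_less_iff)
  then show ?thesis using e by simp
next
  case True
  interpret G: prob_space "gauss I" by (rule prob_space_gauss)
  have n: "real n > 0" using n_pos by simp
  define k where "k = nat \<lceil>4 / e\<rceil>"
  have k: "4 / e \<le> real k" "real k \<le> 4 / e + 1" "k \<ge> 1"
  proof -
    have "4 / e > 0" using e by simp
    then show "4 / e \<le> real k" "real k \<le> 4 / e + 1" "k \<ge> 1"
      unfolding k_def by linarith+
  qed
  have ke: "1 / real k \<le> e / 4"
    using k e by (simp add: field_simps)
  have "\<exists>u. normal_cdf u = real i / real k" if "i \<in> {1..<k}" for i
    using that normal_quantile[of "real i / real k"] by force
  then obtain q where q: "\<And>i. i \<in> {1..<k} \<Longrightarrow> normal_cdf (q i) = real i / real k"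
    by metis
  let ?E = "\<lambda>i. {G \<in> space (gauss I). \<bar>gauss_cdf G (q i) - normal_cdf (q i)\<bar> > e / 4}"
  let ?N = "{G \<in> space (gauss I). \<bar>(\<Sum>i\<in>I. (G i)\<^sup>2) / n - 1\<bar> > e / 8}"
  have sub: "{G \<in> I \<rightarrow>\<^sub>E UNIV. normalize_vec I G \<in> bad_coeffs l d Y e} \<subseteq> ?N \<union> (\<Union>i\<in>{1..<k}. ?E i)"
  proof (rule subsetI, rule UnCI)
    fix G assume "G \<in> {G \<in> I \<rightarrow>\<^sub>E UNIV. normalize_vec I G \<in> bad_coeffs l d Y e}"
      and not_E: "G \<notin> (\<Union>i\<in>{1..<k}. ?E i)"
    then have G: "G \<in> I \<rightarrow>\<^sub>E UNIV" and bad: "normalize_vec I G \<in> bad_coeffs l d Y e"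
      by simp_all
    have L: "L2_set G I \<noteq> 0"
    proof
      assume "L2_set G I = 0"
      then have "L2_set (normalize_vec I G) I = 0"
        by (simp add: normalize_vec_def L2_set_def)
      with bad show False by (simp add: bad_coeffs_def unit_sphere_def)
    qed
    obtain D where D: "real_distribution D" "cdf D = gauss_cdf G"
      using real_distribution_gauss_cdf by blast
    have "\<bar>gauss_cdf G v - normal_cdf v\<bar> \<le> e / 4 + 1 / k" for v
      unfolding D(2)[symmetric]
      by (rule Kolmogorov_grid[OF D(1) k(3) q])
         (use e not_E G in \<open>auto simp: D(2) space_gauss not_less\<close>)
    note * = d_Kol_radial[OF G L this]
    obtain u where u: "e < \<bar>gauss_cdf (normalize_vec I G) (u / sqrt n) - normal_cdf u\<bar>"
      using bad by (auto simp: bad_coeffs_def d_Kol_less_iff)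
    have "e / 8 < t" if "x \<le> e / 4 + y + 2 * t" "y \<le> e / 4" "e < x" for x y t
      using that e by linarith
    from this[OF *[of u] ke u] have "\<bar>(\<Sum>i\<in>I. (G i)\<^sup>2) / n - 1\<bar> > e / 8" .
    with G show "G \<in> ?N" by (simp add: space_gauss)
  qed
  have E_sets [measurable]: "?E i \<in> sets (gauss I)" for i by measurable
  have N_sets [measurable]: "?N \<in> sets (gauss I)" by measurable
  have "measure (sphere_measure I) (bad_coeffs l d Y e) =
      measure (gauss I) {G \<in> I \<rightarrow>\<^sub>E UNIV. normalize_vec I G \<in> bad_coeffs l d Y e}"
    using emeasure_sphere_measure[OF _ bad_coeffs_sets] by (simp add: measure_def)
  also have "\<dots> \<le> measure (gauss I) (?N \<union> (\<Union>i\<in>{1..<k}. ?E i))"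
    by (rule G.finite_measure_mono[OF sub]) measurable
  also have "\<dots> \<le> measure (gauss I) ?N + measure (gauss I) (\<Union>i\<in>{1..<k}. ?E i)"
    by (rule measure_Un_le) measurable
  also have "measure (gauss I) (\<Union>i\<in>{1..<k}. ?E i) \<le> (\<Sum>i\<in>{1..<k}. measure (gauss I) (?E i))"
    by (rule measure_UNION_le[OF finite_atLeastLessThan E_sets])
  also have "\<dots> \<le> (\<Sum>i\<in>{1..<k}. 7 / (n * (e / 4)\<^sup>2))"
    by (rule sum_mono, rule prob_gauss_cdf_deviation) (use e in simp)
  also have "\<dots> = (real k - 1) * (7 / (n * (e / 4)\<^sup>2))"
    using k(3) by (simp add: of_nat_diff)
  also have "\<dots> \<le> (4 / e) * (7 / (n * (e / 4)\<^sup>2))"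
    using k(2) n by (intro mult_right_mono) auto
  also have "\<dots> = 448 / (n * e ^ 3)"
    using e n by (simp add: power2_eq_square power3_eq_cube field_simps)
  also have "measure (gauss I) ?N \<le> 2 / (n * (e / 8)\<^sup>2)"
    by (rule prob_square_norm_deviation) (use e in simp)
  also have "\<dots> = 128 * e / (n * e ^ 3)"
    using e n by (simp add: power2_eq_square power3_eq_cube field_simps)
  also have "\<dots> \<le> 128 / (n * e ^ 3)"
    using e n True by (intro divide_right_mono) auto
  finally show ?thesis by (simp add: add_divide_distrib[symmetric])
qed

end

section \<open>Growth of the eigenspace dimensions\<close>

text \<open>
  Both bounds come from the summand \<open>(l + d - 1) choose l\<close> of the dimension, read from either side of
  Pascal's triangle.
\<close>

lemma eigendim_ge_degree:
  assumes "l \<ge> 1" "d \<ge> 2"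
  shows "(real l / real (d - 1)) ^ (d - 1) \<le> real (eigendim l d)"
proof -
  have "(real l / real (d - 1)) ^ (d - 1) \<le> (real (l + d - 1) / real (d - 1)) ^ (d - 1)"
    using assms by (intro power_mono divide_right_mono) auto
  also have "\<dots> \<le> real ((l + d - 1) choose (d - 1))"
    by (rule binomial_ge_n_over_k_pow_k) simp
  also have "(l + d - 1) choose (d - 1) = (l + d - 1) choose l"
    using assms binomial_symmetric[of l "l + d - 1"] by simp
  also have "real ((l + d - 1) choose l) \<le> real (eigendim l d)"
    using assms by (simp add: eigendim_altdef)
  finally show ?thesis .
qed

lemma eigendim_ge_dimension:
  assumes "l \<ge> 1" "d \<ge> 1"
  shows "(real d / real l) ^ l \<le> real (eigendim l d)"
proof -
  have "(real d / real l) ^ l \<le> (real (l + d - 1) / real l) ^ l"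
    using assms by (intro power_mono divide_right_mono) auto
  also have "\<dots> \<le> real ((l + d - 1) choose l)"
    using assms by (intro binomial_ge_n_over_k_pow_k) simp
  also have "\<dots> \<le> real (eigendim l d)"
    using assms by (simp add: eigendim_altdef)
  finally show ?thesis .
qed

lemma bigo_of_power_lower_bound:
  fixes N :: "nat \<Rightarrow> real" and c K :: real and \<epsilon> :: "nat \<Rightarrow> real"
  assumes "\<And>j. j \<ge> 1 \<Longrightarrow> (real j / c) ^ p \<le> N j" "\<And>j. j \<ge> 1 \<Longrightarrow> \<epsilon> j > 0" "c > 0" "K \<ge> 0"
  shows "(\<lambda>j. K / (N j * \<epsilon> j ^ 3)) \<in> O(\<lambda>j. 1 / (real j ^ p * \<epsilon> j ^ 3))"
proof (rule bigoI[where c = "K * c ^ p"])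
  have "norm (K / (N j * \<epsilon> j ^ 3)) \<le> K * c ^ p * norm (1 / (real j ^ p * \<epsilon> j ^ 3))" if j: "j \<ge> 1" for j
  proof -
    have pos: "(real j / c) ^ p > 0" "\<epsilon> j ^ 3 > 0" using assms j by auto
    then have Nj: "N j > 0" using assms(1)[OF j] by linarith
    have "K / (N j * \<epsilon> j ^ 3) \<le> K / ((real j / c) ^ p * \<epsilon> j ^ 3)"
      using assms(1)[OF j] assms(4) pos Nj by (intro divide_left_mono mult_right_mono mult_pos_pos) auto
    also have "\<dots> = K * c ^ p * (1 / (real j ^ p * \<epsilon> j ^ 3))"
      using assms(3) by (simp add: power_divide)
    finally show ?thesis
      using assms(2)[OF j] assms(4) Nj by simp
  qed
  then show "eventually (\<lambda>j. norm (K / (N j * \<epsilon> j ^ 3)) \<le> K * c ^ p * norm (1 / (real j ^ p * \<epsilon> j ^ 3))) at_top"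
    by (auto intro!: eventually_at_top_linorderI[of 1])
qed

theorem theorem16:
  shows "(\<exists>K::real. \<forall>d\<ge>2. \<forall>(Y :: nat \<Rightarrow> nat \<Rightarrow> (nat \<Rightarrow> real) \<Rightarrow> real) (\<epsilon> :: nat \<Rightarrow> real).
            (\<forall>l\<ge>1. orthonormal_eigenbasis l d (Y l)) \<longrightarrow> (\<forall>l\<ge>1. \<epsilon> l > 0) \<longrightarrow>
              (\<forall>l\<ge>1. bad_coeffs l d (Y l) (\<epsilon> l) \<in> sets (coeff_measure l d) \<and>
                 measure (coeff_measure l d) (bad_coeffs l d (Y l) (\<epsilon> l))
                   \<le> K / (real (eigendim l d) * \<epsilon> l ^ 3)) \<and>
              (\<lambda>l. K / (real (eigendim l d) * \<epsilon> l ^ 3)) \<in> O(\<lambda>l. 1 / (real l ^ (d - 1) * \<epsilon> l ^ 3)))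
       \<and> (\<exists>K'::real. \<forall>l\<ge>1. \<forall>(Y :: nat \<Rightarrow> nat \<Rightarrow> (nat \<Rightarrow> real) \<Rightarrow> real) (\<epsilon> :: nat \<Rightarrow> real).
            (\<forall>d\<ge>1. orthonormal_eigenbasis l d (Y d)) \<longrightarrow> (\<forall>d\<ge>1. \<epsilon> d > 0) \<longrightarrow>
              (\<forall>d\<ge>1. bad_coeffs l d (Y d) (\<epsilon> d) \<in> sets (coeff_measure l d) \<and>
                 measure (coeff_measure l d) (bad_coeffs l d (Y d) (\<epsilon> d))
                   \<le> K' / (real (eigendim l d) * \<epsilon> d ^ 3)) \<and>
              (\<lambda>d. K' / (real (eigendim l d) * \<epsilon> d ^ 3)) \<in> O(\<lambda>d. 1 / (real d ^ l * \<epsilon> d ^ 3)))"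
proof -
  have bound: "bad_coeffs l d Y e \<in> sets (coeff_measure l d) \<and>
      measure (coeff_measure l d) (bad_coeffs l d Y e) \<le> 576 / (real (eigendim l d) * e ^ 3)"
    if "l \<ge> 1" "d \<ge> 1" "orthonormal_eigenbasis l d Y" "e > 0" for l d Y e
  proof -
    interpret eigenbasis l d Y by unfold_locales (use that in auto)
    show ?thesis
      using bad_coeffs_sets prob_bad_coeffs[OF that(4)] by (simp add: coeff_measure_def)
  qed
  show ?thesis
  proof (intro conjI exI[of _ "576 :: real"] allI impI)
    fix d and \<epsilon> :: "nat \<Rightarrow> real" assume d: "d \<ge> (2::nat)" and \<epsilon>: "\<forall>l\<ge>1. \<epsilon> l > 0"
    show "(\<lambda>l. 576 / (real (eigendim l d) * \<epsilon> l ^ 3)) \<in> O(\<lambda>l. 1 / (real l ^ (d - 1) * \<epsilon> l ^ 3))"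
      using d \<epsilon> by (intro bigo_of_power_lower_bound[where c = "real (d - 1)"] eigendim_ge_degree) auto
  next
    fix l and \<epsilon> :: "nat \<Rightarrow> real" assume l: "l \<ge> (1::nat)" and \<epsilon>: "\<forall>d\<ge>1. \<epsilon> d > 0"
    show "(\<lambda>d. 576 / (real (eigendim l d) * \<epsilon> d ^ 3)) \<in> O(\<lambda>d. 1 / (real d ^ l * \<epsilon> d ^ 3))"
      using l \<epsilon> by (intro bigo_of_power_lower_bound[where c = "real l"] eigendim_ge_dimension) auto
  qed (use bound in auto)
qed

end
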